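(* Let $H$ be a finite-dimensional hereditary algebra over a field, let $\overline T$ be an almost complete basic tilting object in the cluster category $\mathcal C=D^b(H)/F$, and let $M$ be a complement of $\overline T$. Let $f:B\to M$ be a minimal right $\operatorname{add}\overline T$-approximation of $M$ in $\mathcal C$, and complete it to a triangle $M^{\ast}\to B\xrightarrow{f} M\to M^{\ast}[1]$ in $\mathcal C$. Then $M^{\ast}$ is another complement of $\overline T$ (that is, $M^{\ast}$ is a complement of $\overline T$ and $M^{\ast}\not\simeq M$).
   Context: Let $\mathcal D=D^b(H)$ be the bounded derived category of finitely generated $H$-modules, with shift $[1]$ and Auslander–Reiten translation $\tau$ (an autoequivalence), and let $F=\tau^{-1}[1]$. The cluster category $\mathcal C=\mathcal D/F$ has as objects the $F$-orbits $\widetilde X$ of objects $X$ of $\mathcal D$, and $\operatorname{Hom}_{\mathcal C}(\widetilde X,\widetilde Y)=\coprod_{i\in\mathbb Z}\operatorname{Hom}_{\mathcal D}(F^iX,Y)$. It is a Krull–Schmidt triangulated category, with shift induced by $[1]$, and $\mathcal D\to\mathcal C$ is a triangle functor. Put $\operatorname{Ext}^1_{\mathcal C}(U,V)=\operatorname{Hom}_{\mathcal C}(U,V[1])$. An object $T$ of $\mathcal C$ is exceptional if $\operatorname{Ext}^1_{\mathcal C}(T,T)=0$, and a tilting object if it is exceptional and has a maximal number of non-isomorphic indecomposable direct summands; it is basic if its indecomposable summands are pairwise non-isomorphic. Maximality is understood so that a basic object is a tilting object if and only if the set of its indecomposable summands is maximal (under inclusion) among sets of non-isomorphic indecomposables with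 pairwise (including self) vanishing $\operatorname{Ext}^1_{\mathcal C}$. A basic exceptional object $\overline T$ is an almost complete basic tilting object if there is an indecomposable $M$ with $\overline T\coprod M$ a basic tilting object; any such $M$ is called a complement of $\overline T$. A right $\operatorname{add}\overline T$-approximation of $M$ is a map $f:B\to M$ with $B\in\operatorname{add}\overline T$ such that $\operatorname{Hom}_{\mathcal C}(X,B)\to\operatorname{Hom}_{\mathcal C}(X,M)$ is surjective for all $X\in\operatorname{add}\overline T$; it is minimal if every $g:B\to B$ with $fg=f$ is an isomorphism. *)

theory Defs
  imports Complex_Main "HOL-Algebra.FiniteProduct"
begin

section \<open>Linear categories\<close>

record ('k, 'o, 'a) lincat =
  Obj :: "'o set"
  Hom :: "'o \<Rightarrow> 'o \<Rightarrow> 'a set"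
  Idn :: "'o \<Rightarrow> 'a"
  Cmp :: "'a \<Rightarrow> 'a \<Rightarrow> 'a" (infixl "\<cdot>\<index>" 75)
  Zer :: "'o \<Rightarrow> 'o \<Rightarrow> 'a"
  Add :: "'a \<Rightarrow> 'a \<Rightarrow> 'a" (infixl "\<oplus>\<index>" 65)
  Scl :: "'k \<Rightarrow> 'a \<Rightarrow> 'a" (infixr "\<odot>\<index>" 80)

text \<open>The composite \<open>g \<cdot> f\<close> is \<open>f\<close> followed by \<open>g\<close>. The additive group \<open>Hom C X Y\<close> is packaged as
  a multiplicative monoid record so that \<^const>\<open>finprod\<close> gives finite sums of morphisms.\<close>

definition hom_group :: "('k, 'o, 'a) lincat \<Rightarrow> 'o \<Rightarrow> 'o \<Rightarrow> 'a monoid" where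
  "hom_group C X Y = \<lparr>carrier = Hom C X Y, monoid.mult = Add C, one = Zer C X Y\<rparr>"

abbreviation hom_sum :: "('k, 'o, 'a) lincat \<Rightarrow> 'o \<Rightarrow> 'o \<Rightarrow> ('i \<Rightarrow> 'a) \<Rightarrow> 'i set \<Rightarrow> 'a" where
  "hom_sum C X Y \<equiv> finprod (hom_group C X Y)"

locale linear_category =
  fixes C :: "('k::field, 'o, 'a) lincat" (structure)
  assumes hom_obj: "f \<in> Hom C X Y \<Longrightarrow> X \<in> Obj C \<and> Y \<in> Obj C"
    and hom_disjoint: "f \<in> Hom C X Y \<Longrightarrow> f \<in> Hom C X' Y' \<Longrightarrow> X = X' \<and> Y = Y'"
    and idn_hom: "X \<in> Obj C \<Longrightarrow> Idn C X \<in> Hom C X X"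
    and cmp_hom: "f \<in> Hom C X Y \<Longrightarrow> g \<in> Hom C Y Z \<Longrightarrow> g \<cdot> f \<in> Hom C X Z"
    and cmp_idn: "f \<in> Hom C X Y \<Longrightarrow> f \<cdot> Idn C X = f"
    and idn_cmp: "f \<in> Hom C X Y \<Longrightarrow> Idn C Y \<cdot> f = f"
    and cmp_assoc: "f \<in> Hom C W X \<Longrightarrow> g \<in> Hom C X Y \<Longrightarrow> h \<in> Hom C Y Z
                      \<Longrightarrow> (h \<cdot> g) \<cdot> f = h \<cdot> (g \<cdot> f)"
    and hom_comm_group: "X \<in> Obj C \<Longrightarrow> Y \<in> Obj C \<Longrightarrow> comm_group (hom_group C X Y)"
    and scl_hom: "f \<in> Hom C X Y \<Longrightarrow> a \<odot> f \<in> Hom C X Y"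
    and scl_add: "f \<in> Hom C X Y \<Longrightarrow> g \<in> Hom C X Y \<Longrightarrow> a \<odot> (f \<oplus> g) = a \<odot> f \<oplus> a \<odot> g"
    and add_scl: "f \<in> Hom C X Y \<Longrightarrow> (a + b) \<odot> f = a \<odot> f \<oplus> b \<odot> f"
    and scl_scl: "f \<in> Hom C X Y \<Longrightarrow> a \<odot> b \<odot> f = (a * b) \<odot> f"
    and scl_one: "f \<in> Hom C X Y \<Longrightarrow> 1 \<odot> f = f"
    and cmp_add: "f \<in> Hom C X Y \<Longrightarrow> f' \<in> Hom C X Y \<Longrightarrow> g \<in> Hom C Y Z
                    \<Longrightarrow> g \<cdot> (f \<oplus> f') = g \<cdot> f \<oplus> g \<cdot> f'"
    and add_cmp: "f \<in> Hom C X Y \<Longrightarrow> g \<in> Hom C Y Z \<Longrightarrow> g' \<in> Hom C Y Z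
                    \<Longrightarrow> (g \<oplus> g') \<cdot> f = g \<cdot> f \<oplus> g' \<cdot> f"
    and cmp_scl: "f \<in> Hom C X Y \<Longrightarrow> g \<in> Hom C Y Z \<Longrightarrow> g \<cdot> (a \<odot> f) = a \<odot> (g \<cdot> f)"
    and scl_cmp: "f \<in> Hom C X Y \<Longrightarrow> g \<in> Hom C Y Z \<Longrightarrow> (a \<odot> g) \<cdot> f = a \<odot> (g \<cdot> f)"

definition is_iso :: "('k, 'o, 'a) lincat \<Rightarrow> 'o \<Rightarrow> 'o \<Rightarrow> 'a \<Rightarrow> bool" where
  "is_iso C X Y f \<longleftrightarrow> f \<in> Hom C X Y \<and>
     (\<exists>g \<in> Hom C Y X. g \<cdot>\<^bsub>C\<^esub> f = Idn C X \<and> f \<cdot>\<^bsub>C\<^esub> g = Idn C Y)"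

definition isomorphic :: "('k, 'o, 'a) lincat \<Rightarrow> 'o \<Rightarrow> 'o \<Rightarrow> bool" where
  "isomorphic C X Y \<longleftrightarrow> (\<exists>f. is_iso C X Y f)"

text \<open>\<open>S\<close> is a direct sum (biproduct) of the objects in the list \<open>Xs\<close>; for \<open>Xs = []\<close> this says that
  \<open>S\<close> is a zero object.\<close>

definition direct_sum :: "('k, 'o, 'a) lincat \<Rightarrow> 'o list \<Rightarrow> 'o \<Rightarrow> bool" where
  "direct_sum C Xs S \<longleftrightarrow> S \<in> Obj C \<and> set Xs \<subseteq> Obj C \<and>
     (\<exists>\<iota> \<pi>. (\<forall>i < length Xs. \<iota> i \<in> Hom C (Xs ! i) S \<and> \<pi> i \<in> Hom C S (Xs ! i)) \<and>
       (\<forall>i < length Xs. \<forall>j < length Xs.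
          \<pi> i \<cdot>\<^bsub>C\<^esub> \<iota> j = (if i = j then Idn C (Xs ! i) else Zer C (Xs ! j) (Xs ! i))) \<and>
       hom_sum C S S (\<lambda>i. \<iota> i \<cdot>\<^bsub>C\<^esub> \<pi> i) {..<length Xs} = Idn C S)"

definition zero_object :: "('k, 'o, 'a) lincat \<Rightarrow> 'o \<Rightarrow> bool" where
  "zero_object C X \<longleftrightarrow> X \<in> Obj C \<and> Idn C X = Zer C X X"

definition summand :: "('k, 'o, 'a) lincat \<Rightarrow> 'o \<Rightarrow> 'o \<Rightarrow> bool" where
  "summand C X S \<longleftrightarrow> (\<exists>Y. direct_sum C [X, Y] S)"

definition indecomposable :: "('k, 'o, 'a) lincat \<Rightarrow> 'o \<Rightarrow> bool" where
  "indecomposable C X \<longleftrightarrow> X \<in> Obj C \<and> \<not> zero_object C X \<and>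
     (\<forall>Y Z. direct_sum C [Y, Z] X \<longrightarrow> zero_object C Y \<or> zero_object C Z)"

locale additive_category = linear_category +
  assumes direct_sum_exists: "set Xs \<subseteq> Obj C \<Longrightarrow> \<exists>S. direct_sum C Xs S"

definition local_endomorphism_ring :: "('k, 'o, 'a) lincat \<Rightarrow> 'o \<Rightarrow> bool" where
  "local_endomorphism_ring C X \<longleftrightarrow> X \<in> Obj C \<and> Idn C X \<noteq> Zer C X X \<and>
     (\<forall>f \<in> Hom C X X. \<forall>g \<in> Hom C X X.
        \<not> is_iso C X X f \<and> \<not> is_iso C X X g \<longrightarrow> \<not> is_iso C X X (f \<oplus>\<^bsub>C\<^esub> g))"

locale krull_schmidt_category = additive_category +
  assumes krull_schmidt:
    "X \<in> Obj C \<Longrightarrow> \<exists>Xs. direct_sum C Xs X \<and> (\<forall>Y \<in> set Xs. local_endomorphism_ring C Y)"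


section \<open>Functors and orbit categories\<close>

record ('o, 'a, 'p, 'b) cat_functor =
  fob :: "'o \<Rightarrow> 'p"
  far :: "'a \<Rightarrow> 'b"

definition linear_functor ::
  "('k, 'o, 'a) lincat \<Rightarrow> ('k, 'p, 'b) lincat \<Rightarrow> ('o, 'a, 'p, 'b) cat_functor \<Rightarrow> bool" where
  "linear_functor C D F \<longleftrightarrow>
     (\<forall>X \<in> Obj C. fob F X \<in> Obj D \<and> far F (Idn C X) = Idn D (fob F X)) \<and>
     (\<forall>X Y. \<forall>f \<in> Hom C X Y. far F f \<in> Hom D (fob F X) (fob F Y)) \<and>
     (\<forall>X Y Z. \<forall>f \<in> Hom C X Y. \<forall>g \<in> Hom C Y Z. far F (g \<cdot>\<^bsub>C\<^esub> f) = far F g \<cdot>\<^bsub>D\<^esub> far F f) \<and>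
     (\<forall>X Y. \<forall>f \<in> Hom C X Y. \<forall>g \<in> Hom C X Y. far F (f \<oplus>\<^bsub>C\<^esub> g) = far F f \<oplus>\<^bsub>D\<^esub> far F g) \<and>
     (\<forall>X Y. \<forall>f \<in> Hom C X Y. \<forall>a. far F (a \<odot>\<^bsub>C\<^esub> f) = a \<odot>\<^bsub>D\<^esub> far F f)"

definition automorphism :: "('k, 'o, 'a) lincat \<Rightarrow> ('o, 'a, 'o, 'a) cat_functor \<Rightarrow> bool" where
  "automorphism C F \<longleftrightarrow> linear_functor C C F \<and> bij_betw (fob F) (Obj C) (Obj C) \<and>
     (\<forall>X \<in> Obj C. \<forall>Y \<in> Obj C. bij_betw (far F) (Hom C X Y) (Hom C (fob F X) (fob F Y)))"

definition functor_comp ::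
  "('p, 'b, 'q, 'c) cat_functor \<Rightarrow> ('o, 'a, 'p, 'b) cat_functor \<Rightarrow> ('o, 'a, 'q, 'c) cat_functor" where
  "functor_comp G F = \<lparr>fob = fob G \<circ> fob F, far = far G \<circ> far F\<rparr>"

definition Arr :: "('k, 'o, 'a) lincat \<Rightarrow> 'a set" where
  "Arr C = (\<Union>X \<in> Obj C. \<Union>Y \<in> Obj C. Hom C X Y)"

definition functor_inv ::
  "('k, 'o, 'a) lincat \<Rightarrow> ('o, 'a, 'o, 'a) cat_functor \<Rightarrow> ('o, 'a, 'o, 'a) cat_functor" where
  "functor_inv C F = \<lparr>fob = inv_into (Obj C) (fob F), far = inv_into (Arr C) (far F)\<rparr>"

definition functor_pow ::
  "('k, 'o, 'a) lincat \<Rightarrow> ('o, 'a, 'o, 'a) cat_functor \<Rightarrow> int \<Rightarrow> ('o, 'a, 'o, 'a) cat_functor" where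
  "functor_pow C F i = (let G = (if 0 \<le> i then F else functor_inv C F); n = nat \<bar>i\<bar>
     in \<lparr>fob = fob G ^^ n, far = far G ^^ n\<rparr>)"

definition orbit :: "('k, 'o, 'a) lincat \<Rightarrow> ('o, 'a, 'o, 'a) cat_functor \<Rightarrow> 'o \<Rightarrow> 'o set" where
  "orbit D F X = {fob (functor_pow D F i) X | i. True}"

text \<open>The formula \<open>\<Coprod>i. Hom (F^i X) Y\<close> for the morphisms between the orbits of \<open>X\<close> and \<open>Y\<close> uses
  representatives of the orbits. We fix one for every orbit; other choices give isomorphic
  categories.\<close>

definition orbit_rep :: "'o set \<Rightarrow> 'o" where
  "orbit_rep U = (SOME X. X \<in> U)"

text \<open>A morphism \<open>U \<rightarrow> V\<close> of the orbit category is a triple \<open>(U, \<phi>, V)\<close>, where \<open>\<phi> i\<close> is the component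
  in \<open>Hom (F^i X) Y\<close>. The composite of \<open>f : F^i X \<rightarrow> Y\<close> and \<open>g : F^j Y \<rightarrow> Z\<close> is
  \<open>g \<cdot> F^j f : F^(i + j) X \<rightarrow> Z\<close>.\<close>

definition orbit_category ::
  "('k, 'o, 'a) lincat \<Rightarrow> ('o, 'a, 'o, 'a) cat_functor
     \<Rightarrow> ('k, 'o set, 'o set \<times> (int \<Rightarrow> 'a) \<times> 'o set) lincat" where
  "orbit_category D F =
    (let src = (\<lambda>U i. fob (functor_pow D F i) (orbit_rep U));
         zer = (\<lambda>U V i. Zer D (src U i) (orbit_rep V))
     in \<lparr>Obj = orbit D F ` Obj D,
         Hom = (\<lambda>U V. {(U, \<phi>, V) | \<phi>. U \<in> orbit D F ` Obj D \<and> V \<in> orbit D F ` Obj D \<and>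
                  (\<forall>i. \<phi> i \<in> Hom D (src U i) (orbit_rep V)) \<and> finite {i. \<phi> i \<noteq> zer U V i}}),
         Idn = (\<lambda>U. (U, (zer U U)(0 := Idn D (orbit_rep U)), U)),
         Cmp = (\<lambda>(V, \<psi>, W) (U, \<phi>, _). (U, (\<lambda>n. hom_sum D (src U n) (orbit_rep W)
                  (\<lambda>j. \<psi> j \<cdot>\<^bsub>D\<^esub> far (functor_pow D F j) (\<phi> (n - j))) {j. \<psi> j \<noteq> zer V W j}), W)),
         Zer = (\<lambda>U V. (U, zer U V, V)),
         Add = (\<lambda>(U, \<phi>, V) (_, \<psi>, _). (U, (\<lambda>i. \<phi> i \<oplus>\<^bsub>D\<^esub> \<psi> i), V)),
         Scl = (\<lambda>a (U, \<phi>, V). (U, (\<lambda>i. a \<odot>\<^bsub>D\<^esub> \<phi> i), V))\<rparr>)"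

text \<open>The projection \<open>D \<rightarrow> D/F\<close>. If \<open>X = F^a X'\<close> and \<open>Y = F^b Y'\<close> with \<open>X'\<close> and \<open>Y'\<close> the chosen
  representatives, then \<open>f : X \<rightarrow> Y\<close> goes to \<open>F^(-b) f : F^(a - b) X' \<rightarrow> Y'\<close>.\<close>

definition orbit_pos :: "('k, 'o, 'a) lincat \<Rightarrow> ('o, 'a, 'o, 'a) cat_functor \<Rightarrow> 'o \<Rightarrow> int" where
  "orbit_pos D F X = (SOME a. fob (functor_pow D F a) (orbit_rep (orbit D F X)) = X)"

definition Dom :: "('k, 'o, 'a) lincat \<Rightarrow> 'a \<Rightarrow> 'o" where
  "Dom C f = (THE X. \<exists>Y. f \<in> Hom C X Y)"

definition Cod :: "('k, 'o, 'a) lincat \<Rightarrow> 'a \<Rightarrow> 'o" where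
  "Cod C f = (THE Y. \<exists>X. f \<in> Hom C X Y)"

definition orbit_projection ::
  "('k, 'o, 'a) lincat \<Rightarrow> ('o, 'a, 'o, 'a) cat_functor
     \<Rightarrow> ('o, 'a, 'o set, 'o set \<times> (int \<Rightarrow> 'a) \<times> 'o set) cat_functor" where
  "orbit_projection D F =
     \<lparr>fob = orbit D F,
      far = (\<lambda>f. let U = orbit D F (Dom D f); V = orbit D F (Cod D f);
                     a = orbit_pos D F (Dom D f); b = orbit_pos D F (Cod D f)
                 in (U, (\<lambda>i. if i = a - b then far (functor_pow D F (- b)) f
                             else Zer D (fob (functor_pow D F i) (orbit_rep U)) (orbit_rep V)), V))\<rparr>"


section \<open>Triangulated categories\<close>

text \<open>A triangle \<open>X \<rightarrow> Y \<rightarrow> Z \<rightarrow> S X\<close> is given by its three morphisms; \<open>\<Delta>\<close> is the class of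
  distinguished triangles.\<close>

definition is_triangle ::
  "('k, 'o, 'a) lincat \<Rightarrow> ('o, 'a, 'o, 'a) cat_functor \<Rightarrow> 'o \<Rightarrow> 'o \<Rightarrow> 'o \<Rightarrow> 'a \<times> 'a \<times> 'a \<Rightarrow> bool" where
  "is_triangle C S X Y Z = (\<lambda>(f, g, h). f \<in> Hom C X Y \<and> g \<in> Hom C Y Z \<and> h \<in> Hom C Z (fob S X))"

definition triangle_iso ::
  "('k, 'o, 'a) lincat \<Rightarrow> ('o, 'a, 'o, 'a) cat_functor \<Rightarrow> 'a \<times> 'a \<times> 'a \<Rightarrow> 'a \<times> 'a \<times> 'a \<Rightarrow> bool" where
  "triangle_iso C S = (\<lambda>(f, g, h) (f', g', h'). \<exists>X Y Z X' Y' Z' u v w.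
     is_triangle C S X Y Z (f, g, h) \<and> is_triangle C S X' Y' Z' (f', g', h') \<and>
     is_iso C X X' u \<and> is_iso C Y Y' v \<and> is_iso C Z Z' w \<and>
     v \<cdot>\<^bsub>C\<^esub> f = f' \<cdot>\<^bsub>C\<^esub> u \<and> w \<cdot>\<^bsub>C\<^esub> g = g' \<cdot>\<^bsub>C\<^esub> v \<and> far S u \<cdot>\<^bsub>C\<^esub> h = h' \<cdot>\<^bsub>C\<^esub> w)"

locale triangulated_category = additive_category C
  for C :: "('k::field, 'o, 'a) lincat" (structure) +
  fixes S :: "('o, 'a, 'o, 'a) cat_functor" and \<Delta> :: "('a \<times> 'a \<times> 'a) set"
  assumes shift_automorphism: "automorphism C S"
    and dist_triangle: "t \<in> \<Delta> \<Longrightarrow> \<exists>X Y Z. is_triangle C S X Y Z t"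
    and dist_idn: "X \<in> Obj C \<Longrightarrow> zero_object C Z \<Longrightarrow>
          (Idn C X, Zer C X Z, Zer C Z (fob S X)) \<in> \<Delta>"
    and dist_iso: "t \<in> \<Delta> \<Longrightarrow> triangle_iso C S t t' \<Longrightarrow> t' \<in> \<Delta>"
    and dist_exists: "f \<in> Hom C X Y \<Longrightarrow> \<exists>g h. (f, g, h) \<in> \<Delta>"
    and dist_rotate: "is_triangle C S X Y Z (f, g, h) \<Longrightarrow>
          (f, g, h) \<in> \<Delta> \<longleftrightarrow> (g, h, (- 1) \<odot> far S f) \<in> \<Delta>"
    and dist_morphism:
      "\<lbrakk>(f, g, h) \<in> \<Delta>; (f', g', h') \<in> \<Delta>;
        is_triangle C S X Y Z (f, g, h); is_triangle C S X' Y' Z' (f', g', h');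
        u \<in> Hom C X X'; v \<in> Hom C Y Y'; v \<cdot> f = f' \<cdot> u\<rbrakk>
       \<Longrightarrow> \<exists>w \<in> Hom C Z Z'. w \<cdot> g = g' \<cdot> v \<and> far S u \<cdot> h = h' \<cdot> w"
    and octahedral:
      "\<lbrakk>f \<in> Hom C X Y; g \<in> Hom C Y Z;
        (f, i, i') \<in> \<Delta>; (g, j, j') \<in> \<Delta>; (g \<cdot> f, k, k') \<in> \<Delta>;
        is_triangle C S X Y Z' (f, i, i'); is_triangle C S Y Z X' (g, j, j');
        is_triangle C S X Z Y' (g \<cdot> f, k, k')\<rbrakk>
       \<Longrightarrow> \<exists>u \<in> Hom C Z' Y'. \<exists>v \<in> Hom C Y' X'.
             (u, v, far S i \<cdot> j') \<in> \<Delta> \<and> u \<cdot> i = k \<cdot> g \<and> k' \<cdot> u = i' \<and> v \<cdot> k = j \<and> j' \<cdot> v = far S f \<cdot> k'"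

definition triangle_functor ::
  "('k, 'o, 'a) lincat \<Rightarrow> ('o, 'a, 'o, 'a) cat_functor \<Rightarrow> ('a \<times> 'a \<times> 'a) set
   \<Rightarrow> ('k, 'p, 'b) lincat \<Rightarrow> ('p, 'b, 'p, 'b) cat_functor \<Rightarrow> ('b \<times> 'b \<times> 'b) set
   \<Rightarrow> ('o, 'a, 'p, 'b) cat_functor \<Rightarrow> bool" where
  "triangle_functor D S \<Delta> C S' \<Delta>' P \<longleftrightarrow> linear_functor D C P \<and>
     (\<exists>\<theta>. (\<forall>X \<in> Obj D. is_iso C (fob P (fob S X)) (fob S' (fob P X)) (\<theta> X)) \<and>
       (\<forall>X Y. \<forall>f \<in> Hom D X Y. \<theta> Y \<cdot>\<^bsub>C\<^esub> far P (far S f) = far S' (far P f) \<cdot>\<^bsub>C\<^esub> \<theta> X) \<and>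
       (\<forall>X Y Z f g h. (f, g, h) \<in> \<Delta> \<and> is_triangle D S X Y Z (f, g, h) \<longrightarrow>
          (far P f, far P g, \<theta> X \<cdot>\<^bsub>C\<^esub> far P h) \<in> \<Delta>'))"


section \<open>Modules over a finite-dimensional hereditary algebra\<close>

locale fd_algebra = vector_space scale
  for scale :: "'k::field \<Rightarrow> 'h::ring_1 \<Rightarrow> 'h" +
  assumes scale_mult_left: "scale a x * y = scale a (x * y)"
    and scale_mult_right: "x * scale a y = scale a (x * y)"
    and finite_dim: "\<exists>B. finite B \<and> span B = UNIV"

record ('h, 'm) lmod =
  mcar :: "'m set"
  madd :: "'m \<Rightarrow> 'm \<Rightarrow> 'm"
  mzero :: "'m"
  mscl :: "'h \<Rightarrow> 'm \<Rightarrow> 'm"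

definition left_module :: "('h::ring_1, 'm) lmod \<Rightarrow> bool" where
  "left_module M \<longleftrightarrow>
     comm_group \<lparr>carrier = mcar M, monoid.mult = madd M, one = mzero M\<rparr> \<and>
     (\<forall>a. \<forall>x \<in> mcar M. mscl M a x \<in> mcar M) \<and>
     (\<forall>a. \<forall>x \<in> mcar M. \<forall>y \<in> mcar M. mscl M a (madd M x y) = madd M (mscl M a x) (mscl M a y)) \<and>
     (\<forall>a b. \<forall>x \<in> mcar M. mscl M (a + b) x = madd M (mscl M a x) (mscl M b x)) \<and>
     (\<forall>a b. \<forall>x \<in> mcar M. mscl M (a * b) x = mscl M a (mscl M b x)) \<and>
     (\<forall>x \<in> mcar M. mscl M 1 x = x)"

definition submodule :: "'m set \<Rightarrow> ('h, 'm) lmod \<Rightarrow> bool" where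
  "submodule U M \<longleftrightarrow> U \<subseteq> mcar M \<and> mzero M \<in> U \<and>
     (\<forall>x \<in> U. \<forall>y \<in> U. madd M x y \<in> U) \<and> (\<forall>a. \<forall>x \<in> U. mscl M a x \<in> U)"

definition finitely_generated :: "('h, 'm) lmod \<Rightarrow> bool" where
  "finitely_generated M \<longleftrightarrow>
     (\<exists>G \<subseteq> mcar M. finite G \<and> (\<forall>U. submodule U M \<and> G \<subseteq> U \<longrightarrow> U = mcar M))"

definition mod_hom :: "('h, 'm) lmod \<Rightarrow> ('h, 'n) lmod \<Rightarrow> ('m \<Rightarrow> 'n) set" where
  "mod_hom M N = {f. f ` mcar M \<subseteq> mcar N \<and>
     (\<forall>x \<in> mcar M. \<forall>y \<in> mcar M. f (madd M x y) = madd N (f x) (f y)) \<and>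
     (\<forall>a. \<forall>x \<in> mcar M. f (mscl M a x) = mscl N a (f x))}"

text \<open>Every finitely generated \<open>H\<close>-module has an isomorphic copy whose underlying set consists of
  sequences in \<open>H\<close>. The modules of this shape form our category of finitely generated
  \<open>H\<close>-modules. Interleaving of sequences gives direct sums within it.\<close>

type_synonym 'h fmod = "('h, nat \<Rightarrow> 'h) lmod"

definition fg_modules :: "'h::ring_1 fmod set" where
  "fg_modules = {M. left_module M \<and> finitely_generated M}"

definition projective :: "'h::ring_1 fmod \<Rightarrow> bool" where
  "projective P \<longleftrightarrow> P \<in> fg_modules \<and>
     (\<forall>M \<in> fg_modules. \<forall>N \<in> fg_modules. \<forall>p \<in> mod_hom M N. \<forall>f \<in> mod_hom P N.
        p ` mcar M = mcar N \<longrightarrow> (\<exists>g \<in> mod_hom P M. \<forall>x \<in> mcar P. p (g x) = f x))"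

locale hereditary_algebra = fd_algebra scale
  for scale :: "'k::field \<Rightarrow> 'h::ring_1 \<Rightarrow> 'h" +
  assumes hereditary:
    "\<And>(P :: 'h fmod) U. projective P \<Longrightarrow> submodule U P \<Longrightarrow> projective (P\<lparr>mcar := U\<rparr>)"

definition sq_pair :: "(nat \<Rightarrow> 'h) \<Rightarrow> (nat \<Rightarrow> 'h) \<Rightarrow> nat \<Rightarrow> 'h" where
  "sq_pair x y = (\<lambda>n. if even n then x (n div 2) else y (n div 2))"

definition sq_fst :: "(nat \<Rightarrow> 'h) \<Rightarrow> nat \<Rightarrow> 'h" where
  "sq_fst z = (\<lambda>n. z (2 * n))"

definition sq_snd :: "(nat \<Rightarrow> 'h) \<Rightarrow> nat \<Rightarrow> 'h" where
  "sq_snd z = (\<lambda>n. z (2 * n + 1))"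

definition mod_sum :: "'h fmod \<Rightarrow> 'h fmod \<Rightarrow> 'h fmod" where
  "mod_sum M N =
     \<lparr>mcar = {sq_pair x y | x y. x \<in> mcar M \<and> y \<in> mcar N},
      madd = (\<lambda>z w. sq_pair (madd M (sq_fst z) (sq_fst w)) (madd N (sq_snd z) (sq_snd w))),
      mzero = sq_pair (mzero M) (mzero N),
      mscl = (\<lambda>a z. sq_pair (mscl M a (sq_fst z)) (mscl N a (sq_snd z)))\<rparr>"


section \<open>Bounded complexes\<close>

record 'h cochain_cx =
  trm :: "int \<Rightarrow> 'h fmod"
  dif :: "int \<Rightarrow> (nat \<Rightarrow> 'h) \<Rightarrow> (nat \<Rightarrow> 'h)"

type_synonym 'h chmap = "int \<Rightarrow> (nat \<Rightarrow> 'h) \<Rightarrow> (nat \<Rightarrow> 'h)"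

text \<open>Cohomological grading: \<open>dif X n\<close> maps the term in degree \<open>n\<close> to that in degree \<open>n + 1\<close>.\<close>

definition bounded_complexes :: "'h::ring_1 cochain_cx set" where
  "bounded_complexes = {X.
     (\<forall>n. trm X n \<in> fg_modules \<and> dif X n \<in> mod_hom (trm X n) (trm X (n + 1)) \<and>
        (\<forall>x \<in> mcar (trm X n). dif X (n + 1) (dif X n x) = mzero (trm X (n + 2)))) \<and>
     (\<exists>N. \<forall>n. \<bar>n\<bar> > N \<longrightarrow> mcar (trm X n) = {mzero (trm X n)})}"

definition chain_maps :: "'h cochain_cx \<Rightarrow> 'h cochain_cx \<Rightarrow> 'h chmap set" where
  "chain_maps X Y = {f. \<forall>n. f n \<in> mod_hom (trm X n) (trm Y n) \<and>
     (\<forall>x \<in> mcar (trm X n). f (n + 1) (dif X n x) = dif Y n (f n x))}"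

definition homotopic ::
  "'h cochain_cx \<Rightarrow> 'h cochain_cx \<Rightarrow> 'h chmap \<Rightarrow> 'h chmap \<Rightarrow> bool" where
  "homotopic X Y f g \<longleftrightarrow>
     (\<exists>s. (\<forall>n. s n \<in> mod_hom (trm X n) (trm Y (n - 1))) \<and>
       (\<forall>n. \<forall>x \<in> mcar (trm X n). f n x =
          madd (trm Y n) (g n x) (madd (trm Y n) (dif Y (n - 1) (s n x)) (s (n + 1) (dif X n x)))))"

definition cocycles :: "'h cochain_cx \<Rightarrow> int \<Rightarrow> (nat \<Rightarrow> 'h) set" where
  "cocycles X n = {x \<in> mcar (trm X n). dif X n x = mzero (trm X (n + 1))}"

definition coboundaries :: "'h cochain_cx \<Rightarrow> int \<Rightarrow> (nat \<Rightarrow> 'h) set" where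
  "coboundaries X n = dif X (n - 1) ` mcar (trm X (n - 1))"

text \<open>The two clauses are injectivity and surjectivity of the map induced in cohomology.\<close>

definition quasi_iso :: "'h cochain_cx \<Rightarrow> 'h cochain_cx \<Rightarrow> 'h chmap \<Rightarrow> bool" where
  "quasi_iso X Y f \<longleftrightarrow> f \<in> chain_maps X Y \<and>
     (\<forall>n. (\<forall>x \<in> cocycles X n. f n x \<in> coboundaries Y n \<longrightarrow> x \<in> coboundaries X n) \<and>
          (\<forall>y \<in> cocycles Y n. \<exists>x \<in> cocycles X n. \<exists>b \<in> coboundaries Y n. y = madd (trm Y n) (f n x) b))"

definition complex_shift :: "'h::ring_1 cochain_cx \<Rightarrow> 'h cochain_cx" where
  "complex_shift X = \<lparr>trm = (\<lambda>n. trm X (n + 1)),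
     dif = (\<lambda>n x. mscl (trm X (n + 2)) (- 1) (dif X (n + 1) x))\<rparr>"

definition chmap_shift :: "'h chmap \<Rightarrow> 'h chmap" where
  "chmap_shift f = (\<lambda>n. f (n + 1))"

text \<open>The mapping cone of \<open>f : X \<rightarrow> Y\<close>, with differential \<open>(x, y) \<mapsto> (- d x, f x + d y)\<close>, and the
  standard triangle \<open>X \<rightarrow> Y \<rightarrow> cone f \<rightarrow> X[1]\<close>.\<close>

definition cone ::
  "'h::ring_1 cochain_cx \<Rightarrow> 'h cochain_cx \<Rightarrow> 'h chmap \<Rightarrow> 'h cochain_cx" where
  "cone X Y f = \<lparr>trm = (\<lambda>n. mod_sum (trm X (n + 1)) (trm Y n)),
     dif = (\<lambda>n z. sq_pair (mscl (trm X (n + 2)) (- 1) (dif X (n + 1) (sq_fst z)))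
                           (madd (trm Y (n + 1)) (f (n + 1) (sq_fst z)) (dif Y n (sq_snd z))))\<rparr>"

definition cone_incl :: "'h cochain_cx \<Rightarrow> 'h chmap" where
  "cone_incl X = (\<lambda>n y. sq_pair (mzero (trm X (n + 1))) y)"

definition cone_proj :: "'h chmap" where
  "cone_proj = (\<lambda>n z. sq_fst z)"


section \<open>The bounded derived category\<close>

text \<open>The triangulated category \<open>(D, S, \<Delta>)\<close> together with the functor \<open>Q\<close> from bounded complexes to
  \<open>D\<close> is a bounded derived category of \<open>H\<close>: up to isomorphism the objects are the complexes, the
  morphisms are the fractions \<open>Q f \<cdot> (Q s)\<^sup>-\<^sup>1\<close> with \<open>s\<close> a quasi-isomorphism (modulo the equivalence
  of the calculus of fractions in the homotopy category), and the distinguished triangles are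
  those given by mapping cones. Thus \<open>D\<close> is determined up to triangle equivalence. It is not a fixed
  construction because the orbit category requires a model of \<open>D\<close> on which the shift and the
  Auslander-Reiten translation are automorphisms and not just autoequivalences; passing to a
  skeleton gives such a model.

  \<open>Qa X Y f\<close> is the image of the chain map \<open>f : X \<rightarrow> Y\<close>, and \<open>\<theta>\<close> identifies \<open>Q (X[1])\<close> with
  \<open>S (Q X)\<close>.\<close>

locale bounded_derived_category =
  fd_algebra scale + triangulated_category D S \<Delta>
  for scale :: "'k::field \<Rightarrow> 'h::ring_1 \<Rightarrow> 'h"
    and D :: "('k, 'o, 'a) lincat" (structure)
    and S :: "('o, 'a, 'o, 'a) cat_functor" and \<Delta> :: "('a \<times> 'a \<times> 'a) set" +
  fixes Qo :: "'h cochain_cx \<Rightarrow> 'o"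
    and Qa :: "'h cochain_cx \<Rightarrow> 'h cochain_cx \<Rightarrow> 'h chmap \<Rightarrow> 'a"
    and \<theta> :: "'h cochain_cx \<Rightarrow> 'a"
  assumes Q_obj: "X \<in> bounded_complexes \<Longrightarrow> Qo X \<in> Obj D"
    and Q_hom: "\<lbrakk>X \<in> bounded_complexes; Y \<in> bounded_complexes; f \<in> chain_maps X Y\<rbrakk>
          \<Longrightarrow> Qa X Y f \<in> Hom D (Qo X) (Qo Y)"
    and Q_idn: "X \<in> bounded_complexes \<Longrightarrow> Qa X X (\<lambda>n x. x) = Idn D (Qo X)"
    and Q_cmp: "\<lbrakk>X \<in> bounded_complexes; Y \<in> bounded_complexes; Z \<in> bounded_complexes;
            f \<in> chain_maps X Y; g \<in> chain_maps Y Z\<rbrakk>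
          \<Longrightarrow> Qa X Z (\<lambda>n x. g n (f n x)) = Qa Y Z g \<cdot> Qa X Y f"
    and Q_add: "\<lbrakk>X \<in> bounded_complexes; Y \<in> bounded_complexes;
            f \<in> chain_maps X Y; g \<in> chain_maps X Y\<rbrakk>
          \<Longrightarrow> Qa X Y (\<lambda>n x. madd (trm Y n) (f n x) (g n x)) = Qa X Y f \<oplus> Qa X Y g"
    and Q_scl: "\<lbrakk>X \<in> bounded_complexes; Y \<in> bounded_complexes; f \<in> chain_maps X Y\<rbrakk>
          \<Longrightarrow> Qa X Y (\<lambda>n x. mscl (trm Y n) (scale a 1) (f n x)) = a \<odot> Qa X Y f"
    and Q_quasi_iso: "\<lbrakk>X \<in> bounded_complexes; Y \<in> bounded_complexes; quasi_iso X Y f\<rbrakk>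
          \<Longrightarrow> is_iso D (Qo X) (Qo Y) (Qa X Y f)"
    and Q_dense: "A \<in> Obj D \<Longrightarrow> \<exists>X \<in> bounded_complexes. isomorphic D A (Qo X)"
    and Q_fraction: "\<lbrakk>X \<in> bounded_complexes; Y \<in> bounded_complexes; \<phi> \<in> Hom D (Qo X) (Qo Y)\<rbrakk>
          \<Longrightarrow> \<exists>Z \<in> bounded_complexes. \<exists>s f. quasi_iso Z X s \<and> f \<in> chain_maps Z Y \<and>
                \<phi> \<cdot> Qa Z X s = Qa Z Y f"
    and Q_eq: "\<lbrakk>X \<in> bounded_complexes; Y \<in> bounded_complexes;
            f \<in> chain_maps X Y; g \<in> chain_maps X Y\<rbrakk>
          \<Longrightarrow> Qa X Y f = Qa X Y g \<longleftrightarrow>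
                (\<exists>Z \<in> bounded_complexes. \<exists>s. quasi_iso Z X s \<and>
                   homotopic Z Y (\<lambda>n z. f n (s n z)) (\<lambda>n z. g n (s n z)))"
    and shift_iso: "X \<in> bounded_complexes \<Longrightarrow>
          is_iso D (Qo (complex_shift X)) (fob S (Qo X)) (\<theta> X)"
    and shift_natural: "\<lbrakk>X \<in> bounded_complexes; Y \<in> bounded_complexes; f \<in> chain_maps X Y\<rbrakk>
          \<Longrightarrow> \<theta> Y \<cdot> Qa (complex_shift X) (complex_shift Y) (chmap_shift f)
                = far S (Qa X Y f) \<cdot> \<theta> X"
    and dist_iff_cone: "t \<in> \<Delta> \<longleftrightarrow>
          (\<exists>X \<in> bounded_complexes. \<exists>Y \<in> bounded_complexes. \<exists>f \<in> chain_maps X Y.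
             triangle_iso D S
               (Qa X Y f, Qa Y (cone X Y f) (cone_incl X),
                \<theta> X \<cdot> Qa (cone X Y f) (complex_shift X) cone_proj) t)"

text \<open>The Auslander-Reiten translation \<open>\<tau>\<close>: an autoequivalence with an Auslander-Reiten formula
  \<open>Hom X (Y[1]) \<cong> (Hom Y (\<tau> X))\<^sup>*\<close> (dual vector space), natural in \<open>X\<close> and \<open>Y\<close>, that is, \<open>\<tau>[1]\<close> is a Serre functor. This
  determines \<open>\<tau>\<close> up to natural isomorphism (Auslander-Reiten triangles alone determine only its
  values on objects).\<close>

definition hom_dual :: "('k::field, 'o, 'a) lincat \<Rightarrow> 'o \<Rightarrow> 'o \<Rightarrow> ('a \<Rightarrow> 'k) set" where
  "hom_dual D X Y = {\<xi> \<in> extensional (Hom D X Y).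
     (\<forall>f \<in> Hom D X Y. \<forall>g \<in> Hom D X Y. \<xi> (f \<oplus>\<^bsub>D\<^esub> g) = \<xi> f + \<xi> g) \<and>
     (\<forall>a. \<forall>f \<in> Hom D X Y. \<xi> (a \<odot>\<^bsub>D\<^esub> f) = a * \<xi> f)}"

definition AR_translation ::
  "('k::field, 'o, 'a) lincat \<Rightarrow> ('o, 'a, 'o, 'a) cat_functor \<Rightarrow> ('o, 'a, 'o, 'a) cat_functor \<Rightarrow> bool" where
  "AR_translation D S \<tau> \<longleftrightarrow> automorphism D \<tau> \<and>
     (\<exists>\<Phi>.
       (\<forall>X \<in> Obj D. \<forall>Y \<in> Obj D.
          bij_betw (\<Phi> X Y) (Hom D X (fob S Y)) (hom_dual D Y (fob \<tau> X)) \<and>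
          (\<forall>f \<in> Hom D X (fob S Y). \<forall>g \<in> Hom D X (fob S Y). \<forall>\<eta> \<in> Hom D Y (fob \<tau> X). \<forall>a.
             \<Phi> X Y (f \<oplus>\<^bsub>D\<^esub> g) \<eta> = \<Phi> X Y f \<eta> + \<Phi> X Y g \<eta> \<and>
             \<Phi> X Y (a \<odot>\<^bsub>D\<^esub> f) \<eta> = a * \<Phi> X Y f \<eta>)) \<and>
       (\<forall>X X' Y Y'. \<forall>u \<in> Hom D X' X. \<forall>v \<in> Hom D Y Y'.
          \<forall>f \<in> Hom D X (fob S Y). \<forall>\<eta> \<in> Hom D Y' (fob \<tau> X').
             \<Phi> X' Y' (far S v \<cdot>\<^bsub>D\<^esub> f \<cdot>\<^bsub>D\<^esub> u) \<eta> = \<Phi> X Y f (far \<tau> u \<cdot>\<^bsub>D\<^esub> \<eta> \<cdot>\<^bsub>D\<^esub> v)))"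


section \<open>The cluster category\<close>

definition cluster_functor ::
  "('k, 'o, 'a) lincat \<Rightarrow> ('o, 'a, 'o, 'a) cat_functor \<Rightarrow> ('o, 'a, 'o, 'a) cat_functor
     \<Rightarrow> ('o, 'a, 'o, 'a) cat_functor" where
  "cluster_functor D S \<tau> = functor_comp (functor_inv D \<tau>) S"

definition cluster_category ::
  "('k, 'o, 'a) lincat \<Rightarrow> ('o, 'a, 'o, 'a) cat_functor \<Rightarrow> ('o, 'a, 'o, 'a) cat_functor
     \<Rightarrow> ('k, 'o set, 'o set \<times> (int \<Rightarrow> 'a) \<times> 'o set) lincat" where
  "cluster_category D S \<tau> = orbit_category D (cluster_functor D S \<tau>)"

text \<open>The triangulated structure \<open>(S', \<Delta>')\<close> of the cluster category is any one for which the
  projection from \<open>D\<close> is a triangle functor; in particular \<open>S'\<close> is induced by the shift of \<open>D\<close>.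
  Such a structure exists by Keller's theorem; that the cluster category is a Krull-Schmidt category
  is likewise a known fact, recorded here as part of the setting.\<close>

locale cluster_category_setting =
  hereditary_algebra scale + bounded_derived_category scale D S \<Delta> Qo Qa \<theta> +
  C: triangulated_category "cluster_category D S \<tau>" S' \<Delta>' +
  C: krull_schmidt_category "cluster_category D S \<tau>"
  for scale :: "'k::field \<Rightarrow> 'h::ring_1 \<Rightarrow> 'h"
    and D :: "('k, 'o, 'a) lincat"
    and S :: "('o, 'a, 'o, 'a) cat_functor" and \<Delta> :: "('a \<times> 'a \<times> 'a) set"
    and Qo :: "'h cochain_cx \<Rightarrow> 'o"
    and Qa :: "'h cochain_cx \<Rightarrow> 'h cochain_cx \<Rightarrow> 'h chmap \<Rightarrow> 'a"
    and \<theta> :: "'h cochain_cx \<Rightarrow> 'a"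
    and \<tau> :: "('o, 'a, 'o, 'a) cat_functor"
    and S' :: "('o set, 'o set \<times> (int \<Rightarrow> 'a) \<times> 'o set,
                'o set, 'o set \<times> (int \<Rightarrow> 'a) \<times> 'o set) cat_functor"
    and \<Delta>' :: "(('o set \<times> (int \<Rightarrow> 'a) \<times> 'o set) \<times> ('o set \<times> (int \<Rightarrow> 'a) \<times> 'o set) \<times>
                ('o set \<times> (int \<Rightarrow> 'a) \<times> 'o set)) set" +
  assumes AR_translation: "AR_translation D S \<tau>"
    and projection_triangle_functor:
      "triangle_functor D S \<Delta> (cluster_category D S \<tau>) S' \<Delta>'
         (orbit_projection D (cluster_functor D S \<tau>))"


section \<open>Tilting objects, complements and approximations\<close>

definition Ext1 :: "('k, 'o, 'a) lincat \<Rightarrow> ('o, 'a, 'o, 'a) cat_functor \<Rightarrow> 'o \<Rightarrow> 'o \<Rightarrow> 'a set" where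
  "Ext1 C S U V = Hom C U (fob S V)"

definition Ext1_vanishes ::
  "('k, 'o, 'a) lincat \<Rightarrow> ('o, 'a, 'o, 'a) cat_functor \<Rightarrow> 'o \<Rightarrow> 'o \<Rightarrow> bool" where
  "Ext1_vanishes C S U V \<longleftrightarrow> Ext1 C S U V = {Zer C U (fob S V)}"

definition exceptional :: "('k, 'o, 'a) lincat \<Rightarrow> ('o, 'a, 'o, 'a) cat_functor \<Rightarrow> 'o \<Rightarrow> bool" where
  "exceptional C S T \<longleftrightarrow> T \<in> Obj C \<and> Ext1_vanishes C S T T"

definition basic :: "('k, 'o, 'a) lincat \<Rightarrow> 'o \<Rightarrow> bool" where
  "basic C T \<longleftrightarrow> (\<exists>Ts. direct_sum C Ts T \<and> (\<forall>X \<in> set Ts. indecomposable C X) \<and>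
     (\<forall>i < length Ts. \<forall>j < length Ts. i \<noteq> j \<longrightarrow> \<not> isomorphic C (Ts ! i) (Ts ! j)))"

definition rigid_set :: "('k, 'o, 'a) lincat \<Rightarrow> ('o, 'a, 'o, 'a) cat_functor \<Rightarrow> 'o set \<Rightarrow> bool" where
  "rigid_set C S R \<longleftrightarrow> (\<forall>X \<in> R. indecomposable C X) \<and>
     (\<forall>X \<in> R. \<forall>Y \<in> R. X \<noteq> Y \<longrightarrow> \<not> isomorphic C X Y) \<and>
     (\<forall>X \<in> R. \<forall>Y \<in> R. Ext1_vanishes C S X Y)"

definition maximal_rigid_set ::
  "('k, 'o, 'a) lincat \<Rightarrow> ('o, 'a, 'o, 'a) cat_functor \<Rightarrow> 'o set \<Rightarrow> bool" where
  "maximal_rigid_set C S R \<longleftrightarrow> rigid_set C S R \<and> (\<forall>R'. rigid_set C S R' \<and> R \<subseteq> R' \<longrightarrow> R' = R)"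

text \<open>\<open>R\<close> is a set of representatives of the isomorphism classes of indecomposable summands of \<open>T\<close>.\<close>

definition summand_reps :: "('k, 'o, 'a) lincat \<Rightarrow> 'o \<Rightarrow> 'o set \<Rightarrow> bool" where
  "summand_reps C T R \<longleftrightarrow> (\<forall>X \<in> R. indecomposable C X \<and> summand C X T) \<and>
     (\<forall>X \<in> R. \<forall>Y \<in> R. X \<noteq> Y \<longrightarrow> \<not> isomorphic C X Y) \<and>
     (\<forall>X. indecomposable C X \<and> summand C X T \<longrightarrow> (\<exists>Y \<in> R. isomorphic C X Y))"

definition tilting :: "('k, 'o, 'a) lincat \<Rightarrow> ('o, 'a, 'o, 'a) cat_functor \<Rightarrow> 'o \<Rightarrow> bool" where
  "tilting C S T \<longleftrightarrow> exceptional C S T \<and> (\<exists>R. summand_reps C T R \<and> maximal_rigid_set C S R)"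

definition complement ::
  "('k, 'o, 'a) lincat \<Rightarrow> ('o, 'a, 'o, 'a) cat_functor \<Rightarrow> 'o \<Rightarrow> 'o \<Rightarrow> bool" where
  "complement C S T M \<longleftrightarrow> indecomposable C M \<and>
     (\<exists>T'. direct_sum C [T, M] T' \<and> basic C T' \<and> tilting C S T')"

definition almost_complete_basic_tilting ::
  "('k, 'o, 'a) lincat \<Rightarrow> ('o, 'a, 'o, 'a) cat_functor \<Rightarrow> 'o \<Rightarrow> bool" where
  "almost_complete_basic_tilting C S T \<longleftrightarrow>
     basic C T \<and> exceptional C S T \<and> (\<exists>M. complement C S T M)"

definition add_closure :: "('k, 'o, 'a) lincat \<Rightarrow> 'o \<Rightarrow> 'o set" where
  "add_closure C T = {X. \<exists>n U. direct_sum C (replicate n T) U \<and> summand C X U}"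

definition right_approximation :: "('k, 'o, 'a) lincat \<Rightarrow> 'o \<Rightarrow> 'o \<Rightarrow> 'o \<Rightarrow> 'a \<Rightarrow> bool" where
  "right_approximation C T M B f \<longleftrightarrow> B \<in> add_closure C T \<and> f \<in> Hom C B M \<and>
     (\<forall>X \<in> add_closure C T. (\<lambda>h. f \<cdot>\<^bsub>C\<^esub> h) ` Hom C X B = Hom C X M)"

definition minimal_right_approximation ::
  "('k, 'o, 'a) lincat \<Rightarrow> 'o \<Rightarrow> 'o \<Rightarrow> 'o \<Rightarrow> 'a \<Rightarrow> bool" where
  "minimal_right_approximation C T M B f \<longleftrightarrow> right_approximation C T M B f \<and>
     (\<forall>g \<in> Hom C B B. f \<cdot>\<^bsub>C\<^esub> g = f \<longrightarrow> is_iso C B B g)"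

end

theory Submission
  imports Defs "HOL-Library.Function_Algebras"
begin

text \<open>Write \<open>[T]\<close> for the ideal of morphisms that factor through \<open>add T\<close>. If \<open>Ext\<^sup>1\<close>-vanishing is symmetric,
  the triangle \<open>M' \<rightarrow> B \<rightarrow> M\<close> shows that \<open>M'\<close> is compatible with \<open>T\<close> and with itself; endomorphisms of \<open>M'\<close>
  extend to the triangle, so \<open>End M'\<close> is local because \<open>End M\<close> is; and \<open>M'\<close> lies neither in \<open>add T\<close> nor is it
  isomorphic to \<open>M\<close>, because otherwise the triangle splits and \<open>M\<close> lies in \<open>add T\<close>. Maximality is transported
  from \<open>T \<oplus> M\<close> to \<open>T \<oplus> M'\<close> by the exchange in the opposite direction, which needs left \<open>add T\<close>-approximations
  and therefore finite-dimensional morphism spaces.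

  Only two facts on the cluster category enter. First, symmetry of \<open>Ext\<^sup>1\<close>-vanishing: since only vanishing matters,
  the Auslander-Reiten formula gives it without any natural isomorphisms, because for the purpose of vanishing
  every automorphism commutes with the Serre functor \<open>\<tau>[1]\<close>. Second, finiteness: the Auslander-Reiten formula,
  used twice, makes the pairing of \<open>Hom X (Y[1])\<close> and \<open>Hom Y (\<tau> X)\<close> perfect on both sides, which forces finite
  dimension; and as \<open>H\<close> is hereditary, the inverse of \<open>F\<close> moves objects with cohomology in degrees \<open>\<ge> p\<close> to
  objects with cohomology in degrees \<open>\<ge> p + 1\<close>, so only finitely many \<open>Hom (F^i X) Y\<close> are nonzero.\<close>

section \<open>Linear categories\<close>

text \<open>Maximality is by inclusion of sets, so no count of summands decides it: an
  indecomposable compatible with \<open>T \<oplus> M'\<close> has to be caught directly, and a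
  second triangle turns it into an object compatible with \<open>T \<oplus> M\<close>. Identities
  written as finite sums of composites through given objects replace matrices over decompositions:
  such sums move along triangles term by term, and local endomorphism rings turn them back into
  isomorphisms. In \<open>D\<close> the obstacle is that \<open>S\<close> and \<open>\<tau>\<close>
  are automorphisms of an unspecified model, so \<open>S (F X) = F (S X)\<close> is not at hand even
  on objects. What is exact is \<open>\<tau> (F X) = S X\<close>. Through Serre duality it sends the
  exponent \<open>i\<close> in \<open>Hom (F^i X) (S Y)\<close> to \<open>1 - i\<close>, a
  reflection of the integers. The reflection gives the symmetry, and it also turns vanishing for
  very negative exponents into vanishing for large positive ones. The gain of one degree under the
  inverse of \<open>F\<close> is a balance: with \<open>H\<close> placed in degree \<open>j\<close>,
  morphisms to the inverse translate of \<open>A\<close> are dual to morphisms from \<open>A\<close>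
  to \<open>H\<close> in degree \<open>j - 2\<close>, and over a hereditary algebra these vanish as
  soon as \<open>j - 2\<close> is at most \<open>p - 2\<close>.\<close>

definition hom_zero :: "('k, 'o, 'a) lincat \<Rightarrow> 'o \<Rightarrow> 'o \<Rightarrow> bool" where
  "hom_zero C X Y \<longleftrightarrow> Hom C X Y = {Zer C X Y}"

context linear_category
begin

lemma hom_group_simps [simp]:
  "carrier (hom_group C X Y) = Hom C X Y" "monoid.mult (hom_group C X Y) = Add C"
  "one (hom_group C X Y) = Zer C X Y"
  by (simp_all add: hom_group_def)

lemma hom_group_comm_group: "f \<in> Hom C X Y \<Longrightarrow> comm_group (hom_group C X Y)"
  using hom_obj hom_comm_group by blast

lemma zer_hom: "X \<in> Obj C \<Longrightarrow> Y \<in> Obj C \<Longrightarrow> Zer C X Y \<in> Hom C X Y"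
  using monoid.one_closed[of "hom_group C X Y"] hom_comm_group[of X Y]
  by (simp add: comm_group_def comm_monoid_def)

lemma add_hom: "f \<in> Hom C X Y \<Longrightarrow> g \<in> Hom C X Y \<Longrightarrow> f \<oplus> g \<in> Hom C X Y"
  using monoid.m_closed[of "hom_group C X Y" f g] hom_group_comm_group[of f X Y]
  by (simp add: comm_group_def comm_monoid_def)

lemma add_assoc: "f \<in> Hom C X Y \<Longrightarrow> g \<in> Hom C X Y \<Longrightarrow> h \<in> Hom C X Y
    \<Longrightarrow> (f \<oplus> g) \<oplus> h = f \<oplus> (g \<oplus> h)"
  using monoid.m_assoc[of "hom_group C X Y" f g h] hom_group_comm_group[of f X Y]
  by (simp add: comm_group_def comm_monoid_def)

lemma add_commute: "f \<in> Hom C X Y \<Longrightarrow> g \<in> Hom C X Y \<Longrightarrow> f \<oplus> g = g \<oplus> f"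
  using comm_monoid.m_comm[of "hom_group C X Y" f g] hom_group_comm_group[of f X Y]
  by (simp add: comm_group_def)

lemma zer_add: "f \<in> Hom C X Y \<Longrightarrow> Zer C X Y \<oplus> f = f"
  using monoid.l_one[of "hom_group C X Y" f] hom_group_comm_group[of f X Y]
  by (simp add: comm_group_def comm_monoid_def)

lemma add_zer: "f \<in> Hom C X Y \<Longrightarrow> f \<oplus> Zer C X Y = f"
  using zer_add add_commute zer_hom hom_obj by metis

lemma add_left_cancel:
  "f \<in> Hom C X Y \<Longrightarrow> g \<in> Hom C X Y \<Longrightarrow> h \<in> Hom C X Y \<Longrightarrow> f \<oplus> g = f \<oplus> h \<longleftrightarrow> g = h"
  using monoid.Units_l_cancel[of "hom_group C X Y" f g h] group.Units_eq[of "hom_group C X Y"]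
    hom_group_comm_group[of f X Y]
  by (auto simp: comm_group_def comm_monoid_def)

lemma add_self_zer: "f \<in> Hom C X Y \<Longrightarrow> f \<oplus> f = f \<Longrightarrow> f = Zer C X Y"
  by (metis add_left_cancel add_zer hom_obj zer_hom)

lemma zero_scl: "f \<in> Hom C X Y \<Longrightarrow> 0 \<odot> f = Zer C X Y"
  by (metis add_0 add_scl add_self_zer scl_hom)

lemma scl_zer: "X \<in> Obj C \<Longrightarrow> Y \<in> Obj C \<Longrightarrow> a \<odot> Zer C X Y = Zer C X Y"
  by (metis add_self_zer scl_add scl_hom zer_add zer_hom)

lemma add_neg: "f \<in> Hom C X Y \<Longrightarrow> f \<oplus> (- 1) \<odot> f = Zer C X Y"
  by (metis add.right_inverse add_scl scl_one zero_scl)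

lemma neg_neg: "f \<in> Hom C X Y \<Longrightarrow> (- 1) \<odot> (- 1) \<odot> f = f"
  by (simp add: scl_scl scl_one)

lemma neg_zer_iff: "f \<in> Hom C X Y \<Longrightarrow> (- 1) \<odot> f = Zer C X Y \<longleftrightarrow> f = Zer C X Y"
  by (metis hom_obj neg_neg scl_zer)

lemma add_neg_cancel: "f \<in> Hom C X Y \<Longrightarrow> g \<in> Hom C X Y \<Longrightarrow> g \<oplus> (f \<oplus> (- 1) \<odot> g) = f"
  using add_commute[of f X Y "(- 1) \<odot> g"] add_assoc[of g X Y "(- 1) \<odot> g" f] scl_hom[of g X Y "- 1"]
  by (simp add: add_neg zer_add)

lemma sub_zer_iff: "f \<in> Hom C X Y \<Longrightarrow> g \<in> Hom C X Y \<Longrightarrow> f \<oplus> (- 1) \<odot> g = Zer C X Y \<longleftrightarrow> f = g"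
  by (metis add_neg add_neg_cancel add_zer)

lemma cmp_zer: "g \<in> Hom C Y Z \<Longrightarrow> X \<in> Obj C \<Longrightarrow> g \<cdot> Zer C X Y = Zer C X Z"
proof -
  assume g: "g \<in> Hom C Y Z" and X: "X \<in> Obj C"
  have z: "Zer C X Y \<in> Hom C X Y" using X hom_obj[OF g] zer_hom by blast
  show ?thesis using cmp_scl[OF z g, of 0] zero_scl[OF z] zero_scl[OF cmp_hom[OF z g]] by simp
qed

lemma zer_cmp: "f \<in> Hom C X Y \<Longrightarrow> Z \<in> Obj C \<Longrightarrow> Zer C Y Z \<cdot> f = Zer C X Z"
proof -
  assume f: "f \<in> Hom C X Y" and Z: "Z \<in> Obj C"
  have z: "Zer C Y Z \<in> Hom C Y Z" using Z hom_obj[OF f] zer_hom by blast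
  show ?thesis using scl_cmp[OF f z, of 0] zero_scl[OF z] zero_scl[OF cmp_hom[OF f z]] by simp
qed

section \<open>Finite sums of morphisms\<close>

lemma hom_sum_closed:
  assumes "X \<in> Obj C" "Y \<in> Obj C" "\<And>i. i \<in> I \<Longrightarrow> f i \<in> Hom C X Y"
  shows "hom_sum C X Y f I \<in> Hom C X Y"
proof -
  interpret H: comm_group "hom_group C X Y" by (rule hom_comm_group[OF assms(1,2)])
  show ?thesis using H.finprod_closed[of f I] assms(3) by auto
qed

lemma hom_sum_empty [simp]:
  assumes "X \<in> Obj C" "Y \<in> Obj C" shows "hom_sum C X Y f {} = Zer C X Y"
proof -
  interpret H: comm_group "hom_group C X Y" by (rule hom_comm_group[OF assms])
  show ?thesis using H.finprod_empty[of f] by simp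
qed

lemma hom_sum_insert:
  assumes "finite I" "i \<notin> I" "X \<in> Obj C" "Y \<in> Obj C" "\<And>j. j \<in> insert i I \<Longrightarrow> f j \<in> Hom C X Y"
  shows "hom_sum C X Y f (insert i I) = f i \<oplus> hom_sum C X Y f I"
proof -
  interpret H: comm_group "hom_group C X Y" by (rule hom_comm_group[OF assms(3,4)])
  show ?thesis using H.finprod_insert[of I i f] assms by auto
qed

lemma hom_sum_cong:
  assumes "X \<in> Obj C" "Y \<in> Obj C" "\<And>i. i \<in> I \<Longrightarrow> g i \<in> Hom C X Y" "\<And>i. i \<in> I \<Longrightarrow> f i = g i"
  shows "hom_sum C X Y f I = hom_sum C X Y g I"
proof -
  interpret H: comm_group "hom_group C X Y" by (rule hom_comm_group[OF assms(1,2)])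
  show ?thesis by (rule H.finprod_cong') (use assms in auto)
qed

lemma hom_sum_cmp:
  assumes "finite I" "X \<in> Obj C" "Y \<in> Obj C" "\<And>i. i \<in> I \<Longrightarrow> f i \<in> Hom C X Y" "g \<in> Hom C W X"
  shows "hom_sum C X Y f I \<cdot> g = hom_sum C W Y (\<lambda>i. f i \<cdot> g) I"
  using assms(1,4)
proof (induction I)
  case empty
  then show ?case using zer_cmp[OF assms(5)] assms(2,3) hom_obj[OF assms(5)] by simp
next
  case (insert i I)
  have 1: "hom_sum C X Y f I \<in> Hom C X Y" by (rule hom_sum_closed) (use assms insert in auto)
  have "hom_sum C X Y f (insert i I) \<cdot> g = (f i \<oplus> hom_sum C X Y f I) \<cdot> g"
    using hom_sum_insert[of I i X Y f] insert assms by simp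
  also have "\<dots> = f i \<cdot> g \<oplus> hom_sum C W Y (\<lambda>i. f i \<cdot> g) I"
    using add_cmp[OF assms(5) _ 1] insert by auto
  also have "\<dots> = hom_sum C W Y (\<lambda>i. f i \<cdot> g) (insert i I)"
    using hom_sum_insert[of I i W Y "\<lambda>i. f i \<cdot> g"] insert assms hom_obj[OF assms(5)] cmp_hom by auto
  finally show ?case .
qed

lemma cmp_hom_sum:
  assumes "finite I" "X \<in> Obj C" "Y \<in> Obj C" "\<And>i. i \<in> I \<Longrightarrow> f i \<in> Hom C X Y" "g \<in> Hom C Y Z"
  shows "g \<cdot> hom_sum C X Y f I = hom_sum C X Z (\<lambda>i. g \<cdot> f i) I"
  using assms(1,4)
proof (induction I)
  case empty
  then show ?case using cmp_zer[OF assms(5)] assms(2,3) hom_obj[OF assms(5)] by simp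
next
  case (insert i I)
  have 1: "hom_sum C X Y f I \<in> Hom C X Y" by (rule hom_sum_closed) (use assms insert in auto)
  have "g \<cdot> hom_sum C X Y f (insert i I) = g \<cdot> (f i \<oplus> hom_sum C X Y f I)"
    using hom_sum_insert[of I i X Y f] insert assms by simp
  also have "\<dots> = g \<cdot> f i \<oplus> hom_sum C X Z (\<lambda>i. g \<cdot> f i) I"
    using cmp_add[OF _ 1 assms(5)] insert by auto
  also have "\<dots> = hom_sum C X Z (\<lambda>i. g \<cdot> f i) (insert i I)"
  proof (rule hom_sum_insert[symmetric])
    fix j assume "j \<in> insert i I"
    then show "g \<cdot> f j \<in> Hom C X Z" using insert.prems assms(5) cmp_hom by blast
  qed (use insert.hyps assms(2) hom_obj[OF assms(5)] in auto)
  finally show ?case .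
qed

lemma hom_sum_delta:
  assumes "finite I" "X \<in> Obj C" "Y \<in> Obj C" "j \<in> I" "f \<in> Hom C X Y"
    "\<And>i. i \<in> I \<Longrightarrow> i \<noteq> j \<Longrightarrow> g i = Zer C X Y" "g j = f"
  shows "hom_sum C X Y g I = f"
proof -
  interpret H: comm_group "hom_group C X Y" by (rule hom_comm_group[OF assms(2,3)])
  have "hom_sum C X Y g I = hom_sum C X Y (\<lambda>i. if j = i then f else \<one>\<^bsub>hom_group C X Y\<^esub>) I"
    by (rule H.finprod_cong') (use assms zer_hom in \<open>auto simp: Pi_iff\<close>)
  also have "\<dots> = f" using H.finprod_singleton[of j I "\<lambda>_. f"] assms by auto
  finally show ?thesis .
qed

section \<open>Isomorphisms\<close>

lemma iso_hom: "is_iso C X Y f \<Longrightarrow> f \<in> Hom C X Y"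
  by (simp add: is_iso_def)

lemma is_isoI: "\<lbrakk>f \<in> Hom C X Y; g \<in> Hom C Y X; g \<cdot> f = Idn C X; f \<cdot> g = Idn C Y\<rbrakk> \<Longrightarrow> is_iso C X Y f"
  by (auto simp: is_iso_def)

lemma is_isoE:
  assumes "is_iso C X Y f"
  obtains g where "is_iso C Y X g" "g \<in> Hom C Y X" "f \<in> Hom C X Y" "g \<cdot> f = Idn C X" "f \<cdot> g = Idn C Y"
  using assms by (auto simp: is_iso_def)

lemma idn_iso: "X \<in> Obj C \<Longrightarrow> is_iso C X X (Idn C X)"
  by (metis idn_cmp idn_hom is_isoI)

lemma iso_cmp:
  assumes "is_iso C X Y f" "is_iso C Y Z g"
  shows "is_iso C X Z (g \<cdot> f)"
proof -
  obtain f' where f: "f' \<in> Hom C Y X" "f \<in> Hom C X Y" "f' \<cdot> f = Idn C X" "f \<cdot> f' = Idn C Y"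
    using assms(1) is_isoE by metis
  obtain g' where g: "g' \<in> Hom C Z Y" "g \<in> Hom C Y Z" "g' \<cdot> g = Idn C Y" "g \<cdot> g' = Idn C Z"
    using assms(2) is_isoE by metis
  show ?thesis
  proof (rule is_isoI)
    show "(f' \<cdot> g') \<cdot> (g \<cdot> f) = Idn C X"
      using cmp_assoc[OF cmp_hom[OF f(2) g(2)] g(1) f(1)] cmp_assoc[OF f(2) g(2) g(1)] f g idn_cmp[OF f(2)]
      by simp
    show "(g \<cdot> f) \<cdot> (f' \<cdot> g') = Idn C Z"
      using cmp_assoc[OF cmp_hom[OF g(1) f(1)] f(2) g(2)] cmp_assoc[OF g(1) f(1) f(2)] f g idn_cmp[OF g(1)]
      by simp
  qed (use f g cmp_hom in blast)+
qed

lemma is_iso_left_right: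
  assumes "f \<in> Hom C X Y" "g \<in> Hom C Y X" "h \<in> Hom C Y X" "g \<cdot> f = Idn C X" "f \<cdot> h = Idn C Y"
  shows "is_iso C X Y f"
proof -
  have "g = h"
    using cmp_assoc[OF assms(3) assms(1) assms(2)] cmp_idn[OF assms(2)] idn_cmp[OF assms(3)] assms(4,5)
    by simp
  then show ?thesis using assms is_isoI by blast
qed

text \<open>The inverse of one composite yields a left inverse of \<open>f\<close>, that of the
  other a right inverse. Endomorphisms of triangles are inverted in this way, because the candidates
  for an inverse are correct only up to an automorphism.\<close>

lemma is_iso_of_cmp_iso:
  assumes "f \<in> Hom C X Y" "g \<in> Hom C Y X" "is_iso C X X (g \<cdot> f)" "is_iso C Y Y (f \<cdot> g)"
  shows "is_iso C X Y f"
proof -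
  obtain u where u: "u \<in> Hom C X X" "u \<cdot> (g \<cdot> f) = Idn C X" using assms(3) is_isoE by metis
  obtain v where v: "v \<in> Hom C Y Y" "(f \<cdot> g) \<cdot> v = Idn C Y" using assms(4) is_isoE by metis
  show ?thesis
  proof (rule is_iso_left_right)
    show "(u \<cdot> g) \<cdot> f = Idn C X" using u assms cmp_assoc by metis
    show "f \<cdot> (g \<cdot> v) = Idn C Y" using v assms cmp_assoc by metis
  qed (use u v assms cmp_hom in blast)+
qed

lemma isomorphic_refl: "X \<in> Obj C \<Longrightarrow> isomorphic C X X"
  using idn_iso isomorphic_def by metis

lemma isomorphic_sym: "isomorphic C X Y \<Longrightarrow> isomorphic C Y X"
  unfolding isomorphic_def using is_isoE by metis

lemma isomorphic_trans: "isomorphic C X Y \<Longrightarrow> isomorphic C Y Z \<Longrightarrow> isomorphic C X Z"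
  unfolding isomorphic_def using iso_cmp by metis

lemma isomorphic_obj: "isomorphic C X Y \<Longrightarrow> X \<in> Obj C \<and> Y \<in> Obj C"
  unfolding isomorphic_def is_iso_def using hom_obj by blast

section \<open>Vanishing morphism spaces\<close>

lemma hom_zeroI:
  "X \<in> Obj C \<Longrightarrow> Y \<in> Obj C \<Longrightarrow> (\<And>f. f \<in> Hom C X Y \<Longrightarrow> f = Zer C X Y) \<Longrightarrow> hom_zero C X Y"
  unfolding hom_zero_def using zer_hom by blast

lemma hom_zeroD: "hom_zero C X Y \<Longrightarrow> f \<in> Hom C X Y \<Longrightarrow> f = Zer C X Y"
  unfolding hom_zero_def by blast

lemma hom_zero_obj: "hom_zero C X Y \<Longrightarrow> X \<in> Obj C \<and> Y \<in> Obj C"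
  unfolding hom_zero_def using hom_obj by blast

lemma hom_zero_retract_right:
  assumes "hom_zero C X Y" "s \<in> Hom C Z Y" "r \<in> Hom C Y Z" "r \<cdot> s = Idn C Z"
  shows "hom_zero C X Z"
proof (rule hom_zeroI)
  show "X \<in> Obj C" "Z \<in> Obj C" using hom_zero_obj assms(1,2) hom_obj by blast+
  fix f assume f: "f \<in> Hom C X Z"
  have "f = r \<cdot> (s \<cdot> f)" using f assms cmp_assoc idn_cmp by metis
  also have "s \<cdot> f = Zer C X Y" using hom_zeroD assms(1,2) f cmp_hom by blast
  also have "r \<cdot> \<dots> = Zer C X Z" using cmp_zer[OF assms(3)] hom_obj[OF f] by simp
  finally show "f = Zer C X Z" .
qed

lemma hom_zero_retract_left:
  assumes "hom_zero C X Y" "s \<in> Hom C Z X" "r \<in> Hom C X Z" "r \<cdot> s = Idn C Z"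
  shows "hom_zero C Z Y"
proof (rule hom_zeroI)
  show "Y \<in> Obj C" "Z \<in> Obj C" using hom_zero_obj assms(1,2) hom_obj by blast+
  fix f assume f: "f \<in> Hom C Z Y"
  have "f = (f \<cdot> r) \<cdot> s" using f assms cmp_assoc cmp_idn by metis
  also have "f \<cdot> r = Zer C X Y" using hom_zeroD assms(1,3) f cmp_hom by blast
  also have "\<dots> \<cdot> s = Zer C Z Y" using zer_cmp[OF assms(2)] hom_obj[OF f] by simp
  finally show "f = Zer C Z Y" .
qed

lemma hom_zero_iso_right: "isomorphic C Y Z \<Longrightarrow> hom_zero C X Y \<longleftrightarrow> hom_zero C X Z"
  unfolding isomorphic_def by (metis hom_zero_retract_right is_isoE)

lemma hom_zero_iso_left: "isomorphic C X Z \<Longrightarrow> hom_zero C X Y \<longleftrightarrow> hom_zero C Z Y"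
  unfolding isomorphic_def by (metis hom_zero_retract_left is_isoE)

lemma zero_object_hom_zero:
  assumes "zero_object C Z" "X \<in> Obj C"
  shows "hom_zero C Z X" "hom_zero C X Z"
proof -
  have Z: "Z \<in> Obj C" "Idn C Z = Zer C Z Z" using assms(1) by (auto simp: zero_object_def)
  show "hom_zero C Z X"
    by (rule hom_zeroI) (use assms Z cmp_idn cmp_zer in metis)+
  show "hom_zero C X Z"
    by (rule hom_zeroI) (use assms Z idn_cmp zer_cmp in metis)+
qed

end

text \<open>An object \<open>X\<close> lies in \<open>add \<T>\<close> if and only if its identity lies in this ideal.\<close>

inductive_set factor_ideal ::
  "('k, 'o, 'a) lincat \<Rightarrow> 'o set \<Rightarrow> 'o \<Rightarrow> 'o \<Rightarrow> 'a set" for C :: "('k, 'o, 'a) lincat" and \<T> X Y where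
  zer: "X \<in> Obj C \<Longrightarrow> Y \<in> Obj C \<Longrightarrow> Zer C X Y \<in> factor_ideal C \<T> X Y"
| step: "T \<in> \<T> \<Longrightarrow> a \<in> Hom C X T \<Longrightarrow> b \<in> Hom C T Y \<Longrightarrow> f \<in> factor_ideal C \<T> X Y
      \<Longrightarrow> (b \<cdot>\<^bsub>C\<^esub> a) \<oplus>\<^bsub>C\<^esub> f \<in> factor_ideal C \<T> X Y"

section \<open>Calculus of the factor ideal\<close>

context linear_category
begin

lemma ideal_hom: "f \<in> factor_ideal C \<T> X Y \<Longrightarrow> f \<in> Hom C X Y"
  by (induction rule: factor_ideal.induct) (use zer_hom add_hom cmp_hom in blast)+

lemma ideal_single:
  assumes "T \<in> \<T>" "a \<in> Hom C X T" "b \<in> Hom C T Y"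
  shows "b \<cdot> a \<in> factor_ideal C \<T> X Y"
  using factor_ideal.step[OF assms factor_ideal.zer] add_zer[OF cmp_hom[OF assms(2,3)]]
    hom_obj[OF assms(2)] hom_obj[OF assms(3)] by metis

lemma ideal_add:
  assumes "f \<in> factor_ideal C \<T> X Y" "g \<in> factor_ideal C \<T> X Y"
  shows "f \<oplus> g \<in> factor_ideal C \<T> X Y"
  using assms(1)
proof (induction rule: factor_ideal.induct)
  case zer
  then show ?case using zer_add[OF ideal_hom[OF assms(2)]] assms(2) by simp
next
  case (step T a b f)
  have "((b \<cdot> a) \<oplus> f) \<oplus> g = (b \<cdot> a) \<oplus> (f \<oplus> g)"
    using add_assoc[OF cmp_hom[OF step(2,3)] ideal_hom[OF step(4)] ideal_hom[OF assms(2)]] .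
  then show ?case using factor_ideal.step[OF step(1-3) step.IH] by simp
qed

lemma ideal_cmp_left:
  assumes "f \<in> factor_ideal C \<T> X Y" "g \<in> Hom C Y Z"
  shows "g \<cdot> f \<in> factor_ideal C \<T> X Z"
  using assms(1)
proof (induction rule: factor_ideal.induct)
  case zer
  then show ?case using cmp_zer[OF assms(2)] factor_ideal.zer hom_obj[OF assms(2)] by metis
next
  case (step T a b f)
  have "g \<cdot> ((b \<cdot> a) \<oplus> f) = ((g \<cdot> b) \<cdot> a) \<oplus> (g \<cdot> f)"
    using cmp_add[OF cmp_hom[OF step(2,3)] ideal_hom[OF step(4)] assms(2)]
      cmp_assoc[OF step(2,3) assms(2)] by simp
  then show ?case using factor_ideal.step[OF step(1,2) cmp_hom[OF step(3) assms(2)] step.IH] by simp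
qed

lemma ideal_cmp_right:
  assumes "f \<in> factor_ideal C \<T> X Y" "g \<in> Hom C W X"
  shows "f \<cdot> g \<in> factor_ideal C \<T> W Y"
  using assms(1)
proof (induction rule: factor_ideal.induct)
  case zer
  then show ?case using zer_cmp[OF assms(2)] factor_ideal.zer hom_obj[OF assms(2)] by metis
next
  case (step T a b f)
  have "((b \<cdot> a) \<oplus> f) \<cdot> g = (b \<cdot> (a \<cdot> g)) \<oplus> (f \<cdot> g)"
    using add_cmp[OF assms(2) cmp_hom[OF step(2,3)] ideal_hom[OF step(4)]]
      cmp_assoc[OF assms(2) step(2,3)] by simp
  then show ?case using factor_ideal.step[OF step(1) cmp_hom[OF assms(2) step(2)] step(3) step.IH] by simp
qed

lemma ideal_idn_cmp:
  "Idn C Y \<in> factor_ideal C \<T> Y Y \<Longrightarrow> f \<in> Hom C X Y \<Longrightarrow> f \<in> factor_ideal C \<T> X Y"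
  using ideal_cmp_right idn_cmp by metis

lemma ideal_cmp_idn:
  "Idn C X \<in> factor_ideal C \<T> X X \<Longrightarrow> f \<in> Hom C X Y \<Longrightarrow> f \<in> factor_ideal C \<T> X Y"
  using ideal_cmp_left cmp_idn by metis

text \<open>Inserting the identity of \<open>T\<close> between \<open>b\<close> and \<open>a\<close>
  rewrites each term through \<open>\<U>\<close>. This is transitivity of membership in additive
  closures and replaces the composition of decompositions.\<close>

lemma ideal_subset:
  assumes "\<And>T. T \<in> \<T> \<Longrightarrow> Idn C T \<in> factor_ideal C \<U> T T" "f \<in> factor_ideal C \<T> X Y"
  shows "f \<in> factor_ideal C \<U> X Y"
  using assms(2)
proof (induction rule: factor_ideal.induct)
  case zer
  then show ?case by (rule factor_ideal.zer)
next
  case (step T a b f)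
  have "b \<cdot> a \<in> factor_ideal C \<U> X Y"
    using ideal_cmp_left[OF ideal_idn_cmp[OF assms(1)[OF step(1)] step(2)] step(3)] .
  then show ?case using ideal_add step.IH by blast
qed

lemma ideal_idn: "X \<in> Obj C \<Longrightarrow> X \<in> \<T> \<Longrightarrow> Idn C X \<in> factor_ideal C \<T> X X"
  using ideal_single[of X \<T> "Idn C X" X "Idn C X" X] idn_hom idn_cmp by metis

lemma ideal_mono:
  assumes "f \<in> factor_ideal C \<T> X Y" "\<T> \<subseteq> \<U>" shows "f \<in> factor_ideal C \<U> X Y"
  using assms(1)
proof (induction rule: factor_ideal.induct)
  case (step T a b f)
  show ?case by (rule factor_ideal.step[OF _ step(2,3) step.IH]) (use step(1) assms(2) in blast)
qed (rule factor_ideal.zer)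

lemma ideal_hom_sum:
  assumes "finite I" "X \<in> Obj C" "Y \<in> Obj C" "\<And>i. i \<in> I \<Longrightarrow> f i \<in> factor_ideal C \<T> X Y"
  shows "hom_sum C X Y f I \<in> factor_ideal C \<T> X Y"
  using assms(1,4)
proof (induction I)
  case empty
  then show ?case using factor_ideal.zer assms by simp
next
  case (insert i I)
  have "hom_sum C X Y f (insert i I) = f i \<oplus> hom_sum C X Y f I"
    using hom_sum_insert[of I i X Y f] assms(2,3) insert ideal_hom by blast
  then show ?case using insert ideal_add by simp
qed

lemma ideal_direct_sum:
  assumes "direct_sum C Xs X" "\<And>Y. Y \<in> set Xs \<Longrightarrow> Idn C Y \<in> factor_ideal C \<T> Y Y"
  shows "Idn C X \<in> factor_ideal C \<T> X X"
proof -
  obtain \<iota> \<pi> where \<iota>: "\<And>i. i < length Xs \<Longrightarrow> \<iota> i \<in> Hom C (Xs ! i) X"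
    and \<pi>: "\<And>i. i < length Xs \<Longrightarrow> \<pi> i \<in> Hom C X (Xs ! i)"
    and id: "hom_sum C X X (\<lambda>i. \<iota> i \<cdot> \<pi> i) {..<length Xs} = Idn C X"
    using assms(1) unfolding direct_sum_def by blast
  have X: "X \<in> Obj C" using assms(1) by (simp add: direct_sum_def)
  have "\<iota> i \<cdot> \<pi> i \<in> factor_ideal C \<T> X X" if "i < length Xs" for i
    using ideal_cmp_left[OF ideal_idn_cmp[OF assms(2) \<pi>[OF that]] \<iota>[OF that]] that by simp
  then show ?thesis using ideal_hom_sum[of "{..<length Xs}" X X "\<lambda>i. \<iota> i \<cdot> \<pi> i" \<T>] X id by simp
qed

text \<open>Each term \<open>b \<cdot> a\<close> dies because \<open>a\<close> does. Vanishing
  against all of \<open>add T\<close> is thereby checked on \<open>T\<close> alone.\<close>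

lemma hom_zero_ideal_right:
  assumes "Idn C Y \<in> factor_ideal C \<T> Y Y" "X \<in> Obj C" "\<And>T. T \<in> \<T> \<Longrightarrow> hom_zero C X T"
  shows "hom_zero C X Y"
proof (rule hom_zeroI)
  have "g = Zer C X Z" if "g \<in> factor_ideal C \<T> X Z" for g Z
    using that
  proof (induction rule: factor_ideal.induct)
    case (step T a b f)
    have "b \<cdot> a = Zer C X Z"
      using hom_zeroD[OF assms(3)[OF step(1)] step(2)] cmp_zer[OF step(3) assms(2)] by simp
    then show ?case using step zer_add ideal_hom by metis
  qed simp
  then show "f = Zer C X Y" if "f \<in> Hom C X Y" for f using that ideal_idn_cmp[OF assms(1)] by blast
qed (use assms(1,2) ideal_hom hom_obj in blast)+

lemma hom_zero_ideal_left:
  assumes "Idn C X \<in> factor_ideal C \<T> X X" "Y \<in> Obj C" "\<And>T. T \<in> \<T> \<Longrightarrow> hom_zero C T Y"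
  shows "hom_zero C X Y"
proof (rule hom_zeroI)
  have "g = Zer C Z Y" if "g \<in> factor_ideal C \<T> Z Y" for g Z
    using that
  proof (induction rule: factor_ideal.induct)
    case (step T a b f)
    have "b \<cdot> a = Zer C Z Y"
      using hom_zeroD[OF assms(3)[OF step(1)] step(3)] zer_cmp[OF step(2) assms(2)] by simp
    then show ?case using step zer_add ideal_hom by metis
  qed simp
  then show "f = Zer C X Y" if "f \<in> Hom C X Y" for f using that ideal_cmp_idn[OF assms(1)] by blast
qed (use assms(1,2) ideal_hom hom_obj in blast)+

section \<open>Biproducts\<close>

lemma direct_sum_obj: "direct_sum C Xs X \<Longrightarrow> X \<in> Obj C \<and> set Xs \<subseteq> Obj C"
  by (simp add: direct_sum_def)

lemma direct_sum_retract:
  assumes "direct_sum C Xs X" "Y \<in> set Xs"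
  obtains s r where "s \<in> Hom C Y X" "r \<in> Hom C X Y" "r \<cdot> s = Idn C Y"
proof -
  obtain i where i: "i < length Xs" "Xs ! i = Y" using assms(2) by (auto simp: in_set_conv_nth)
  obtain \<iota> \<pi> where "\<forall>i < length Xs. \<iota> i \<in> Hom C (Xs ! i) X \<and> \<pi> i \<in> Hom C X (Xs ! i)"
    "\<forall>i < length Xs. \<forall>j < length Xs.
          \<pi> i \<cdot> \<iota> j = (if i = j then Idn C (Xs ! i) else Zer C (Xs ! j) (Xs ! i))"
    using assms(1) unfolding direct_sum_def by blast
  then have "\<iota> i \<in> Hom C Y X" "\<pi> i \<in> Hom C X Y" "\<pi> i \<cdot> \<iota> i = Idn C Y" using i by auto
  then show ?thesis using that by blast
qed

lemma direct_sum_idn: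
  assumes "direct_sum C Xs X" shows "Idn C X \<in> factor_ideal C (set Xs) X X"
  by (rule ideal_direct_sum[OF assms]) (use direct_sum_obj[OF assms] ideal_idn in blast)

lemma retract_idn:
  "s \<in> Hom C Y X \<Longrightarrow> r \<in> Hom C X Y \<Longrightarrow> r \<cdot> s = Idn C Y \<Longrightarrow> Idn C Y \<in> factor_ideal C {X} Y Y"
  using ideal_single[of X "{X}" s Y r Y] by simp

lemma direct_sum_idn_summand:
  assumes "direct_sum C Xs X" "Y \<in> set Xs" shows "Idn C Y \<in> factor_ideal C {X} Y Y"
  using direct_sum_retract[OF assms] retract_idn by metis

text \<open>Together with \<open>direct_sum_pairE\<close> this translates the list-indexed
  definition and its \<open>finprod\<close> into the four maps of a binary biproduct, so that later
  arguments are free of indices.\<close>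

lemma direct_sum_pairI:
  assumes "i \<in> Hom C X S" "j \<in> Hom C Y S" "p \<in> Hom C S X" "q \<in> Hom C S Y"
    "p \<cdot> i = Idn C X" "q \<cdot> j = Idn C Y" "p \<cdot> j = Zer C Y X" "q \<cdot> i = Zer C X Y"
    "(i \<cdot> p) \<oplus> (j \<cdot> q) = Idn C S"
  shows "direct_sum C [X, Y] S"
proof -
  define \<iota> where "\<iota> = (\<lambda>n::nat. if n = 0 then i else j)"
  define \<pi> where "\<pi> = (\<lambda>n::nat. if n = 0 then p else q)"
  have obj: "X \<in> Obj C" "Y \<in> Obj C" "S \<in> Obj C" using assms hom_obj by blast+
  have n: "{..<length [X, Y]} = insert 0 (insert 1 {})" by (auto simp: less_Suc_eq)
  have h: "\<iota> 0 \<cdot> \<pi> 0 \<in> Hom C S S" "\<iota> 1 \<cdot> \<pi> 1 \<in> Hom C S S"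
    using assms cmp_hom unfolding \<iota>_def \<pi>_def by auto
  have 1: "hom_sum C S S (\<lambda>i. \<iota> i \<cdot> \<pi> i) (insert 1 {}) = \<iota> 1 \<cdot> \<pi> 1"
    by (rule hom_sum_delta) (use obj h in auto)
  have 2: "hom_sum C S S (\<lambda>i. \<iota> i \<cdot> \<pi> i) (insert 0 (insert 1 {})) =
     (\<iota> 0 \<cdot> \<pi> 0) \<oplus> hom_sum C S S (\<lambda>i. \<iota> i \<cdot> \<pi> i) (insert 1 {})"
    by (rule hom_sum_insert) (use obj h in auto)
  have "hom_sum C S S (\<lambda>i. \<iota> i \<cdot> \<pi> i) {..<length [X, Y]} = Idn C S"
    unfolding n 2 1 using assms(9) by (simp add: \<iota>_def \<pi>_def)
  moreover have "\<forall>n < length [X, Y]. \<iota> n \<in> Hom C ([X, Y] ! n) S \<and> \<pi> n \<in> Hom C S ([X, Y] ! n)"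
    using assms by (auto simp: \<iota>_def \<pi>_def less_Suc_eq)
  moreover have "\<forall>n < length [X, Y]. \<forall>m < length [X, Y].
     \<pi> n \<cdot> \<iota> m = (if n = m then Idn C ([X, Y] ! n) else Zer C ([X, Y] ! m) ([X, Y] ! n))"
    using assms by (auto simp: \<iota>_def \<pi>_def less_Suc_eq)
  moreover have "set [X, Y] \<subseteq> Obj C" using obj by simp
  ultimately show ?thesis unfolding direct_sum_def using obj by blast
qed

lemma direct_sum_pairE:
  assumes "direct_sum C [X, Y] S"
  obtains i j p q where "i \<in> Hom C X S" "j \<in> Hom C Y S" "p \<in> Hom C S X" "q \<in> Hom C S Y"
    "p \<cdot> i = Idn C X" "q \<cdot> j = Idn C Y" "p \<cdot> j = Zer C Y X" "q \<cdot> i = Zer C X Y"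
    "(i \<cdot> p) \<oplus> (j \<cdot> q) = Idn C S"
proof -
  have obj: "X \<in> Obj C" "Y \<in> Obj C" "S \<in> Obj C" using assms by (auto simp: direct_sum_def)
  have n: "{..<length [X, Y]} = insert 0 (insert 1 {})" by (auto simp: less_Suc_eq)
  obtain \<iota> \<pi> where h: "\<forall>n < length [X, Y]. \<iota> n \<in> Hom C ([X, Y] ! n) S \<and> \<pi> n \<in> Hom C S ([X, Y] ! n)"
    and o: "\<forall>n < length [X, Y]. \<forall>m < length [X, Y].
     \<pi> n \<cdot> \<iota> m = (if n = m then Idn C ([X, Y] ! n) else Zer C ([X, Y] ! m) ([X, Y] ! n))"
    and s: "hom_sum C S S (\<lambda>i. \<iota> i \<cdot> \<pi> i) {..<length [X, Y]} = Idn C S"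
    using assms unfolding direct_sum_def by blast
  have h': "\<iota> 0 \<in> Hom C X S" "\<iota> 1 \<in> Hom C Y S" "\<pi> 0 \<in> Hom C S X" "\<pi> 1 \<in> Hom C S Y"
    using h by auto
  have hh: "\<iota> 0 \<cdot> \<pi> 0 \<in> Hom C S S" "\<iota> 1 \<cdot> \<pi> 1 \<in> Hom C S S" using h' cmp_hom by blast+
  have 1: "hom_sum C S S (\<lambda>i. \<iota> i \<cdot> \<pi> i) (insert 1 {}) = \<iota> 1 \<cdot> \<pi> 1"
    by (rule hom_sum_delta) (use obj hh in auto)
  have 2: "hom_sum C S S (\<lambda>i. \<iota> i \<cdot> \<pi> i) (insert 0 (insert 1 {})) =
     (\<iota> 0 \<cdot> \<pi> 0) \<oplus> hom_sum C S S (\<lambda>i. \<iota> i \<cdot> \<pi> i) (insert 1 {})"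
    by (rule hom_sum_insert) (use obj hh in auto)
  have s': "(\<iota> 0 \<cdot> \<pi> 0) \<oplus> (\<iota> 1 \<cdot> \<pi> 1) = Idn C S" using s unfolding n 2 1 .
  have "\<pi> 0 \<cdot> \<iota> 0 = Idn C X" "\<pi> 1 \<cdot> \<iota> 1 = Idn C Y" "\<pi> 0 \<cdot> \<iota> 1 = Zer C Y X" "\<pi> 1 \<cdot> \<iota> 0 = Zer C X Y"
    using o by auto
  then show ?thesis using that[OF h'] s' by blast
qed

text \<open>The injections and projections of the two sums are composed. This is what appends
  \<open>M'\<close> to the decomposition of \<open>T\<close> and gives a single list for
  \<open>T \<oplus> M'\<close>.\<close>

lemma direct_sum_append:
  assumes "direct_sum C Xs X" "direct_sum C [X, Y] S"
  shows "direct_sum C (Xs @ [Y]) S"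
proof -
  let ?n = "length Xs"
  obtain \<iota> \<pi> where \<iota>: "\<And>i. i < ?n \<Longrightarrow> \<iota> i \<in> Hom C (Xs ! i) X"
    and \<pi>: "\<And>i. i < ?n \<Longrightarrow> \<pi> i \<in> Hom C X (Xs ! i)"
    and o: "\<And>i j. i < ?n \<Longrightarrow> j < ?n \<Longrightarrow>
       \<pi> i \<cdot> \<iota> j = (if i = j then Idn C (Xs ! i) else Zer C (Xs ! j) (Xs ! i))"
    and id: "hom_sum C X X (\<lambda>i. \<iota> i \<cdot> \<pi> i) {..<?n} = Idn C X"
    using assms(1) unfolding direct_sum_def by blast
  obtain i j p q where ij: "i \<in> Hom C X S" "j \<in> Hom C Y S" "p \<in> Hom C S X" "q \<in> Hom C S Y"
    "p \<cdot> i = Idn C X" "q \<cdot> j = Idn C Y" "p \<cdot> j = Zer C Y X" "q \<cdot> i = Zer C X Y"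
    "(i \<cdot> p) \<oplus> (j \<cdot> q) = Idn C S"
    using direct_sum_pairE[OF assms(2)] by blast
  have obj: "X \<in> Obj C" "Y \<in> Obj C" "S \<in> Obj C" "\<And>k. k < ?n \<Longrightarrow> Xs ! k \<in> Obj C"
    using ij \<iota> hom_obj by blast+
  define \<iota>' where "\<iota>' = (\<lambda>k. if k < ?n then i \<cdot> \<iota> k else j)"
  define \<pi>' where "\<pi>' = (\<lambda>k. if k < ?n then \<pi> k \<cdot> p else q)"
  have h: "\<iota>' k \<in> Hom C ((Xs @ [Y]) ! k) S \<and> \<pi>' k \<in> Hom C S ((Xs @ [Y]) ! k)"
    if "k < length (Xs @ [Y])" for k
    using that \<iota>[of k] \<pi>[of k] ij cmp_hom by (auto simp: \<iota>'_def \<pi>'_def nth_append)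
  have o': "\<pi>' k \<cdot> \<iota>' l = (if k = l then Idn C ((Xs @ [Y]) ! k) else Zer C ((Xs @ [Y]) ! l) ((Xs @ [Y]) ! k))"
    if kl: "k < length (Xs @ [Y])" "l < length (Xs @ [Y])" for k l
  proof -
    consider "k < ?n" "l < ?n" | "k < ?n" "l = ?n" | "k = ?n" "l < ?n" | "k = ?n" "l = ?n"
      using kl by fastforce
    then show ?thesis
    proof cases
      case 1
      have "(\<pi> k \<cdot> p) \<cdot> (i \<cdot> \<iota> l) = \<pi> k \<cdot> ((p \<cdot> i) \<cdot> \<iota> l)"
        using cmp_assoc[OF cmp_hom[OF \<iota>[OF 1(2)] ij(1)] ij(3) \<pi>[OF 1(1)]]
          cmp_assoc[OF \<iota>[OF 1(2)] ij(1,3)] by simp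
      also have "\<dots> = \<pi> k \<cdot> \<iota> l" using ij(5) idn_cmp[OF \<iota>[OF 1(2)]] by simp
      finally show ?thesis using 1 o by (simp add: \<iota>'_def \<pi>'_def nth_append)
    next
      case 2
      have "(\<pi> k \<cdot> p) \<cdot> j = Zer C Y (Xs ! k)"
        using cmp_assoc[OF ij(2) ij(3) \<pi>[OF 2(1)]] ij(7) cmp_zer[OF \<pi>[OF 2(1)] obj(2)] by simp
      then show ?thesis using 2 by (simp add: \<iota>'_def \<pi>'_def nth_append)
    next
      case 3
      have "q \<cdot> (i \<cdot> \<iota> l) = Zer C (Xs ! l) Y"
        using cmp_assoc[OF \<iota>[OF 3(2)] ij(1) ij(4)] ij(8) zer_cmp[OF \<iota>[OF 3(2)] obj(2)] by simp
      then show ?thesis using 3 by (simp add: \<iota>'_def \<pi>'_def nth_append)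
    next
      case 4
      then show ?thesis using ij(6) by (simp add: \<iota>'_def \<pi>'_def nth_append)
    qed
  qed
  have cl: "(\<iota> k \<cdot> \<pi> k) \<in> Hom C X X" "(\<iota> k \<cdot> \<pi> k) \<cdot> p \<in> Hom C S X"
      "i \<cdot> ((\<iota> k \<cdot> \<pi> k) \<cdot> p) \<in> Hom C S S" if "k < ?n" for k
    using \<iota>[OF that] \<pi>[OF that] ij cmp_hom by blast+
  have a: "\<iota>' k \<cdot> \<pi>' k = i \<cdot> ((\<iota> k \<cdot> \<pi> k) \<cdot> p)" if "k < ?n" for k
    using cmp_assoc[OF cmp_hom[OF ij(3) \<pi>[OF that]] \<iota>[OF that] ij(1)]
      cmp_assoc[OF ij(3) \<pi>[OF that] \<iota>[OF that]] that by (simp add: \<iota>'_def \<pi>'_def)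
  have "hom_sum C S S (\<lambda>k. \<iota>' k \<cdot> \<pi>' k) {..<?n} = hom_sum C S S (\<lambda>k. i \<cdot> ((\<iota> k \<cdot> \<pi> k) \<cdot> p)) {..<?n}"
    by (rule hom_sum_cong) (use obj a cl in auto)
  also have "\<dots> = i \<cdot> hom_sum C S X (\<lambda>k. (\<iota> k \<cdot> \<pi> k) \<cdot> p) {..<?n}"
    by (rule cmp_hom_sum[symmetric]) (use obj cl ij in auto)
  also have "hom_sum C S X (\<lambda>k. (\<iota> k \<cdot> \<pi> k) \<cdot> p) {..<?n} = hom_sum C X X (\<lambda>k. \<iota> k \<cdot> \<pi> k) {..<?n} \<cdot> p"
    by (rule hom_sum_cmp[symmetric]) (use obj cl ij in auto)
  finally have b: "hom_sum C S S (\<lambda>k. \<iota>' k \<cdot> \<pi>' k) {..<?n} = i \<cdot> p"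
    using id idn_cmp[OF ij(3)] by simp
  have hh: "\<iota>' k \<cdot> \<pi>' k \<in> Hom C S S" if "k < length (Xs @ [Y])" for k using h[OF that] cmp_hom by blast
  have n: "{..<length (Xs @ [Y])} = insert ?n {..<?n}" by auto
  have "hom_sum C S S (\<lambda>k. \<iota>' k \<cdot> \<pi>' k) (insert ?n {..<?n}) =
      (\<iota>' ?n \<cdot> \<pi>' ?n) \<oplus> hom_sum C S S (\<lambda>k. \<iota>' k \<cdot> \<pi>' k) {..<?n}"
    by (rule hom_sum_insert) (use obj hh in auto)
  also have "\<dots> = (j \<cdot> q) \<oplus> (i \<cdot> p)" unfolding b by (simp add: \<iota>'_def \<pi>'_def)
  also have "\<dots> = Idn C S"
    using add_commute[OF cmp_hom[OF ij(4,2)] cmp_hom[OF ij(3,1)]] ij(9) by simp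
  finally have "hom_sum C S S (\<lambda>k. \<iota>' k \<cdot> \<pi>' k) {..<length (Xs @ [Y])} = Idn C S" unfolding n .
  moreover have "set (Xs @ [Y]) \<subseteq> Obj C" using obj direct_sum_obj[OF assms(1)] by simp
  moreover have "\<forall>k < length (Xs @ [Y]). \<iota>' k \<in> Hom C ((Xs @ [Y]) ! k) S \<and> \<pi>' k \<in> Hom C S ((Xs @ [Y]) ! k)"
    using h by blast
  moreover have "\<forall>k < length (Xs @ [Y]). \<forall>l < length (Xs @ [Y]).
     \<pi>' k \<cdot> \<iota>' l = (if k = l then Idn C ((Xs @ [Y]) ! k) else Zer C ((Xs @ [Y]) ! l) ((Xs @ [Y]) ! k))"
    using o' by blast
  ultimately show ?thesis unfolding direct_sum_def using obj by blast
qed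

text \<open>\<open>f\<close> and \<open>1 - f\<close> add up to the identity, so locality forbids
  both to be non-invertible.\<close>

lemma local_iso_or:
  assumes "local_endomorphism_ring C X" "f \<in> Hom C X X"
  shows "is_iso C X X f \<or> is_iso C X X (Idn C X \<oplus> (- 1) \<odot> f)"
proof -
  have X: "X \<in> Obj C" using assms(1) by (simp add: local_endomorphism_ring_def)
  have "f \<oplus> (Idn C X \<oplus> (- 1) \<odot> f) = Idn C X" using add_neg_cancel[OF idn_hom[OF X] assms(2)] .
  then show ?thesis
    using assms X idn_iso[OF X] idn_hom[OF X] add_hom scl_hom[OF assms(2)]
    unfolding local_endomorphism_ring_def by metis
qed

text \<open>An invertible sum in a local ring has an invertible term. If this is
  \<open>b \<cdot> a\<close>, then \<open>b\<close> corrected by its inverse is a retraction of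
  \<open>a\<close>.\<close>

lemma local_ideal_retract:
  assumes X: "local_endomorphism_ring C X" and "f \<in> factor_ideal C \<T> X X" "is_iso C X X f"
  shows "\<exists>T \<in> \<T>. \<exists>s \<in> Hom C X T. \<exists>r \<in> Hom C T X. r \<cdot> s = Idn C X"
  using assms(2,3)
proof (induction rule: factor_ideal.induct)
  case zer
  \<comment> \<open>An invertible zero makes the identity zero, which locality excludes.\<close>
  have "Zer C X X = Idn C X" using zer(3) zer(1) zer_cmp cmp_zer is_isoE by metis
  then show ?case using X by (simp add: local_endomorphism_ring_def)
next
  case (step T a b f)
  have ba: "b \<cdot> a \<in> Hom C X X" using step cmp_hom by blast
  show ?case
  proof (cases "is_iso C X X (b \<cdot> a)")
    case True
    then obtain u where u: "u \<in> Hom C X X" "u \<cdot> (b \<cdot> a) = Idn C X" using is_isoE by metis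
    have "(u \<cdot> b) \<cdot> a = Idn C X" using cmp_assoc[OF step(2,3) u(1)] u(2) by simp
    then show ?thesis using step(1,2) cmp_hom[OF step(3) u(1)] by blast
  next
    case False
    then have "is_iso C X X f"
      using X step.prems ba ideal_hom[OF step(4)] unfolding local_endomorphism_ring_def by blast
    then show ?thesis using step.IH by blast
  qed
qed

lemma idem_iso_idn:
  assumes "is_iso C X X e" "e \<cdot> e = e" shows "e = Idn C X"
proof -
  obtain u where u: "u \<in> Hom C X X" "e \<in> Hom C X X" "u \<cdot> e = Idn C X" using assms(1) is_isoE by metis
  have "e = (u \<cdot> e) \<cdot> e" using u idn_cmp by simp
  also have "\<dots> = Idn C X" using cmp_assoc[OF u(2,2,1)] assms(2) u(3) by simp
  finally show ?thesis .
qed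

text \<open>Correct \<open>b\<close> to \<open>r\<close> with \<open>r \<cdot> a = 1\<close>. Then
  \<open>a \<cdot> r\<close> is idempotent, and the complementary idempotent kills the nonzero
  morphism \<open>a\<close>, so it is not invertible. Locality of \<open>T\<close> makes
  \<open>a \<cdot> r\<close> invertible, hence the identity.\<close>

lemma local_retract_section_iso:
  assumes "local_endomorphism_ring C X" "local_endomorphism_ring C T"
    and a: "a \<in> Hom C X T" and b: "b \<in> Hom C T X" and ba: "is_iso C X X (b \<cdot> a)"
  shows "is_iso C X T a" "is_iso C T X b"
proof -
  obtain u where u: "is_iso C X X u" "u \<in> Hom C X X" "u \<cdot> (b \<cdot> a) = Idn C X" using is_isoE[OF ba] by metis
  define r where "r = u \<cdot> b"
  have r: "r \<in> Hom C T X" and ra: "r \<cdot> a = Idn C X"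
    unfolding r_def using cmp_hom[OF b u(2)] cmp_assoc[OF a b u(2)] u(3) by simp_all
  have X: "X \<in> Obj C" "Idn C X \<noteq> Zer C X X" and T: "T \<in> Obj C"
    using assms(1,2) by (auto simp: local_endomorphism_ring_def)
  have ar: "a \<cdot> r \<in> Hom C T T" using a r cmp_hom by blast
  have ara: "(a \<cdot> r) \<cdot> a = a" using cmp_assoc[OF a r a] ra cmp_idn[OF a] by simp
  have idem: "(a \<cdot> r) \<cdot> (a \<cdot> r) = a \<cdot> r" using cmp_assoc[OF r a ar] ara by simp
  have "\<not> is_iso C T T (Idn C T \<oplus> (- 1) \<odot> (a \<cdot> r))"
  proof
    assume iso: "is_iso C T T (Idn C T \<oplus> (- 1) \<odot> (a \<cdot> r))" (is "is_iso C T T ?e")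
    obtain v where v: "v \<in> Hom C T T" "v \<cdot> ?e = Idn C T" using is_isoE[OF iso] by metis
    have I: "Idn C T \<in> Hom C T T" using idn_hom[OF T] .
    have "?e \<cdot> a = a \<oplus> (- 1) \<odot> a"
      using add_cmp[OF a I scl_hom[OF ar]] scl_cmp[OF a ar] ara idn_cmp[OF a] by simp
    then have "?e \<cdot> a = Zer C X T" using add_neg[OF a] by simp
    then have "a = Zer C X T"
      using cmp_assoc[OF a iso_hom[OF iso] v(1)] v(2) idn_cmp[OF a] cmp_zer[OF v(1) X(1)] by simp
    then show False using ra cmp_zer[OF r X(1)] X(2) by simp
  qed
  then have "a \<cdot> r = Idn C T" using local_iso_or[OF assms(2) ar] idem_iso_idn idem by blast
  then have 1: "is_iso C X T a" "is_iso C T X r" using is_isoI a r ra by blast+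
  then show "is_iso C X T a" by blast
  have "b = (b \<cdot> a) \<cdot> r"
    using cmp_assoc[OF r a b] \<open>a \<cdot> r = Idn C T\<close> cmp_idn[OF b] by simp
  then show "is_iso C T X b" using iso_cmp[OF 1(2) ba] by simp
qed

text \<open>A decomposition gives complementary orthogonal idempotents \<open>i \<cdot> p\<close>
  and \<open>j \<cdot> q\<close>; whichever is invertible annihilates the inclusion of the other
  summand, which is therefore zero. The criterion asks only about \<open>f\<close> and
  \<open>1 - f\<close>, since this is what can be read off from endomorphisms of a triangle.\<close>

lemma indecomposableI:
  assumes "X \<in> Obj C" "Idn C X \<noteq> Zer C X X"
    and "\<And>f. f \<in> Hom C X X \<Longrightarrow> is_iso C X X f \<or> is_iso C X X (Idn C X \<oplus> (- 1) \<odot> f)"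
  shows "indecomposable C X"
proof -
  have "zero_object C Y \<or> zero_object C Z" if YZ: "direct_sum C [Y, Z] X" for Y Z
  proof -
    obtain i j p q where ij: "i \<in> Hom C Y X" "j \<in> Hom C Z X" "p \<in> Hom C X Y" "q \<in> Hom C X Z"
      "p \<cdot> i = Idn C Y" "q \<cdot> j = Idn C Z" "p \<cdot> j = Zer C Z Y" "q \<cdot> i = Zer C Y Z"
      "(i \<cdot> p) \<oplus> (j \<cdot> q) = Idn C X"
      using direct_sum_pairE[OF YZ] by blast
    have ip: "i \<cdot> p \<in> Hom C X X" and jq: "j \<cdot> q \<in> Hom C X X" using ij cmp_hom by blast+
    have obj: "Y \<in> Obj C" "Z \<in> Obj C" using ij hom_obj by blast+
    have ipj: "(i \<cdot> p) \<cdot> j = Zer C Z X"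
      using cmp_assoc[OF ij(2,3,1)] ij(7) cmp_zer[OF ij(1) obj(2)] by simp
    have jqi: "(j \<cdot> q) \<cdot> i = Zer C Y X"
      using cmp_assoc[OF ij(1,4,2)] ij(8) cmp_zer[OF ij(2) obj(1)] by simp
    have "Idn C X \<oplus> (- 1) \<odot> (i \<cdot> p) = ((i \<cdot> p) \<oplus> (j \<cdot> q)) \<oplus> (- 1) \<odot> (i \<cdot> p)" using ij(9) by simp
    also have "\<dots> = ((j \<cdot> q) \<oplus> (i \<cdot> p)) \<oplus> (- 1) \<odot> (i \<cdot> p)" using add_commute[OF ip jq] by simp
    also have "\<dots> = j \<cdot> q" using add_assoc[OF jq ip scl_hom[OF ip]] add_neg[OF ip] add_zer[OF jq] by simp
    finally have sub: "Idn C X \<oplus> (- 1) \<odot> (i \<cdot> p) = j \<cdot> q" .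
    from assms(3)[OF ip] show ?thesis
    proof
      assume "is_iso C X X (i \<cdot> p)"
      then obtain u where u: "u \<in> Hom C X X" "u \<cdot> (i \<cdot> p) = Idn C X" using is_isoE by metis
      have "j = u \<cdot> ((i \<cdot> p) \<cdot> j)" using cmp_assoc[OF ij(2) ip u(1)] u(2) idn_cmp[OF ij(2)] by simp
      then have "j = Zer C Z X" using ipj cmp_zer[OF u(1) obj(2)] by simp
      then show ?thesis using ij(6) cmp_zer[OF ij(4) obj(2)] obj by (simp add: zero_object_def)
    next
      assume "is_iso C X X (Idn C X \<oplus> (- 1) \<odot> (i \<cdot> p))"
      then obtain u where u: "u \<in> Hom C X X" "u \<cdot> (j \<cdot> q) = Idn C X" using sub is_isoE by metis
      have "i = u \<cdot> ((j \<cdot> q) \<cdot> i)" using cmp_assoc[OF ij(1) jq u(1)] u(2) idn_cmp[OF ij(1)] by simp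
      then have "i = Zer C Y X" using jqi cmp_zer[OF u(1) obj(1)] by simp
      then show ?thesis using ij(5) cmp_zer[OF ij(3) obj(1)] obj by (simp add: zero_object_def)
    qed
  qed
  then show ?thesis using assms(1,2) unfolding indecomposable_def zero_object_def by blast
qed

lemma local_indecomposable: "local_endomorphism_ring C X \<Longrightarrow> indecomposable C X"
  by (rule indecomposableI) (use local_iso_or in \<open>auto simp: local_endomorphism_ring_def\<close>)

lemma iso_conj_iff:
  assumes u: "is_iso C X Y u" "v \<in> Hom C Y X" "v \<cdot> u = Idn C X" "u \<cdot> v = Idn C Y" and f: "f \<in> Hom C Y Y"
  shows "is_iso C X X (v \<cdot> (f \<cdot> u)) \<longleftrightarrow> is_iso C Y Y f"
proof
  have v: "is_iso C Y X v" using u is_isoI iso_hom by metis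
  have uh: "u \<in> Hom C X Y" using u iso_hom by blast
  show "is_iso C Y Y f \<Longrightarrow> is_iso C X X (v \<cdot> (f \<cdot> u))" using iso_cmp u v by blast
  assume "is_iso C X X (v \<cdot> (f \<cdot> u))"
  then have i: "is_iso C Y Y (u \<cdot> ((v \<cdot> (f \<cdot> u)) \<cdot> v))" using iso_cmp u v by blast
  have fu: "f \<cdot> u \<in> Hom C X Y" using f uh cmp_hom by blast
  have "u \<cdot> ((v \<cdot> (f \<cdot> u)) \<cdot> v) = (u \<cdot> (v \<cdot> (f \<cdot> u))) \<cdot> v"
    using cmp_assoc[OF u(2) cmp_hom[OF fu u(2)] uh] by simp
  also have "u \<cdot> (v \<cdot> (f \<cdot> u)) = f \<cdot> u" using cmp_assoc[OF fu u(2) uh] u(4) idn_cmp[OF fu] by simp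
  also have "(f \<cdot> u) \<cdot> v = f" using cmp_assoc[OF u(2) uh f] u(4) cmp_idn[OF f] by simp
  finally show "is_iso C Y Y f" using i by simp
qed

lemma local_iso:
  assumes "local_endomorphism_ring C X" "isomorphic C X Y"
  shows "local_endomorphism_ring C Y"
proof -
  obtain u v where uv: "is_iso C X Y u" "v \<in> Hom C Y X" "v \<cdot> u = Idn C X" "u \<cdot> v = Idn C Y"
    using assms(2) unfolding isomorphic_def is_iso_def by blast
  have u: "u \<in> Hom C X Y" using uv iso_hom by blast
  have obj: "X \<in> Obj C" "Y \<in> Obj C" using u hom_obj by blast+
  have 0: "Idn C Y \<noteq> Zer C Y Y"
  proof
    assume "Idn C Y = Zer C Y Y"
    then have "u = Zer C X Y" using idn_cmp[OF u] zer_cmp[OF u obj(2)] by simp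
    then have "Idn C X = Zer C X X" using uv(3) cmp_zer[OF uv(2) obj(1)] by simp
    then show False using assms(1) by (simp add: local_endomorphism_ring_def)
  qed
  have "\<not> is_iso C Y Y (f \<oplus> g)"
    if fg: "f \<in> Hom C Y Y" "g \<in> Hom C Y Y" "\<not> is_iso C Y Y f" "\<not> is_iso C Y Y g" for f g
  proof -
    have h: "f \<cdot> u \<in> Hom C X Y" "g \<cdot> u \<in> Hom C X Y" using fg u cmp_hom by blast+
    have "v \<cdot> ((f \<oplus> g) \<cdot> u) = (v \<cdot> (f \<cdot> u)) \<oplus> (v \<cdot> (g \<cdot> u))"
      using add_cmp[OF u fg(1,2)] cmp_add[OF h uv(2)] by simp
    moreover have "\<not> is_iso C X X (v \<cdot> (f \<cdot> u))" "\<not> is_iso C X X (v \<cdot> (g \<cdot> u))"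
      using iso_conj_iff[OF uv] fg by blast+
    ultimately have "\<not> is_iso C X X (v \<cdot> ((f \<oplus> g) \<cdot> u))"
      using assms(1) h uv(2) cmp_hom unfolding local_endomorphism_ring_def by metis
    then show ?thesis using iso_conj_iff[OF uv add_hom[OF fg(1,2)]] by blast
  qed
  then show ?thesis using 0 obj unfolding local_endomorphism_ring_def by blast
qed

end

section \<open>Triangulated categories\<close>

context additive_category
begin

lemma zero_object_exists: "\<exists>Z. zero_object C Z"
proof -
  obtain Z where "direct_sum C [] Z" using direct_sum_exists[of "[]"] by auto
  then have "Z \<in> Obj C" "hom_sum C Z Z (\<lambda>i. undefined) {} = Idn C Z"
    by (auto simp: direct_sum_def)
  then show ?thesis by (auto simp: zero_object_def)
qed

end

text \<open>A Hom set contains the zero morphism, so it vanishes exactly if it has one element, and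
  having one element is preserved by a bijection.\<close>

lemma automorphism_hom_zero:
  assumes "automorphism D F" "linear_category D" "X \<in> Obj D" "Y \<in> Obj D"
  shows "hom_zero D (fob F X) (fob F Y) \<longleftrightarrow> hom_zero D X Y"
proof -
  interpret linear_category D by (rule assms(2))
  have bij: "bij_betw (far F) (Hom D X Y) (Hom D (fob F X) (fob F Y))"
    using assms by (auto simp: automorphism_def)
  have obj: "fob F X \<in> Obj D" "fob F Y \<in> Obj D"
    using assms by (auto simp: automorphism_def linear_functor_def)
  have "is_singleton (Hom D (fob F X) (fob F Y)) \<longleftrightarrow> is_singleton (Hom D X Y)"
    using bij_betw_same_card[OF bij] by (simp add: is_singleton_altdef)
  moreover have "hom_zero D A B \<longleftrightarrow> is_singleton (Hom D A B)" if "A \<in> Obj D" "B \<in> Obj D" for A B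
    unfolding hom_zero_def is_singleton_def using zer_hom[OF that] by auto
  ultimately show ?thesis using assms(3,4) obj by simp
qed

context triangulated_category
begin

lemma shift_obj: "X \<in> Obj C \<Longrightarrow> fob S X \<in> Obj C"
  and shift_idn: "X \<in> Obj C \<Longrightarrow> far S (Idn C X) = Idn C (fob S X)"
  and shift_hom: "f \<in> Hom C X Y \<Longrightarrow> far S f \<in> Hom C (fob S X) (fob S Y)"
  and shift_cmp: "f \<in> Hom C X Y \<Longrightarrow> g \<in> Hom C Y Z \<Longrightarrow> far S (g \<cdot> f) = far S g \<cdot> far S f"
  and shift_add: "f \<in> Hom C X Y \<Longrightarrow> g \<in> Hom C X Y \<Longrightarrow> far S (f \<oplus> g) = far S f \<oplus> far S g"
  and shift_scl: "f \<in> Hom C X Y \<Longrightarrow> far S (a \<odot> f) = a \<odot> far S f"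
  using shift_automorphism unfolding automorphism_def linear_functor_def by blast+

lemma shift_zer: "X \<in> Obj C \<Longrightarrow> Y \<in> Obj C \<Longrightarrow> far S (Zer C X Y) = Zer C (fob S X) (fob S Y)"
  using shift_scl[OF zer_hom, of X Y 0] zero_scl[OF shift_hom[OF zer_hom, of X Y]] zero_scl[OF zer_hom, of X Y]
  by simp

lemma shift_bij: "X \<in> Obj C \<Longrightarrow> Y \<in> Obj C
    \<Longrightarrow> bij_betw (far S) (Hom C X Y) (Hom C (fob S X) (fob S Y))"
  using shift_automorphism unfolding automorphism_def by blast

lemma shift_full:
  assumes "f \<in> Hom C (fob S X) (fob S Y)" "X \<in> Obj C" "Y \<in> Obj C"
  obtains g where "g \<in> Hom C X Y" "f = far S g"
  using shift_bij[OF assms(2,3)] assms(1) that unfolding bij_betw_def by blast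

lemma shift_faithful:
  "f \<in> Hom C X Y \<Longrightarrow> g \<in> Hom C X Y \<Longrightarrow> far S f = far S g \<Longrightarrow> f = g"
  using shift_bij hom_obj unfolding bij_betw_def inj_on_def by metis

lemma shift_hom_zero: "X \<in> Obj C \<Longrightarrow> Y \<in> Obj C \<Longrightarrow> hom_zero C (fob S X) (fob S Y) \<longleftrightarrow> hom_zero C X Y"
  using automorphism_hom_zero[OF shift_automorphism] linear_category_axioms by blast

lemma shift_zero_object: "zero_object C X \<Longrightarrow> zero_object C (fob S X)"
  by (simp add: zero_object_def shift_obj shift_zer flip: shift_idn)

text \<open>\<open>\<Delta>\<close> holds bare triples of morphisms. The objects, which
  \<open>hom_disjoint\<close> makes unique, are carried along because every diagram chase refers to
  them.\<close>

definition distinguished :: "'o \<Rightarrow> 'o \<Rightarrow> 'o \<Rightarrow> 'a \<Rightarrow> 'a \<Rightarrow> 'a \<Rightarrow> bool" where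
  "distinguished X Y Z f g h \<longleftrightarrow> (f, g, h) \<in> \<Delta> \<and> is_triangle C S X Y Z (f, g, h)"

lemma distinguished_hom:
  assumes "distinguished X Y Z f g h"
  shows "f \<in> Hom C X Y" "g \<in> Hom C Y Z" "h \<in> Hom C Z (fob S X)"
  using assms by (auto simp: distinguished_def is_triangle_def)

lemma distinguished_obj:
  assumes "distinguished X Y Z f g h"
  shows "X \<in> Obj C" "Y \<in> Obj C" "Z \<in> Obj C"
  using distinguished_hom[OF assms] hom_obj by blast+

lemma distinguished_rotate:
  assumes "distinguished X Y Z f g h"
  shows "distinguished Y Z (fob S X) g h ((- 1) \<odot> far S f)"
  using assms dist_rotate[of X Y Z f g h] shift_hom scl_hom
  unfolding distinguished_def by (auto simp: is_triangle_def)

lemma distinguished_exists: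
  assumes "f \<in> Hom C X Y"
  obtains Z g h where "distinguished X Y Z f g h"
proof -
  obtain g h where gh: "(f, g, h) \<in> \<Delta>" using dist_exists[OF assms] by blast
  obtain X' Y' Z where t: "is_triangle C S X' Y' Z (f, g, h)" using dist_triangle[OF gh] by blast
  then have "X' = X" "Y' = Y" using hom_disjoint assms unfolding is_triangle_def by blast+
  then show ?thesis using that gh t by (simp add: distinguished_def)
qed

lemma distinguished_morphism:
  assumes "distinguished X Y Z f g h" "distinguished X' Y' Z' f' g' h'"
    "u \<in> Hom C X X'" "v \<in> Hom C Y Y'" "v \<cdot> f = f' \<cdot> u"
  obtains w where "w \<in> Hom C Z Z'" "w \<cdot> g = g' \<cdot> v" "far S u \<cdot> h = h' \<cdot> w"
  using dist_morphism[of f g h f' g' h' X Y Z X' Y' Z' u v] assms that unfolding distinguished_def by blast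

section \<open>Exactness of Hom functors along a triangle\<close>

lemma neg_inject: "f \<in> Hom C X Y \<Longrightarrow> g \<in> Hom C X Y \<Longrightarrow> (- 1) \<odot> f = (- 1) \<odot> g \<Longrightarrow> f = g"
  using neg_neg by metis

text \<open>The triangle \<open>W \<rightarrow> W \<rightarrow> 0\<close>, rotated once, maps to the
  rotated triangle of \<open>f\<close> by \<open>v\<close> and a zero morphism. The third component
  is a morphism between shifts and desuspends to \<open>u\<close>.\<close>

lemma exact_second:
  assumes d: "distinguished X Y Z f g h" and v: "v \<in> Hom C W Y" and 0: "g \<cdot> v = Zer C W Z"
  obtains u where "u \<in> Hom C W X" "v = f \<cdot> u"
proof -
  obtain N where N: "zero_object C N" using zero_object_exists by blast
  have obj: "W \<in> Obj C" "N \<in> Obj C" "X \<in> Obj C" "Y \<in> Obj C" "Z \<in> Obj C"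
    using v N hom_obj distinguished_obj[OF d] by (auto simp: zero_object_def)
  note fgh = distinguished_hom[OF d]
  have "distinguished W W N (Idn C W) (Zer C W N) (Zer C N (fob S W))"
    unfolding distinguished_def is_triangle_def using dist_idn[OF obj(1) N] obj zer_hom idn_hom shift_obj by auto
  from distinguished_rotate[OF this]
  have t: "distinguished W N (fob S W) (Zer C W N) (Zer C N (fob S W)) ((- 1) \<odot> far S (Idn C W))" .
  have c: "Zer C N Z \<cdot> Zer C W N = g \<cdot> v" using 0 zer_cmp[OF zer_hom[OF obj(1,2)] obj(5)] by simp
  obtain w where w: "w \<in> Hom C (fob S W) (fob S X)"
    "far S v \<cdot> ((- 1) \<odot> far S (Idn C W)) = ((- 1) \<odot> far S f) \<cdot> w"
    using distinguished_morphism[OF t distinguished_rotate[OF d] v zer_hom[OF obj(2,5)] c] by blast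
  obtain u where u: "u \<in> Hom C W X" "w = far S u" using shift_full[OF w(1) obj(1,3)] by blast
  have Sv: "far S v \<in> Hom C (fob S W) (fob S Y)" using shift_hom[OF v] .
  have fu: "f \<cdot> u \<in> Hom C W Y" using u fgh cmp_hom by blast
  \<comment> \<open>Both rotations contribute a sign, and the two signs cancel.\<close>
  have "(- 1) \<odot> far S v = far S v \<cdot> ((- 1) \<odot> far S (Idn C W))"
    using cmp_scl[OF shift_hom[OF idn_hom[OF obj(1)]] Sv] shift_idn[OF obj(1)] cmp_idn[OF Sv] by simp
  also have "\<dots> = (- 1) \<odot> far S (f \<cdot> u)"
    using w(2) u(2) scl_cmp[OF shift_hom[OF u(1)] shift_hom[OF fgh(1)]] shift_cmp[OF u(1) fgh(1)] by simp
  finally have "far S v = far S (f \<cdot> u)" using neg_inject[OF Sv shift_hom[OF fu]] by blast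
  then show ?thesis using shift_faithful[OF v fu] that u(1) by blast
qed

lemma exact_third:
  assumes d: "distinguished X Y Z f g h" and v: "v \<in> Hom C W Z" "h \<cdot> v = Zer C W (fob S X)"
  obtains u where "u \<in> Hom C W Y" "v = g \<cdot> u"
  using exact_second[OF distinguished_rotate[OF d] v] that by blast

lemma exact_fourth:
  assumes d: "distinguished X Y Z f g h" and v: "v \<in> Hom C W (fob S X)"
    and 0: "far S f \<cdot> v = Zer C W (fob S Y)"
  obtains u where "u \<in> Hom C W Z" "v = h \<cdot> u"
proof -
  have Sf: "far S f \<in> Hom C (fob S X) (fob S Y)" using distinguished_hom[OF d] shift_hom by blast
  have "((- 1) \<odot> far S f) \<cdot> v = Zer C W (fob S Y)"
    using scl_cmp[OF v Sf] 0 scl_zer hom_obj[OF v] hom_obj[OF Sf] by simp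
  then show ?thesis using exact_third[OF distinguished_rotate[OF d] v] that by blast
qed

text \<open>Dually, the given triangle is mapped to the trivial triangle on
  \<open>0 \<rightarrow> W \<rightarrow> W\<close>; the third component of this morphism is
  \<open>u\<close>.\<close>

lemma coexact_second:
  assumes d: "distinguished X Y Z f g h" and v: "v \<in> Hom C Y W" and 0: "v \<cdot> f = Zer C X W"
  obtains u where "u \<in> Hom C Z W" "v = u \<cdot> g"
proof -
  obtain N where N: "zero_object C N" using zero_object_exists by blast
  have obj: "W \<in> Obj C" "N \<in> Obj C" "X \<in> Obj C" "Y \<in> Obj C" "Z \<in> Obj C"
    using v N hom_obj distinguished_obj[OF d] by (auto simp: zero_object_def)
  have SN: "fob S N \<in> Obj C" using shift_obj[OF obj(2)] .
  have tri: "is_triangle C S N W W (Zer C N W, Idn C W, Zer C W (fob S N))"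
    unfolding is_triangle_def using obj zer_hom idn_hom SN by auto
  \<comment> \<open>The trivial triangle is found by rotating backwards: its rotation is the
    identity triangle of \<open>W\<close> with zero object \<open>fob S N\<close>.\<close>
  have "(Idn C W, Zer C W (fob S N), (- 1) \<odot> far S (Zer C N W)) \<in> \<Delta>"
    using dist_idn[OF obj(1) shift_zero_object[OF N]] shift_zer[OF obj(2,1)]
      scl_zer[OF SN shift_obj[OF obj(1)]] by simp
  then have t: "distinguished N W W (Zer C N W) (Idn C W) (Zer C W (fob S N))"
    unfolding distinguished_def using dist_rotate[OF tri] tri by simp
  have c: "v \<cdot> f = Zer C N W \<cdot> Zer C X N" using 0 zer_cmp[OF zer_hom[OF obj(3,2)] obj(1)] by simp
  obtain w where w: "w \<in> Hom C Z W" "w \<cdot> g = Idn C W \<cdot> v"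
    using distinguished_morphism[OF d t zer_hom[OF obj(3,2)] v c] by blast
  then show ?thesis using that idn_cmp[OF v] by simp
qed

lemma coexact_third:
  assumes d: "distinguished X Y Z f g h" and v: "v \<in> Hom C Z W" "v \<cdot> g = Zer C Y W"
  obtains u where "u \<in> Hom C (fob S X) W" "v = u \<cdot> h"
  using coexact_second[OF distinguished_rotate[OF d] v] that by blast

text \<open>\<open>far S v \<cdot> h\<close> is the obstruction to extending \<open>v\<close> along
  \<open>f\<close>. The sign of the rotation is absorbed by replacing the desuspended
  \<open>u\<close> with its negative.\<close>

lemma coexact_fourth:
  assumes d: "distinguished X Y Z f g h" and v: "v \<in> Hom C X W"
    and 0: "far S v \<cdot> h = Zer C Z (fob S W)"
  obtains u where "u \<in> Hom C Y W" "v = u \<cdot> f"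
proof -
  note fgh = distinguished_hom[OF d]
  obtain w where w: "w \<in> Hom C (fob S Y) (fob S W)" "far S v = w \<cdot> ((- 1) \<odot> far S f)"
    using coexact_third[OF distinguished_rotate[OF d] shift_hom[OF v] 0] by blast
  obtain u where u: "u \<in> Hom C Y W" "w = far S u"
    using shift_full[OF w(1)] hom_obj fgh v by blast
  have nu: "(- 1) \<odot> u \<in> Hom C Y W" using scl_hom[OF u(1)] .
  have "far S v = (- 1) \<odot> (far S u \<cdot> far S f)"
    using w(2) u(2) cmp_scl[OF shift_hom[OF fgh(1)] shift_hom[OF u(1)]] by simp
  also have "\<dots> = far S (((- 1) \<odot> u) \<cdot> f)"
    using shift_scl[OF cmp_hom[OF fgh(1) u(1)]] shift_cmp[OF fgh(1) u(1)] scl_cmp[OF fgh(1) u(1)] by simp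
  finally have "v = ((- 1) \<odot> u) \<cdot> f" using shift_faithful[OF v cmp_hom[OF fgh(1) nu]] by blast
  then show ?thesis using that nu by blast
qed

lemma distinguished_cmp_zer:
  assumes d: "distinguished X Y Z f g h"
  shows "g \<cdot> f = Zer C X Z"
proof -
  note fgh = distinguished_hom[OF d]
  obtain N where N: "zero_object C N" using zero_object_exists by blast
  have obj: "N \<in> Obj C" "X \<in> Obj C" "Y \<in> Obj C" "Z \<in> Obj C"
    using N distinguished_obj[OF d] by (auto simp: zero_object_def)
  have t: "distinguished X X N (Idn C X) (Zer C X N) (Zer C N (fob S X))"
    unfolding distinguished_def is_triangle_def using dist_idn[OF obj(2) N] obj zer_hom idn_hom shift_obj by auto
  obtain w where w: "w \<in> Hom C N Z" "w \<cdot> Zer C X N = g \<cdot> f"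
    using distinguished_morphism[OF t d idn_hom[OF obj(2)] fgh(1)] by blast
  then show ?thesis using cmp_zer[OF w(1) obj(2)] by simp
qed

lemma distinguished_cmp_zer':
  "distinguished X Y Z f g h \<Longrightarrow> h \<cdot> g = Zer C Y (fob S X)"
  using distinguished_cmp_zer[OF distinguished_rotate] .

lemma distinguished_cmp_zer'':
  assumes d: "distinguished X Y Z f g h" shows "far S f \<cdot> h = Zer C Z (fob S Y)"
proof -
  note fgh = distinguished_hom[OF d]
  have "(- 1) \<odot> (far S f \<cdot> h) = Zer C Z (fob S Y)"
    using distinguished_cmp_zer'[OF distinguished_rotate[OF d]] scl_cmp[OF fgh(3) shift_hom[OF fgh(1)]] by simp
  then show ?thesis using neg_zer_iff[OF cmp_hom[OF fgh(3) shift_hom[OF fgh(1)]]] by simp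
qed

text \<open>The complement is the cone \<open>Y\<close> of \<open>s\<close>. As
  \<open>far S s\<close> is split mono and \<open>far S s \<cdot> h = 0\<close>, the morphism
  \<open>h\<close> is zero. Hence \<open>g\<close> is epi, and the idempotent
  \<open>1 - s \<cdot> r\<close> factors as \<open>j \<cdot> g\<close>, which supplies the inclusion
  \<open>j\<close> of \<open>Y\<close>.\<close>

lemma split_mono_summand:
  assumes s: "s \<in> Hom C X U" and r: "r \<in> Hom C U X" and rs: "r \<cdot> s = Idn C X"
  shows "summand C X U"
proof -
  obtain Y g h where d: "distinguished X U Y s g h" using distinguished_exists[OF s] .
  note fgh = distinguished_hom[OF d]
  have obj: "X \<in> Obj C" "U \<in> Obj C" "Y \<in> Obj C" using distinguished_obj[OF d] .
  have "h = (far S r \<cdot> far S s) \<cdot> h"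
    using shift_cmp[OF s r] rs shift_idn[OF obj(1)] idn_cmp[OF fgh(3)] by simp
  also have "\<dots> = far S r \<cdot> (far S s \<cdot> h)" using cmp_assoc[OF fgh(3) shift_hom[OF s] shift_hom[OF r]] .
  also have "\<dots> = Zer C Y (fob S X)"
    using distinguished_cmp_zer''[OF d] cmp_zer[OF shift_hom[OF r] obj(3)] by simp
  finally have h0: "h = Zer C Y (fob S X)" .
  have sr: "s \<cdot> r \<in> Hom C U U" using s r cmp_hom by blast
  define e where "e = Idn C U \<oplus> (- 1) \<odot> (s \<cdot> r)"
  have e: "e \<in> Hom C U U" unfolding e_def using idn_hom[OF obj(2)] scl_hom[OF sr] add_hom by blast
  have "e \<cdot> s = s \<oplus> (- 1) \<odot> s"
    unfolding e_def using add_cmp[OF s idn_hom[OF obj(2)] scl_hom[OF sr]] scl_cmp[OF s sr]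
      cmp_assoc[OF s r s] rs cmp_idn[OF s] idn_cmp[OF s] by simp
  then have es: "e \<cdot> s = Zer C X U" using add_neg[OF s] by simp
  obtain j where j: "j \<in> Hom C Y U" "e = j \<cdot> g" using coexact_second[OF d e es] by blast
  have re: "r \<cdot> e = Zer C U X"
  proof -
    have "r \<cdot> e = r \<oplus> (- 1) \<odot> r"
      unfolding e_def using cmp_add[OF idn_hom[OF obj(2)] scl_hom[OF sr] r] cmp_scl[OF sr r]
        cmp_assoc[OF r s r] rs cmp_idn[OF r] idn_cmp[OF r] by simp
    then show ?thesis using add_neg[OF r] by simp
  qed
  have epi: "v = v'" if v: "v \<in> Hom C Y W" "v' \<in> Hom C Y W" and eq: "v \<cdot> g = v' \<cdot> g" for v v' W
  proof -
    have m: "v \<oplus> (- 1) \<odot> v' \<in> Hom C Y W" using v scl_hom add_hom by blast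
    have "(v \<oplus> (- 1) \<odot> v') \<cdot> g = Zer C U W"
      using add_cmp[OF fgh(2) v(1) scl_hom[OF v(2)]] scl_cmp[OF fgh(2) v(2)] eq
        add_neg[OF cmp_hom[OF fgh(2) v(2)]] by simp
    then obtain w where w: "w \<in> Hom C (fob S X) W" "v \<oplus> (- 1) \<odot> v' = w \<cdot> h"
      using coexact_third[OF d m] by blast
    then have "v \<oplus> (- 1) \<odot> v' = Zer C Y W" using h0 cmp_zer[OF w(1) obj(3)] by simp
    then show ?thesis using sub_zer_iff[OF v] by simp
  qed
  have rj: "r \<cdot> j = Zer C Y X"
  proof (rule epi)
    show "r \<cdot> j \<in> Hom C Y X" "Zer C Y X \<in> Hom C Y X" using j r cmp_hom zer_hom obj by blast+
    show "(r \<cdot> j) \<cdot> g = Zer C Y X \<cdot> g"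
      using cmp_assoc[OF fgh(2) j(1) r] j(2) re zer_cmp[OF fgh(2) obj(1)] by simp
  qed
  have gs: "g \<cdot> s = Zer C X Y" using distinguished_cmp_zer[OF d] .
  have gj: "g \<cdot> j = Idn C Y"
  proof (rule epi)
    show "g \<cdot> j \<in> Hom C Y Y" "Idn C Y \<in> Hom C Y Y" using j fgh cmp_hom idn_hom obj by blast+
    have "(g \<cdot> j) \<cdot> g = g \<cdot> e" using cmp_assoc[OF fgh(2) j(1) fgh(2)] j(2) by simp
    also have "\<dots> = g \<oplus> (- 1) \<odot> ((g \<cdot> s) \<cdot> r)"
      unfolding e_def using cmp_add[OF idn_hom[OF obj(2)] scl_hom[OF sr] fgh(2)] cmp_scl[OF sr fgh(2)]
        cmp_assoc[OF r s fgh(2)] cmp_idn[OF fgh(2)] by simp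
    also have "\<dots> = g" using gs zer_cmp[OF r obj(3)] scl_zer[OF obj(2,3)] add_zer[OF fgh(2)] by simp
    finally show "(g \<cdot> j) \<cdot> g = Idn C Y \<cdot> g" using idn_cmp[OF fgh(2)] by simp
  qed
  have "(s \<cdot> r) \<oplus> (j \<cdot> g) = Idn C U"
    using add_neg_cancel[OF idn_hom[OF obj(2)] sr] j(2) e_def by simp
  then have "direct_sum C [X, Y] U"
    using direct_sum_pairI[OF s j(1) r fgh(2) rs gj rj gs] by blast
  then show ?thesis unfolding summand_def by blast
qed

text \<open>With \<open>f = 1 + m\<close> and \<open>m \<cdot> m = 0\<close> the inverse is
  \<open>1 - m\<close>.\<close>

lemma nilpotent_iso:
  assumes f: "f \<in> Hom C X X" and n: "(f \<oplus> (- 1) \<odot> Idn C X) \<cdot> (f \<oplus> (- 1) \<odot> Idn C X) = Zer C X X"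
  shows "is_iso C X X f"
proof -
  have X: "X \<in> Obj C" using f hom_obj by blast
  define m where "m = f \<oplus> (- 1) \<odot> Idn C X"
  have I: "Idn C X \<in> Hom C X X" using idn_hom[OF X] .
  have m: "m \<in> Hom C X X" unfolding m_def using f I scl_hom add_hom by blast
  have fm: "f = Idn C X \<oplus> m" unfolding m_def using add_neg_cancel[OF f I] by simp
  have nm: "(- 1) \<odot> m \<in> Hom C X X" using scl_hom[OF m] .
  define g where "g = Idn C X \<oplus> (- 1) \<odot> m"
  have g: "g \<in> Hom C X X" unfolding g_def using I nm add_hom by blast
  have mm: "m \<cdot> m = Zer C X X" using n m_def by simp
  have mg: "m \<cdot> g = m"
    unfolding g_def using cmp_add[OF I nm m] cmp_scl[OF m m] mm scl_zer[OF X X] add_zer[OF m] cmp_idn[OF m]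
    by simp
  have gm: "g \<cdot> m = m"
    unfolding g_def using add_cmp[OF m I nm] scl_cmp[OF m m] mm scl_zer[OF X X] add_zer[OF m] idn_cmp[OF m]
    by simp
  have gm': "g \<oplus> m = Idn C X"
    using add_commute[OF g m] add_neg_cancel[OF I m] unfolding g_def by simp
  show ?thesis
  proof (rule is_isoI[OF f g])
    show "g \<cdot> f = Idn C X" unfolding fm using cmp_add[OF I m g] cmp_idn[OF g] gm gm' by simp
    show "f \<cdot> g = Idn C X" unfolding fm using add_cmp[OF g I m] idn_cmp[OF g] mg gm' by simp
  qed
qed

text \<open>The axiom fills in a third morphism. After rotating both triangles this is a morphism
  between the shifts of the first objects, and it desuspends.\<close>

lemma distinguished_morphism_first:
  assumes d: "distinguished X Y Z f g h" and d': "distinguished X' Y' Z' f' g' h'"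
    and v: "v \<in> Hom C Y Y'" and w: "w \<in> Hom C Z Z'" and eq: "w \<cdot> g = g' \<cdot> v"
  obtains u where "u \<in> Hom C X X'" "f' \<cdot> u = v \<cdot> f" "far S u \<cdot> h = h' \<cdot> w"
proof -
  note fgh = distinguished_hom[OF d] and fgh' = distinguished_hom[OF d']
  obtain x where x: "x \<in> Hom C (fob S X) (fob S X')" "x \<cdot> h = h' \<cdot> w"
    "far S v \<cdot> ((- 1) \<odot> far S f) = ((- 1) \<odot> far S f') \<cdot> x"
    using distinguished_morphism[OF distinguished_rotate[OF d] distinguished_rotate[OF d'] v w eq] by metis
  obtain u where u: "u \<in> Hom C X X'" "x = far S u"
    using shift_full[OF x(1)] hom_obj fgh(1) fgh'(1) by blast
  have vf: "v \<cdot> f \<in> Hom C X Y'" and fu: "f' \<cdot> u \<in> Hom C X Y'" using cmp_hom fgh(1) fgh'(1) v u(1) by blast+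
  have "(- 1) \<odot> far S (v \<cdot> f) = (- 1) \<odot> far S (f' \<cdot> u)"
    using x(3) u(2) cmp_scl[OF shift_hom[OF fgh(1)] shift_hom[OF v]] shift_cmp[OF fgh(1) v]
      scl_cmp[OF shift_hom[OF u(1)] shift_hom[OF fgh'(1)]] shift_cmp[OF u(1) fgh'(1)] by simp
  then have "far S (v \<cdot> f) = far S (f' \<cdot> u)" using neg_inject shift_hom vf fu by blast
  then have "f' \<cdot> u = v \<cdot> f" using shift_faithful[OF vf fu] by simp
  then show ?thesis using that u x(2) by blast
qed

text \<open>The inverse \<open>w\<close> of \<open>v\<close> also respects \<open>g\<close> and so
  induces some \<open>y\<close> on \<open>X\<close>. Completions of triangles are not unique, so the
  composites of \<open>u\<close> and \<open>y\<close> need not be identities; they do fix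
  \<open>f\<close> and \<open>h\<close>, and \<open>nil\<close> shows that such an endomorphism
  differs from the identity by a morphism of square zero.\<close>

lemma triangle_endo_iso:
  assumes d: "distinguished X Y Z f g h"
    and u: "u \<in> Hom C X X" and v: "is_iso C Y Y v" and fu: "f \<cdot> u = v \<cdot> f" and gv: "g \<cdot> v = g"
    and hu: "far S u \<cdot> h = h"
  shows "is_iso C X X u"
proof -
  note fgh = distinguished_hom[OF d]
  have obj: "X \<in> Obj C" "Y \<in> Obj C" "Z \<in> Obj C" using distinguished_obj[OF d] .
  obtain w where w: "w \<in> Hom C Y Y" "v \<in> Hom C Y Y" "w \<cdot> v = Idn C Y" "v \<cdot> w = Idn C Y"
    using is_isoE[OF v] by metis
  have gw: "g \<cdot> w = g" using cmp_assoc[OF w(1,2) fgh(2)] gv w(4) cmp_idn[OF fgh(2)] by simp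
  have Iobj: "Idn C Z \<in> Hom C Z Z" using idn_hom[OF obj(3)] .
  obtain y where y: "y \<in> Hom C X X" "f \<cdot> y = w \<cdot> f" "far S y \<cdot> h = h \<cdot> Idn C Z"
    using distinguished_morphism_first[OF d d w(1) Iobj] gw idn_cmp[OF fgh(2)] by metis
  have hy: "far S y \<cdot> h = h" and fy: "f \<cdot> y = w \<cdot> f" using y cmp_idn[OF fgh(3)] by simp_all
  have nil: "is_iso C X X a" if a: "a \<in> Hom C X X" and fa: "f \<cdot> a = f" and ha: "far S a \<cdot> h = h" for a
  proof (rule nilpotent_iso[OF a])
    \<comment> \<open>The difference \<open>m\<close> from the identity satisfies
      \<open>f \<cdot> m = 0\<close> and has no obstruction against \<open>h\<close>, so
      \<open>m = b \<cdot> f\<close> and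
      \<open>m \<cdot> m = b \<cdot> (f \<cdot> m) = 0\<close>.\<close>
    define m where "m = a \<oplus> (- 1) \<odot> Idn C X"
    have I: "Idn C X \<in> Hom C X X" using idn_hom[OF obj(1)] .
    have m: "m \<in> Hom C X X" unfolding m_def using a I scl_hom add_hom by blast
    have fm: "f \<cdot> m = Zer C X Y"
      unfolding m_def using cmp_add[OF a scl_hom[OF I] fgh(1)] cmp_scl[OF I fgh(1)] fa cmp_idn[OF fgh(1)]
        add_neg[OF fgh(1)] by simp
    have hm: "far S m \<cdot> h = Zer C Z (fob S X)"
      unfolding m_def using shift_add[OF a scl_hom[OF I]] shift_scl[OF I] shift_idn[OF obj(1)]
        add_cmp[OF fgh(3) shift_hom[OF a] scl_hom[OF idn_hom[OF shift_obj[OF obj(1)]]]]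
        scl_cmp[OF fgh(3) idn_hom[OF shift_obj[OF obj(1)]]] idn_cmp[OF fgh(3)] ha add_neg[OF fgh(3)] by simp
    obtain b where b: "b \<in> Hom C Y X" "m = b \<cdot> f" using coexact_fourth[OF d m hm] by blast
    have "m \<cdot> m = b \<cdot> (f \<cdot> m)" using cmp_assoc[OF m fgh(1) b(1)] b(2) by simp
    also have "\<dots> = Zer C X X" using fm cmp_zer[OF b(1) obj(1)] by simp
    finally show "(a \<oplus> (- 1) \<odot> Idn C X) \<cdot> (a \<oplus> (- 1) \<odot> Idn C X) = Zer C X X" unfolding m_def .
  qed
  have yu: "y \<cdot> u \<in> Hom C X X" "u \<cdot> y \<in> Hom C X X" using y u cmp_hom by blast+
  have "f \<cdot> (y \<cdot> u) = f"
    using cmp_assoc[OF u y(1) fgh(1)] fy cmp_assoc[OF u fgh(1) w(1)] fu cmp_assoc[OF fgh(1) w(2,1)]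
      w(3) idn_cmp[OF fgh(1)] by simp
  moreover have "far S (y \<cdot> u) \<cdot> h = h"
    using shift_cmp[OF u y(1)] cmp_assoc[OF fgh(3) shift_hom[OF u] shift_hom[OF y(1)]] hu hy by simp
  ultimately have 1: "is_iso C X X (y \<cdot> u)" using nil yu by blast
  have "f \<cdot> (u \<cdot> y) = f"
    using cmp_assoc[OF y(1) u fgh(1)] fu cmp_assoc[OF y(1) fgh(1) w(2)] fy cmp_assoc[OF fgh(1) w(1,2)]
      w(4) idn_cmp[OF fgh(1)] by simp
  moreover have "far S (u \<cdot> y) \<cdot> h = h"
    using shift_cmp[OF y(1) u] cmp_assoc[OF fgh(3) shift_hom[OF y(1)] shift_hom[OF u]] hu hy by simp
  ultimately have 2: "is_iso C X X (u \<cdot> y)" using nil yu by blast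
  show ?thesis by (rule is_iso_of_cmp_iso[OF u y(1) 1 2])
qed

end

section \<open>Exchange triangles\<close>

definition hom_subspace :: "('k, 'o, 'a) lincat \<Rightarrow> 'o \<Rightarrow> 'o \<Rightarrow> 'a set \<Rightarrow> bool" where
  "hom_subspace C X Y W \<longleftrightarrow> W \<subseteq> Hom C X Y \<and> Zer C X Y \<in> W \<and>
     (\<forall>f \<in> W. \<forall>g \<in> W. f \<oplus>\<^bsub>C\<^esub> g \<in> W) \<and> (\<forall>a. \<forall>f \<in> W. a \<odot>\<^bsub>C\<^esub> f \<in> W)"

text \<open>Hom sets are mere carrier sets inside the type of all morphisms, so spanning is
  expressed by quantifying over subspaces.\<close>

definition finitely_spanned :: "('k, 'o, 'a) lincat \<Rightarrow> 'o \<Rightarrow> 'o \<Rightarrow> bool" where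
  "finitely_spanned C X Y \<longleftrightarrow>
     (\<exists>E \<subseteq> Hom C X Y. finite E \<and> (\<forall>W. hom_subspace C X Y W \<and> E \<subseteq> W \<longrightarrow> W = Hom C X Y))"

context linear_category
begin

text \<open>The terms \<open>b \<cdot> v\<close> factor through \<open>a\<close> one at a time, and
  the factors add up. A left approximation property known for the objects of \<open>\<T>\<close>
  thus extends to the whole ideal.\<close>

lemma ideal_factor_left:
  assumes a: "a \<in> Hom C X B" and fac: "\<And>T v. T \<in> \<T> \<Longrightarrow> v \<in> Hom C X T \<Longrightarrow> \<exists>w \<in> Hom C B T. v = w \<cdot> a"
    and "e \<in> factor_ideal C \<T> X Z"
  shows "\<exists>w \<in> Hom C B Z. e = w \<cdot> a"
  using assms(3)
proof (induction rule: factor_ideal.induct)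
  case zer
  then show ?case using zer_cmp[OF a] zer_hom hom_obj[OF a] by metis
next
  case (step T v b f)
  obtain w where w: "w \<in> Hom C B T" "v = w \<cdot> a" using fac step by blast
  obtain y where y: "y \<in> Hom C B Z" "f = y \<cdot> a" using step.IH by blast
  have bw: "b \<cdot> w \<in> Hom C B Z" using w step cmp_hom by blast
  have "((b \<cdot> w) \<oplus> y) \<cdot> a = (b \<cdot> v) \<oplus> f"
    using add_cmp[OF a bw y(1)] cmp_assoc[OF a w(1) step(3)] w y by simp
  then show ?case using add_hom[OF bw y(1)] by metis
qed

lemma ideal_factor_right:
  assumes a: "a \<in> Hom C B Y" and fac: "\<And>T v. T \<in> \<T> \<Longrightarrow> v \<in> Hom C T Y \<Longrightarrow> \<exists>w \<in> Hom C T B. v = a \<cdot> w"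
    and "e \<in> factor_ideal C \<T> Z Y"
  shows "\<exists>w \<in> Hom C Z B. e = a \<cdot> w"
  using assms(3)
proof (induction rule: factor_ideal.induct)
  case zer
  then show ?case using cmp_zer[OF a] zer_hom hom_obj[OF a] by metis
next
  case (step T b v f)
  obtain w where w: "w \<in> Hom C T B" "v = a \<cdot> w" using fac step by blast
  obtain y where y: "y \<in> Hom C Z B" "f = a \<cdot> y" using step.IH by blast
  have wb: "w \<cdot> b \<in> Hom C Z B" using w step cmp_hom by blast
  have "a \<cdot> ((w \<cdot> b) \<oplus> y) = (v \<cdot> b) \<oplus> f"
    using cmp_add[OF wb y(1) a] cmp_assoc[OF step(2) w(1) a] w y by simp
  then show ?case using add_hom[OF wb y(1)] by metis
qed

end

text \<open>\<open>B\<close> is a sum of copies of \<open>T\<close>, one for each element of a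
  finite spanning set, and \<open>a\<close> is the column of these elements. The morphisms that
  factor through \<open>a\<close> form a subspace that contains the spanning set.\<close>

lemma (in additive_category) left_approximation_exists:
  assumes "X \<in> Obj C" "T \<in> Obj C" "finitely_spanned C X T"
  obtains B a where "a \<in> Hom C X B" "Idn C B \<in> factor_ideal C {T} B B"
    "\<And>v. v \<in> Hom C X T \<Longrightarrow> \<exists>w \<in> Hom C B T. v = w \<cdot> a"
proof -
  obtain E where E: "E \<subseteq> Hom C X T" "finite E"
    and span: "\<And>W. hom_subspace C X T W \<Longrightarrow> E \<subseteq> W \<Longrightarrow> W = Hom C X T"
    using assms(3) unfolding finitely_spanned_def by blast
  have "\<exists>B. \<exists>a \<in> Hom C X B. Idn C B \<in> factor_ideal C {T} B B \<and> (\<forall>v \<in> E. \<exists>w \<in> Hom C B T. v = w \<cdot> a)"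
    using E(2,1)
  proof (induction E)
    case empty
    obtain N where N: "zero_object C N" using zero_object_exists by blast
    then have "N \<in> Obj C" "Idn C N = Zer C N N" by (auto simp: zero_object_def)
    then show ?case using zer_hom[OF assms(1)] factor_ideal.zer by fastforce
  next
    case (insert v E)
    have v: "v \<in> Hom C X T" using insert by blast
    obtain B a where a: "a \<in> Hom C X B" "Idn C B \<in> factor_ideal C {T} B B"
      and fac: "\<And>v. v \<in> E \<Longrightarrow> \<exists>w \<in> Hom C B T. v = w \<cdot> a" using insert by blast
    have B: "B \<in> Obj C" using a hom_obj by blast
    obtain B' where d: "direct_sum C [T, B] B'" using direct_sum_exists[of "[T, B]"] B assms(2) by auto
    obtain i j p q where ij: "i \<in> Hom C T B'" "j \<in> Hom C B B'" "p \<in> Hom C B' T" "q \<in> Hom C B' B"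
      "p \<cdot> i = Idn C T" "q \<cdot> j = Idn C B" "p \<cdot> j = Zer C B T" "q \<cdot> i = Zer C T B"
      "(i \<cdot> p) \<oplus> (j \<cdot> q) = Idn C B'"
      using direct_sum_pairE[OF d] by blast
    have iv: "i \<cdot> v \<in> Hom C X B'" and ja: "j \<cdot> a \<in> Hom C X B'" using ij v a cmp_hom by blast+
    \<comment> \<open>The new column has components \<open>v\<close> and \<open>a\<close>, which the
      projections \<open>p\<close> and \<open>q\<close> recover.\<close>
    let ?a = "(i \<cdot> v) \<oplus> (j \<cdot> a)"
    have a': "?a \<in> Hom C X B'" using add_hom[OF iv ja] .
    have pa: "p \<cdot> ?a = v"
      using cmp_add[OF iv ja ij(3)] cmp_assoc[OF v ij(1,3)] cmp_assoc[OF a(1) ij(2,3)] ij(5,7)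
        idn_cmp[OF v] zer_cmp[OF a(1) assms(2)] add_zer[OF v] by simp
    have qa: "q \<cdot> ?a = a"
      using cmp_add[OF iv ja ij(4)] cmp_assoc[OF v ij(1,4)] cmp_assoc[OF a(1) ij(2,4)] ij(6,8)
        idn_cmp[OF a(1)] zer_cmp[OF v B] zer_add[OF a(1)] by simp
    have "\<exists>w \<in> Hom C B' T. v' = w \<cdot> ?a" if v': "v' \<in> insert v E" for v'
    proof (cases "v' = v")
      case True
      then show ?thesis using pa ij(3) by metis
    next
      case False
      then obtain w where w: "w \<in> Hom C B T" "v' = w \<cdot> a" using v' fac by blast
      then have "v' = (w \<cdot> q) \<cdot> ?a" using cmp_assoc[OF a' ij(4) w(1)] qa by simp
      then show ?thesis using cmp_hom[OF ij(4) w(1)] by blast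
    qed
    moreover have "Idn C B' \<in> factor_ideal C {T} B' B'"
      using ideal_direct_sum[OF d, of "{T}"] a(2) ideal_idn[OF assms(2), of "{T}"] by auto
    ultimately show ?case using a' by blast
  qed
  then obtain B a where a: "a \<in> Hom C X B" "Idn C B \<in> factor_ideal C {T} B B"
    and fac: "\<And>v. v \<in> E \<Longrightarrow> \<exists>w \<in> Hom C B T. v = w \<cdot> a" by blast
  define W where "W = {v \<in> Hom C X T. \<exists>w \<in> Hom C B T. v = w \<cdot> a}"
  have B: "B \<in> Obj C" using a hom_obj by blast
  have "hom_subspace C X T W"
    unfolding hom_subspace_def
  proof (intro conjI ballI allI)
    show "Zer C X T \<in> W"
      unfolding W_def using zer_hom[OF assms(1,2)] zer_hom[OF B assms(2)] zer_cmp[OF a(1) assms(2)] by force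
  next
    fix v v' assume "v \<in> W" "v' \<in> W"
    then obtain w w' where w: "v \<in> Hom C X T" "v' \<in> Hom C X T" "w \<in> Hom C B T" "w' \<in> Hom C B T" "v = w \<cdot> a" "v' = w' \<cdot> a"
      unfolding W_def by blast
    then have "v \<oplus> v' = (w \<oplus> w') \<cdot> a" using add_cmp[OF a(1)] by simp
    then show "v \<oplus> v' \<in> W" unfolding W_def using w add_hom by blast
  next
    fix c v assume "v \<in> W"
    then obtain w where w: "v \<in> Hom C X T" "w \<in> Hom C B T" "v = w \<cdot> a" unfolding W_def by blast
    then have "c \<odot> v = (c \<odot> w) \<cdot> a" using scl_cmp[OF a(1)] by simp
    then show "c \<odot> v \<in> W" unfolding W_def using w scl_hom by blast
  qed (auto simp: W_def)
  moreover have "E \<subseteq> W" unfolding W_def using E(1) fac by blast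
  ultimately have "W = Hom C X T" by (rule span)
  then show ?thesis using that[OF a] unfolding W_def by blast
qed

context triangulated_category
begin

lemma shift_ideal:
  assumes "e \<in> factor_ideal C \<T> X Y"
  shows "far S e \<in> factor_ideal C (fob S ` \<T>) (fob S X) (fob S Y)"
  using assms
proof (induction rule: factor_ideal.induct)
  case zer
  then show ?case using factor_ideal.zer shift_obj shift_zer by metis
next
  case (step T a b f)
  have "far S ((b \<cdot> a) \<oplus> f) = (far S b \<cdot> far S a) \<oplus> far S f"
    using shift_add[OF cmp_hom[OF step(2,3)] ideal_hom[OF step(4)]] shift_cmp[OF step(2,3)] by simp
  then show ?case
    using factor_ideal.step[OF imageI[OF step(1)] shift_hom[OF step(2)] shift_hom[OF step(3)] step.IH] by simp
qed

lemma ext_zero_ideal_right: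
  assumes "Idn C Y \<in> factor_ideal C \<T> Y Y" "X \<in> Obj C" "\<And>T. T \<in> \<T> \<Longrightarrow> hom_zero C X (fob S T)"
  shows "hom_zero C X (fob S Y)"
proof (rule hom_zero_ideal_right[OF _ assms(2)])
  have "Y \<in> Obj C" using ideal_hom[OF assms(1)] hom_obj by blast
  then show "Idn C (fob S Y) \<in> factor_ideal C (fob S ` \<T>) (fob S Y) (fob S Y)"
    using shift_ideal[OF assms(1)] shift_idn by simp
qed (use assms(3) in blast)

end

section \<open>Exchange for finite-dimensional Hom spaces and symmetric Ext vanishing\<close>

locale ext_symmetric_category = triangulated_category C S \<Delta> + krull_schmidt_category C
  for C :: "('k::field, 'o, 'a) lincat" (structure) and S :: "('o, 'a, 'o, 'a) cat_functor"
    and \<Delta> :: "('a \<times> 'a \<times> 'a) set" +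
  assumes hom_finite: "X \<in> Obj C \<Longrightarrow> Y \<in> Obj C \<Longrightarrow> finitely_spanned C X Y"
    and ext_symmetric: "X \<in> Obj C \<Longrightarrow> Y \<in> Obj C \<Longrightarrow> hom_zero C X (fob S Y) \<Longrightarrow> hom_zero C Y (fob S X)"
begin

text \<open>The Krull-Schmidt decomposition of \<open>X\<close> is not empty, as \<open>X\<close> is
  nonzero. Any of its members splits off, and indecomposability makes the complement zero, so
  \<open>X\<close> is isomorphic to an object with local endomorphism ring.\<close>

lemma indecomposable_local:
  assumes "indecomposable C X" shows "local_endomorphism_ring C X"
proof -
  have X: "X \<in> Obj C" "Idn C X \<noteq> Zer C X X" using assms by (auto simp: indecomposable_def zero_object_def)
  obtain Xs where Xs: "direct_sum C Xs X" "\<And>Y. Y \<in> set Xs \<Longrightarrow> local_endomorphism_ring C Y"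
    using krull_schmidt[OF X(1)] by blast
  have "Xs \<noteq> []"
    using Xs(1) X by (auto simp: direct_sum_def)
  then obtain Y where Y: "Y \<in> set Xs" using list.set_sel(1) by blast
  obtain s r where "s \<in> Hom C Y X" "r \<in> Hom C X Y" "r \<cdot> s = Idn C Y"
    using direct_sum_retract[OF Xs(1) Y] by blast
  then obtain Z where Z: "direct_sum C [Y, Z] X" using split_mono_summand unfolding summand_def by blast
  have "\<not> zero_object C Y" using Xs(2)[OF Y] by (auto simp: zero_object_def local_endomorphism_ring_def)
  then have zZ: "zero_object C Z" using assms Z unfolding indecomposable_def by blast
  obtain i j p q where ij: "i \<in> Hom C Y X" "j \<in> Hom C Z X" "p \<in> Hom C X Y" "q \<in> Hom C X Z"
      "p \<cdot> i = Idn C Y" "q \<cdot> j = Idn C Z" "p \<cdot> j = Zer C Z Y" "q \<cdot> i = Zer C Y Z"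
      "(i \<cdot> p) \<oplus> (j \<cdot> q) = Idn C X"
    using direct_sum_pairE[OF Z] by blast
  have "j = Zer C Z X" using hom_zeroD[OF zero_object_hom_zero(1)[OF zZ X(1)]] ij by blast
  then have "j \<cdot> q = Zer C X X" using zer_cmp[OF ij(4) X(1)] by simp
  then have "i \<cdot> p = Idn C X" using ij add_zer[OF cmp_hom[OF ij(3,1)]] by simp
  then have "isomorphic C Y X" unfolding isomorphic_def using is_isoI[OF ij(1,3)] ij(5) by blast
  then show ?thesis using local_iso Xs(2)[OF Y] by blast
qed

lemma indecomposable_ideal_iso:
  assumes "indecomposable C X" "Idn C X \<in> factor_ideal C \<T> X X" "\<And>T. T \<in> \<T> \<Longrightarrow> indecomposable C T"
  obtains T where "T \<in> \<T>" "isomorphic C X T"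
proof -
  have X: "X \<in> Obj C" "Idn C X \<noteq> Zer C X X" using assms(1) by (auto simp: indecomposable_def zero_object_def)
  obtain T s r where T: "T \<in> \<T>" "s \<in> Hom C X T" "r \<in> Hom C T X" "r \<cdot> s = Idn C X"
    using local_ideal_retract[OF indecomposable_local[OF assms(1)] assms(2) idn_iso[OF X(1)]] by blast
  then show ?thesis
    using that local_retract_section_iso(1)[OF indecomposable_local[OF assms(1)] indecomposable_local[OF assms(3)]
        T(2,3)] idn_iso[OF X(1)] unfolding isomorphic_def by metis
qed

end

text \<open>The conditions on \<open>add T\<close> are recorded through \<open>T\<close> and its
  factor ideal. \<open>M_notin\<close>, later deduced from basicness of \<open>T \<oplus> M\<close>,
  keeps the triangle from splitting.\<close>

locale exchange_triangle = ext_symmetric_category +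
  fixes T M M' B :: 'b and f g h :: 'c
  assumes tri: "distinguished M' B M g f h"
    and add_B: "Idn C B \<in> factor_ideal C {T} B B"
    and T_obj: "T \<in> Obj C"
    and approx: "v \<in> Hom C T M \<Longrightarrow> \<exists>w \<in> Hom C T B. v = f \<cdot> w"
    and minimal: "e \<in> Hom C B B \<Longrightarrow> f \<cdot> e = f \<Longrightarrow> is_iso C B B e"
    and ext_T_T: "hom_zero C T (fob S T)"
    and ext_T_M: "hom_zero C T (fob S M)"
    and ext_M_M: "hom_zero C M (fob S M)"
    and M_indec: "indecomposable C M"
    and M_notin: "Idn C M \<notin> factor_ideal C {T} M M"
begin

lemmas tri_hom = distinguished_hom[OF tri]
lemmas tri_obj = distinguished_obj[OF tri]

lemma ext_M_T: "hom_zero C M (fob S T)"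
  using ext_symmetric[OF T_obj tri_obj(3) ext_T_M] .

lemma approx_ideal: "v \<in> factor_ideal C {T} X M \<Longrightarrow> \<exists>w \<in> Hom C X B. v = f \<cdot> w"
  by (rule ideal_factor_right[OF tri_hom(2), of "{T}"]) (use approx in auto)

lemma approx_add: "Idn C X \<in> factor_ideal C {T} X X \<Longrightarrow> v \<in> Hom C X M \<Longrightarrow> \<exists>w \<in> Hom C X B. v = f \<cdot> w"
  using approx_ideal ideal_cmp_idn by blast

lemma ext_zero_B: "X \<in> Obj C \<Longrightarrow> hom_zero C X (fob S T) \<Longrightarrow> hom_zero C X (fob S B)"
  using ext_zero_ideal_right[OF add_B] by blast

lemma cmp_h_f: "v \<in> Hom C X B \<Longrightarrow> h \<cdot> (f \<cdot> v) = Zer C X (fob S M')"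
  using cmp_assoc[of v X B f M h "fob S M'"] tri_hom distinguished_cmp_zer'[OF tri] zer_cmp shift_obj tri_obj
  by metis

text \<open>Ext of \<open>T\<close> with \<open>B\<close> vanishes, so \<open>v\<close> lifts along
  \<open>h\<close> to a morphism from \<open>T\<close> to \<open>M\<close>. That morphism factors
  through \<open>f\<close>, and \<open>h \<cdot> f = 0\<close>.\<close>

lemma ext_T_M': "hom_zero C T (fob S M')"
proof (rule hom_zeroI[OF T_obj shift_obj[OF tri_obj(1)]])
  fix v assume v: "v \<in> Hom C T (fob S M')"
  have "far S g \<cdot> v = Zer C T (fob S B)"
    using hom_zeroD[OF ext_zero_B[OF T_obj ext_T_T] cmp_hom[OF v shift_hom[OF tri_hom(1)]]] .
  then obtain u where u: "u \<in> Hom C T M" "v = h \<cdot> u" using exact_fourth[OF tri v] by blast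
  then show "v = Zer C T (fob S M')" using approx cmp_h_f by blast
qed

lemma ext_M'_T: "hom_zero C M' (fob S T)"
  using ext_symmetric[OF T_obj tri_obj(1) ext_T_M'] .

text \<open>The obstruction to extending \<open>v\<close> along \<open>g\<close> lies in Ext of
  \<open>M\<close> with \<open>T\<close>. So \<open>g\<close> is a left approximation of
  \<open>M'\<close>, and the triangle can be read in both directions.\<close>

lemma factor_g: "v \<in> Hom C M' T \<Longrightarrow> \<exists>w \<in> Hom C B T. v = w \<cdot> g"
proof -
  assume v: "v \<in> Hom C M' T"
  have "far S v \<cdot> h = Zer C M (fob S T)"
    using hom_zeroD[OF ext_M_T cmp_hom[OF tri_hom(3) shift_hom[OF v]]] .
  then show ?thesis using coexact_fourth[OF tri v] by blast
qed

text \<open>First \<open>v = h \<cdot> \<alpha>\<close>, since Ext of \<open>M'\<close> with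
  \<open>B\<close> vanishes. The obstruction to extending \<open>\<alpha>\<close> over
  \<open>B\<close> lies in Ext of \<open>M\<close> with itself, and the approximation property then
  moves \<open>\<alpha>\<close> through \<open>f\<close>, which \<open>h\<close> kills.\<close>

lemma ext_M'_M': "hom_zero C M' (fob S M')"
proof (rule hom_zeroI[OF tri_obj(1) shift_obj[OF tri_obj(1)]])
  fix v assume v: "v \<in> Hom C M' (fob S M')"
  have "far S g \<cdot> v = Zer C M' (fob S B)"
    using hom_zeroD[OF ext_zero_B[OF tri_obj(1) ext_M'_T] cmp_hom[OF v shift_hom[OF tri_hom(1)]]] .
  then obtain \<alpha> where \<alpha>: "\<alpha> \<in> Hom C M' M" "v = h \<cdot> \<alpha>" using exact_fourth[OF tri v] by blast
  have "far S \<alpha> \<cdot> h = Zer C M (fob S M)"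
    using hom_zeroD[OF ext_M_M cmp_hom[OF tri_hom(3) shift_hom[OF \<alpha>(1)]]] .
  then obtain \<beta> where \<beta>: "\<beta> \<in> Hom C B M" "\<alpha> = \<beta> \<cdot> g" using coexact_fourth[OF tri \<alpha>(1)] by blast
  obtain \<gamma> where \<gamma>: "\<gamma> \<in> Hom C B B" "\<beta> = f \<cdot> \<gamma>" using approx_add[OF add_B \<beta>(1)] by blast
  have "\<alpha> = f \<cdot> (\<gamma> \<cdot> g)" using cmp_assoc[OF tri_hom(1) \<gamma>(1) tri_hom(2)] \<beta> \<gamma> by simp
  then show "v = Zer C M' (fob S M')" using \<alpha>(2) cmp_h_f cmp_hom[OF tri_hom(1) \<gamma>(1)] by simp
qed

text \<open>The connecting morphism \<open>h\<close> is the nonzero element: were it zero, the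
  identity of \<open>M\<close> would factor through \<open>f\<close>, hence through
  \<open>add T\<close>.\<close>

lemma ext_M_M'_nonzero: "\<not> hom_zero C M (fob S M')"
proof
  assume "hom_zero C M (fob S M')"
  then have "h = Zer C M (fob S M')" using hom_zeroD tri_hom(3) by blast
  then have "h \<cdot> Idn C M = Zer C M (fob S M')" using cmp_idn[OF tri_hom(3)] by simp
  then obtain u where u: "u \<in> Hom C M B" "Idn C M = f \<cdot> u"
    using exact_third[OF tri idn_hom[OF tri_obj(3)]] by blast
  have "f \<cdot> u \<in> factor_ideal C {T} M M" using ideal_cmp_left[OF ideal_idn_cmp[OF add_B u(1)] tri_hom(2)] .
  then show False using u M_notin by simp
qed

text \<open>Otherwise Ext of \<open>M\<close> with \<open>M'\<close> would vanish along with Ext of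
  \<open>M\<close> with \<open>T\<close>.\<close>

lemma M'_notin: "Idn C M' \<notin> factor_ideal C {T} M' M'"
  using ext_zero_ideal_right[of M' "{T}" M] ext_M_T tri_obj ext_M_M'_nonzero by blast

lemma not_isomorphic: "\<not> isomorphic C M' M"
  using hom_zero_iso_left[of M' M] ext_M'_M' ext_M_M'_nonzero by blast

text \<open>The inverse \<open>\<kappa>\<close> of \<open>\<chi>\<close> lifts to \<open>B\<close>
  by the approximation property and from there to \<open>M'\<close>. The composites in either order
  are the identity on \<open>M\<close>; on \<open>B\<close> they fix \<open>f\<close>, so minimality
  makes them invertible, and \<open>triangle_endo_iso\<close> carries this over to
  \<open>M'\<close>.\<close>

lemma triangle_endo_first_iso:
  assumes \<phi>: "\<phi> \<in> Hom C M' M'" and \<psi>: "\<psi> \<in> Hom C B B" and \<chi>: "is_iso C M M \<chi>"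
    and 1: "\<psi> \<cdot> g = g \<cdot> \<phi>" and 2: "\<chi> \<cdot> f = f \<cdot> \<psi>" and 3: "far S \<phi> \<cdot> h = h \<cdot> \<chi>"
  shows "is_iso C M' M' \<phi>"
proof -
  obtain \<kappa> where \<kappa>: "\<kappa> \<in> Hom C M M" "\<chi> \<in> Hom C M M" "\<kappa> \<cdot> \<chi> = Idn C M" "\<chi> \<cdot> \<kappa> = Idn C M"
    using is_isoE[OF \<chi>] by metis
  obtain \<psi>' where \<psi>': "\<psi>' \<in> Hom C B B" "\<kappa> \<cdot> f = f \<cdot> \<psi>'"
    using approx_add[OF add_B cmp_hom[OF tri_hom(2) \<kappa>(1)]] by blast
  obtain \<phi>' where \<phi>': "\<phi>' \<in> Hom C M' M'" "g \<cdot> \<phi>' = \<psi>' \<cdot> g" "far S \<phi>' \<cdot> h = h \<cdot> \<kappa>"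
    using distinguished_morphism_first[OF tri tri \<psi>'(1) \<kappa>(1) \<psi>'(2)] by blast
  have iso: "is_iso C M' M' (\<alpha> \<cdot> \<beta>)"
    if \<alpha>: "\<alpha> \<in> Hom C M' M'" and \<beta>: "\<beta> \<in> Hom C M' M'" and \<alpha>': "\<alpha>' \<in> Hom C B B" and \<beta>': "\<beta>' \<in> Hom C B B"
      and \<gamma>: "\<gamma> \<in> Hom C M M" and \<delta>: "\<delta> \<in> Hom C M M"
      and e: "\<alpha>' \<cdot> g = g \<cdot> \<alpha>" "\<beta>' \<cdot> g = g \<cdot> \<beta>" "\<gamma> \<cdot> f = f \<cdot> \<alpha>'" "\<delta> \<cdot> f = f \<cdot> \<beta>'"
        "far S \<alpha> \<cdot> h = h \<cdot> \<gamma>" "far S \<beta> \<cdot> h = h \<cdot> \<delta>" "\<gamma> \<cdot> \<delta> = Idn C M"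
    for \<alpha> \<beta> \<alpha>' \<beta>' \<gamma> \<delta>
  proof (rule triangle_endo_iso[OF tri])
    show "\<alpha> \<cdot> \<beta> \<in> Hom C M' M'" using \<alpha> \<beta> cmp_hom by blast
    have ab: "\<alpha>' \<cdot> \<beta>' \<in> Hom C B B" using \<alpha>' \<beta>' cmp_hom by blast
    show "g \<cdot> (\<alpha> \<cdot> \<beta>) = (\<alpha>' \<cdot> \<beta>') \<cdot> g"
      using cmp_assoc[OF \<beta> \<alpha> tri_hom(1)] cmp_assoc[OF \<beta> tri_hom(1) \<alpha>'] cmp_assoc[OF tri_hom(1) \<beta>' \<alpha>'] e by simp
    show fab: "f \<cdot> (\<alpha>' \<cdot> \<beta>') = f"
      using cmp_assoc[OF \<beta>' \<alpha>' tri_hom(2)] cmp_assoc[OF \<beta>' tri_hom(2) \<gamma>] cmp_assoc[OF tri_hom(2) \<delta> \<gamma>] e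
        idn_cmp[OF tri_hom(2)] by simp
    show "is_iso C B B (\<alpha>' \<cdot> \<beta>')" using minimal[OF ab fab] .
    show "far S (\<alpha> \<cdot> \<beta>) \<cdot> h = h"
      using shift_cmp[OF \<beta> \<alpha>] cmp_assoc[OF tri_hom(3) shift_hom[OF \<beta>] shift_hom[OF \<alpha>]]
        cmp_assoc[OF \<delta> tri_hom(3) shift_hom[OF \<alpha>]] cmp_assoc[OF \<delta> \<gamma> tri_hom(3)] e cmp_idn[OF tri_hom(3)] by simp
  qed
  show ?thesis
    by (rule is_iso_of_cmp_iso[OF \<phi> \<phi>'(1) iso[of \<phi>' \<phi> \<psi>' \<psi> \<kappa> \<chi>] iso[of \<phi> \<phi>' \<psi> \<psi>' \<chi> \<kappa>]])
      (use \<phi> \<phi>' \<psi> \<psi>' \<kappa> 1 2 3 in simp_all)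
qed

text \<open>\<open>\<phi>\<close> extends to an endomorphism of the whole triangle because
  \<open>g\<close> is a left approximation. The resulting \<open>\<chi>\<close> is not unique, so
  there is no canonical map of endomorphism rings; but locality applied to one choice of
  \<open>\<chi>\<close> already decides between \<open>\<phi>\<close> and
  \<open>1 - \<phi>\<close>.\<close>

lemma M'_indec: "indecomposable C M'"
proof (rule indecomposableI[OF tri_obj(1)])
  show "Idn C M' \<noteq> Zer C M' M'" using M'_notin factor_ideal.zer tri_obj(1) by metis
  fix \<phi> assume \<phi>: "\<phi> \<in> Hom C M' M'"
  have "g \<cdot> \<phi> \<in> factor_ideal C {T} M' B" using ideal_idn_cmp[OF add_B cmp_hom[OF \<phi> tri_hom(1)]] .
  then obtain \<psi> where \<psi>: "\<psi> \<in> Hom C B B" "g \<cdot> \<phi> = \<psi> \<cdot> g"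
    using ideal_factor_left[OF tri_hom(1), of "{T}"] factor_g by blast
  obtain \<chi> where \<chi>: "\<chi> \<in> Hom C M M" "\<chi> \<cdot> f = f \<cdot> \<psi>" "far S \<phi> \<cdot> h = h \<cdot> \<chi>"
    using distinguished_morphism[OF tri tri \<phi> \<psi>(1) \<psi>(2)[symmetric]] by blast
  consider "is_iso C M M \<chi>" | "is_iso C M M (Idn C M \<oplus> (- 1) \<odot> \<chi>)"
    using local_iso_or[OF indecomposable_local[OF M_indec] \<chi>(1)] by blast
  then show "is_iso C M' M' \<phi> \<or> is_iso C M' M' (Idn C M' \<oplus> (- 1) \<odot> \<phi>)"
  proof cases
    case 1
    then show ?thesis using triangle_endo_first_iso[OF \<phi> \<psi>(1)] \<psi> \<chi> by simp
  next
    case 2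
    have I: "Idn C M' \<in> Hom C M' M'" "Idn C B \<in> Hom C B B" "Idn C M \<in> Hom C M M"
      using idn_hom tri_obj by blast+
    have n: "(- 1) \<odot> \<phi> \<in> Hom C M' M'" "(- 1) \<odot> \<psi> \<in> Hom C B B" "(- 1) \<odot> \<chi> \<in> Hom C M M"
      using scl_hom \<phi> \<psi> \<chi> by blast+
    have "is_iso C M' M' (Idn C M' \<oplus> (- 1) \<odot> \<phi>)"
    proof (rule triangle_endo_first_iso[OF _ _ 2])
      show "Idn C M' \<oplus> (- 1) \<odot> \<phi> \<in> Hom C M' M'" "Idn C B \<oplus> (- 1) \<odot> \<psi> \<in> Hom C B B"
        using I n add_hom by blast+
      show "(Idn C B \<oplus> (- 1) \<odot> \<psi>) \<cdot> g = g \<cdot> (Idn C M' \<oplus> (- 1) \<odot> \<phi>)"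
        using add_cmp[OF tri_hom(1) I(2) n(2)] cmp_add[OF I(1) n(1) tri_hom(1)] idn_cmp[OF tri_hom(1)]
          cmp_idn[OF tri_hom(1)] scl_cmp[OF tri_hom(1) \<psi>(1)] cmp_scl[OF \<phi> tri_hom(1)] \<psi>(2) by simp
      show "(Idn C M \<oplus> (- 1) \<odot> \<chi>) \<cdot> f = f \<cdot> (Idn C B \<oplus> (- 1) \<odot> \<psi>)"
        using add_cmp[OF tri_hom(2) I(3) n(3)] cmp_add[OF I(2) n(2) tri_hom(2)] idn_cmp[OF tri_hom(2)]
          cmp_idn[OF tri_hom(2)] scl_cmp[OF tri_hom(2) \<chi>(1)] cmp_scl[OF \<psi>(1) tri_hom(2)] \<chi>(2) by simp
      show "far S (Idn C M' \<oplus> (- 1) \<odot> \<phi>) \<cdot> h = h \<cdot> (Idn C M \<oplus> (- 1) \<odot> \<chi>)"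
        using shift_add[OF I(1) n(1)] shift_idn[OF tri_obj(1)] shift_scl[OF \<phi>]
          add_cmp[OF tri_hom(3) idn_hom[OF shift_obj[OF tri_obj(1)]] scl_hom[OF shift_hom[OF \<phi>]]]
          scl_cmp[OF tri_hom(3) shift_hom[OF \<phi>]] idn_cmp[OF tri_hom(3)]
          cmp_add[OF I(3) n(3) tri_hom(3)] cmp_idn[OF tri_hom(3)] cmp_scl[OF \<chi>(1) tri_hom(3)] \<chi>(3) by simp
    qed
    then show ?thesis by blast
  qed
qed

text \<open>The cone \<open>Y\<close> of a left \<open>add T\<close>-approximation of \<open>X\<close> is compatible with \<open>T\<close> and \<open>M\<close>, hence lies in
  \<open>add (T \<oplus> M)\<close>. A factorization of \<open>Idn Y\<close> through \<open>T\<close> and \<open>M\<close> lifts along the two triangles to one of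
  \<open>Idn X\<close> through \<open>M'\<close>, up to a morphism that factors through the approximation.\<close>

lemma compatible_in_ideal:
  assumes max: "\<And>Y. \<lbrakk>Y \<in> Obj C; hom_zero C Y (fob S Y); hom_zero C Y (fob S T); hom_zero C Y (fob S M)\<rbrakk>
      \<Longrightarrow> Idn C Y \<in> factor_ideal C {T, M} Y Y"
    and X: "X \<in> Obj C" and ext_X_X: "hom_zero C X (fob S X)" and ext_X_T: "hom_zero C X (fob S T)"
    and ext_X_M': "hom_zero C X (fob S M')"
  shows "Idn C X \<in> factor_ideal C {T, M'} X X"
proof -
  obtain A a where a: "a \<in> Hom C X A" and add_A: "Idn C A \<in> factor_ideal C {T} A A"
    and appr: "\<And>v. v \<in> Hom C X T \<Longrightarrow> \<exists>w \<in> Hom C A T. v = w \<cdot> a"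
    using left_approximation_exists[OF X T_obj hom_finite[OF X T_obj]] by blast
  obtain Y b c where d: "distinguished X A Y a b c" using distinguished_exists[OF a] .
  note dh = distinguished_hom[OF d] and dobj = distinguished_obj[OF d]
  have ext_T_X: "hom_zero C T (fob S X)" using ext_symmetric[OF X T_obj ext_X_T] .
  \<comment> \<open>Morphisms in the ideal of \<open>T\<close> factor through \<open>a\<close>, and
    \<open>far S a \<cdot> c = 0\<close>. They contribute nothing to Ext of
    \<open>Y\<close>.\<close>
  have shift_factor: "far S v \<cdot> c = Zer C Y (fob S W)" if v: "v \<in> factor_ideal C {T} X W" for v W
  proof -
    have "\<exists>w \<in> Hom C A W. v = w \<cdot> a"
      by (rule ideal_factor_left[OF a _ v]) (use appr in blast)
    then obtain w where w: "w \<in> Hom C A W" "v = w \<cdot> a" by blast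
    have "far S v \<cdot> c = far S w \<cdot> (far S a \<cdot> c)"
      using w shift_cmp[OF a w(1)] cmp_assoc[OF dh(3) shift_hom[OF a] shift_hom[OF w(1)]] by simp
    also have "\<dots> = Zer C Y (fob S W)"
      using distinguished_cmp_zer''[OF d] cmp_zer[OF shift_hom[OF w(1)] dobj(3)] by simp
    finally show ?thesis .
  qed
  \<comment> \<open>As Ext of \<open>A\<close> with \<open>W\<close> vanishes, every
    \<open>y\<close> has the form \<open>far S v \<cdot> c\<close>. Compatibility of
    \<open>Y\<close> with \<open>W\<close> thus becomes a condition on the morphisms
    \<open>v\<close> from \<open>X\<close> to \<open>W\<close>.\<close>
  have ext_Y: "hom_zero C Y (fob S W)"
    if W: "hom_zero C T (fob S W)" and fac: "\<And>v. v \<in> Hom C X W \<Longrightarrow> far S v \<cdot> c = Zer C Y (fob S W)" "W \<in> Obj C" for W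
  proof (rule hom_zeroI[OF dobj(3) shift_obj[OF fac(2)]])
    fix y assume y: "y \<in> Hom C Y (fob S W)"
    have "hom_zero C A (fob S W)"
      using hom_zero_ideal_left[OF add_A shift_obj[OF fac(2)]] W by blast
    then have "y \<cdot> b = Zer C A (fob S W)" using hom_zeroD cmp_hom[OF dh(2) y] by blast
    then obtain z where z: "z \<in> Hom C (fob S X) (fob S W)" "y = z \<cdot> c" using coexact_third[OF d y] by blast
    obtain v where v: "v \<in> Hom C X W" "z = far S v" using shift_full[OF z(1) X fac(2)] by blast
    then show "y = Zer C Y (fob S W)" using fac(1) z by blast
  qed
  have ext_Y_T: "hom_zero C Y (fob S T)"
    by (rule ext_Y[OF ext_T_T _ T_obj])
      (use shift_factor ideal_idn_cmp[OF ideal_idn[OF T_obj]] in blast)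
  have ext_T_Y: "hom_zero C T (fob S Y)" using ext_symmetric[OF dobj(3) T_obj ext_Y_T] .
  have ext_Y_Y: "hom_zero C Y (fob S Y)"
  proof (rule ext_Y[OF ext_T_Y _ dobj(3)])
    fix v assume v: "v \<in> Hom C X Y"
    have "c \<cdot> v = Zer C X (fob S X)" using hom_zeroD[OF ext_X_X cmp_hom[OF v dh(3)]] .
    then obtain w where w: "w \<in> Hom C X A" "v = b \<cdot> w" using exact_third[OF d v] by blast
    then have "v \<in> factor_ideal C {T} X Y" using ideal_cmp_left[OF ideal_idn_cmp[OF add_A w(1)] dh(2)] by simp
    then show "far S v \<cdot> c = Zer C Y (fob S Y)" by (rule shift_factor)
  qed
  have ext_Y_M: "hom_zero C Y (fob S M)"
  proof (rule ext_Y[OF ext_T_M _ tri_obj(3)])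
    fix v assume v: "v \<in> Hom C X M"
    \<comment> \<open>Compatibility of \<open>X\<close> with \<open>M'\<close> enters here: it lets
      \<open>v\<close> pass through \<open>f\<close>, hence through \<open>add T\<close>.\<close>
    have "h \<cdot> v = Zer C X (fob S M')" using hom_zeroD[OF ext_X_M' cmp_hom[OF v tri_hom(3)]] .
    then obtain w where w: "w \<in> Hom C X B" "v = f \<cdot> w" using exact_third[OF tri v] by blast
    then have "v \<in> factor_ideal C {T} X M" using ideal_cmp_left[OF ideal_idn_cmp[OF add_B w(1)] tri_hom(2)] by simp
    then show "far S v \<cdot> c = Zer C Y (fob S M)" by (rule shift_factor)
  qed
  have factor_b: "\<exists>w \<in> Hom C Z A. v = b \<cdot> w" if "v \<in> factor_ideal C {T} Z Y" for v Z
  proof (rule ideal_factor_right[OF dh(2) _ that])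
    fix T' v assume "T' \<in> {T}" and v: "v \<in> Hom C T' Y"
    then have "c \<cdot> v = Zer C T' (fob S X)" using hom_zeroD[OF ext_T_X] cmp_hom[OF v dh(3)] by blast
    then show "\<exists>w \<in> Hom C T' A. v = b \<cdot> w" using exact_third[OF d v] by blast
  qed
  \<comment> \<open>An endomorphism \<open>e\<close> of \<open>Y\<close> is traded for some
    \<open>u\<close> on \<open>X\<close> with the same effect on the connecting morphism
    \<open>c\<close>. The relation is additive, so it is enough to treat single terms.\<close>
  have lift: "\<exists>u \<in> factor_ideal C {T, M'} X X. far S u \<cdot> c = c \<cdot> e" if "e \<in> factor_ideal C {T, M} Y Y" for e
    using that
  proof (induction rule: factor_ideal.induct)
    case zer
    have "Zer C X X \<in> factor_ideal C {T, M'} X X" using factor_ideal.zer[OF X X] .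
    moreover have "far S (Zer C X X) \<cdot> c = c \<cdot> Zer C Y Y"
      using shift_zer[OF X X] zer_cmp[OF dh(3) shift_obj[OF X]] cmp_zer[OF dh(3) dobj(3)] by simp
    ultimately show ?case by blast
  next
    case (step T' p q e)
    obtain u where u: "u \<in> factor_ideal C {T, M'} X X" "far S u \<cdot> c = c \<cdot> e" using step.IH by blast
    have e: "e \<in> Hom C Y Y" using step ideal_hom by blast
    have qp: "q \<cdot> p \<in> Hom C Y Y" using step cmp_hom by blast
    have "\<exists>u' \<in> factor_ideal C {T, M'} X X. far S u' \<cdot> c = c \<cdot> (q \<cdot> p)"
    proof (cases "T' = T")
      case True
      \<comment> \<open>A term through \<open>T\<close> has no effect on \<open>c\<close>, since
        \<open>c \<cdot> q\<close> lies in Ext of \<open>T\<close> with \<open>X\<close>.\<close>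
      have "c \<cdot> q = Zer C T (fob S X)" using hom_zeroD[OF ext_T_X] cmp_hom[OF step(3) dh(3)] True by blast
      then have "c \<cdot> (q \<cdot> p) = Zer C Y (fob S X)"
        using cmp_assoc[OF step(2,3) dh(3)] True zer_cmp[OF step(2)] shift_obj[OF X] by simp
      moreover have "Zer C X X \<in> factor_ideal C {T, M'} X X" using factor_ideal.zer[OF X X] .
      moreover have "far S (Zer C X X) \<cdot> c = Zer C Y (fob S X)"
        using shift_zer[OF X X] zer_cmp[OF dh(3) shift_obj[OF X]] by simp
      ultimately show ?thesis by force
    next
      case False
      then have "T' = M" using step(1) by blast
      then have p: "p \<in> Hom C Y M" and q: "q \<in> Hom C M Y" using step by blast+
      \<comment> \<open>For a term through \<open>M\<close>, both \<open>p\<close> and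
        \<open>q\<close> extend to morphisms between the two triangles; their first components pass
        through \<open>M'\<close>.\<close>
      obtain p' where p': "p' \<in> Hom C A B" "p \<cdot> b = f \<cdot> p'"
        using approx_add[OF add_A cmp_hom[OF dh(2) p]] by blast
      obtain p'' where p'': "p'' \<in> Hom C X M'" "far S p'' \<cdot> c = h \<cdot> p"
        using distinguished_morphism_first[OF d tri p'(1) p p'(2)] by blast
      obtain q' where q': "q' \<in> Hom C B A" "q \<cdot> f = b \<cdot> q'"
        using factor_b[OF ideal_cmp_idn[OF add_B cmp_hom[OF tri_hom(2) q]]] by blast
      obtain q'' where q'': "q'' \<in> Hom C M' X" "far S q'' \<cdot> h = c \<cdot> q"
        using distinguished_morphism_first[OF tri d q'(1) q q'(2)] by blast
      have "far S (q'' \<cdot> p'') \<cdot> c = c \<cdot> (q \<cdot> p)"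
        using shift_cmp[OF p''(1) q''(1)] cmp_assoc[OF dh(3) shift_hom[OF p''(1)] shift_hom[OF q''(1)]]
          cmp_assoc[OF p tri_hom(3) shift_hom[OF q''(1)]] cmp_assoc[OF p q dh(3)] p''(2) q''(2) by simp
      moreover have "q'' \<cdot> p'' \<in> factor_ideal C {T, M'} X X"
        using ideal_single[OF _ p''(1) q''(1), of "{T, M'}"] by simp
      ultimately show ?thesis by blast
    qed
    then obtain u' where u': "u' \<in> factor_ideal C {T, M'} X X" "far S u' \<cdot> c = c \<cdot> (q \<cdot> p)" by blast
    have "far S (u' \<oplus> u) \<cdot> c = c \<cdot> ((q \<cdot> p) \<oplus> e)"
      using shift_add[OF ideal_hom[OF u'(1)] ideal_hom[OF u(1)]]
        add_cmp[OF dh(3) shift_hom[OF ideal_hom[OF u'(1)]] shift_hom[OF ideal_hom[OF u(1)]]]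
        cmp_add[OF qp e dh(3)] u u' by simp
    then show ?case using ideal_add[OF u'(1) u(1)] by blast
  qed
  obtain u where u: "u \<in> factor_ideal C {T, M'} X X" "far S u \<cdot> c = c \<cdot> Idn C Y"
    using lift[OF max[OF dobj(3) ext_Y_Y ext_Y_T ext_Y_M]] by blast
  have uh: "u \<in> Hom C X X" using ideal_hom[OF u(1)] .
  have I: "Idn C X \<in> Hom C X X" using idn_hom[OF X] .
  have dif: "Idn C X \<oplus> (- 1) \<odot> u \<in> Hom C X X" using I uh scl_hom add_hom by blast
  \<comment> \<open>\<open>u\<close> acts on \<open>c\<close> like the identity, so
    \<open>1 - u\<close> is unobstructed, factors through \<open>a\<close> and lies in the ideal of
    \<open>T\<close>.\<close>
  have "far S (Idn C X \<oplus> (- 1) \<odot> u) \<cdot> c = Zer C Y (fob S X)"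
    using shift_add[OF I scl_hom[OF uh]] shift_idn[OF X] shift_scl[OF uh]
      add_cmp[OF dh(3) idn_hom[OF shift_obj[OF X]] scl_hom[OF shift_hom[OF uh]]]
      scl_cmp[OF dh(3) shift_hom[OF uh]] idn_cmp[OF dh(3)] cmp_idn[OF dh(3)] u(2) add_neg[OF dh(3)] by simp
  then obtain v where v: "v \<in> Hom C A X" "Idn C X \<oplus> (- 1) \<odot> u = v \<cdot> a"
    using coexact_fourth[OF d dif] by blast
  have "Idn C X \<oplus> (- 1) \<odot> u \<in> factor_ideal C {T} X X"
    using ideal_cmp_left[OF ideal_idn_cmp[OF add_A a] v(1)] v(2) by simp
  then have "Idn C X \<oplus> (- 1) \<odot> u \<in> factor_ideal C {T, M'} X X" by (rule ideal_mono) simp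
  then have "u \<oplus> (Idn C X \<oplus> (- 1) \<odot> u) \<in> factor_ideal C {T, M'} X X" using ideal_add[OF u(1)] by simp
  then show ?thesis using add_neg_cancel[OF I uh] by simp
qed

end

section \<open>Rigid sets, basic objects and the exchange of complements\<close>

lemma Ext1_vanishes_iff: "Ext1_vanishes C S X Y \<longleftrightarrow> hom_zero C X (fob S Y)"
  by (simp add: Ext1_vanishes_def Ext1_def hom_zero_def)

context linear_category
begin

lemma local_hom_sum_iso:
  assumes "local_endomorphism_ring C X" "finite I" "\<And>i. i \<in> I \<Longrightarrow> f i \<in> Hom C X X"
    "is_iso C X X (hom_sum C X X f I)"
  shows "\<exists>i \<in> I. is_iso C X X (f i)"
  using assms(2-4)
proof (induction I)
  case empty
  have X: "X \<in> Obj C" "Idn C X \<noteq> Zer C X X" using assms(1) by (auto simp: local_endomorphism_ring_def)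
  have z: "is_iso C X X (Zer C X X)" using empty(2) X by simp
  obtain u where u: "u \<in> Hom C X X" "u \<cdot> Zer C X X = Idn C X" using is_isoE[OF z] by metis
  then show ?case using cmp_zer[OF u(1) X(1)] X(2) by simp
next
  case (insert i I)
  have X: "X \<in> Obj C" using assms(1) by (auto simp: local_endomorphism_ring_def)
  have s: "hom_sum C X X f (insert i I) = f i \<oplus> hom_sum C X X f I"
    using hom_sum_insert[OF insert.hyps(1,2) X X] insert.prems by blast
  have h: "f i \<in> Hom C X X" "hom_sum C X X f I \<in> Hom C X X"
    using insert.prems(1) hom_sum_closed[OF X X, of I f] by simp_all
  show ?case
  proof (cases "is_iso C X X (f i)")
    case False
    then have "is_iso C X X (hom_sum C X X f I)"
      using assms(1) h insert.prems(2) unfolding local_endomorphism_ring_def s by blast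
    then show ?thesis using insert by blast
  qed blast
qed

text \<open>Modulo the radical of \<open>End N\<close>, only the summand isomorphic to \<open>N\<close> contributes to \<open>p \<cdot> s\<close>, \<open>q \<cdot> t\<close>
  and \<open>p \<cdot> t\<close>; the first two being the identity makes the third invertible.\<close>

lemma direct_sum_no_repeated_summand:
  assumes N: "local_endomorphism_ring C N" and d: "direct_sum C Xs X"
    and Xs: "\<And>Y. Y \<in> set Xs \<Longrightarrow> local_endomorphism_ring C Y"
    and noniso: "\<And>i j. i < length Xs \<Longrightarrow> j < length Xs \<Longrightarrow> i \<noteq> j \<Longrightarrow> \<not> isomorphic C (Xs ! i) (Xs ! j)"
    and h: "s \<in> Hom C N X" "t \<in> Hom C N X" "p \<in> Hom C X N" "q \<in> Hom C X N"
    and e: "p \<cdot> s = Idn C N" "q \<cdot> t = Idn C N" "p \<cdot> t = Zer C N N"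
  shows False
proof -
  let ?n = "length Xs"
  obtain \<iota> \<pi> where \<iota>: "\<And>i. i < ?n \<Longrightarrow> \<iota> i \<in> Hom C (Xs ! i) X"
    and \<pi>: "\<And>i. i < ?n \<Longrightarrow> \<pi> i \<in> Hom C X (Xs ! i)"
    and id: "hom_sum C X X (\<lambda>i. \<iota> i \<cdot> \<pi> i) {..<?n} = Idn C X"
    using d unfolding direct_sum_def by blast
  have obj: "X \<in> Obj C" "N \<in> Obj C" using h hom_obj by blast+
  have in1: "\<pi> i \<cdot> a \<in> Hom C N (Xs ! i)" if "i < ?n" "a \<in> Hom C N X" for i a
    using \<pi> that cmp_hom by blast
  have in2: "b \<cdot> \<iota> i \<in> Hom C (Xs ! i) N" if "i < ?n" "b \<in> Hom C X N" for i b
    using \<iota> that cmp_hom by blast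
  have expand: "b \<cdot> a = hom_sum C N N (\<lambda>i. (b \<cdot> \<iota> i) \<cdot> (\<pi> i \<cdot> a)) {..<?n}"
    if a: "a \<in> Hom C N X" and b: "b \<in> Hom C X N" for a b
  proof -
    have "b \<cdot> a = b \<cdot> (Idn C X \<cdot> a)" using idn_cmp[OF a] by simp
    also have "\<dots> = b \<cdot> (hom_sum C X X (\<lambda>i. \<iota> i \<cdot> \<pi> i) {..<?n} \<cdot> a)" using id by simp
    also have "\<dots> = b \<cdot> hom_sum C N X (\<lambda>i. (\<iota> i \<cdot> \<pi> i) \<cdot> a) {..<?n}"
      using hom_sum_cmp[of "{..<?n}" X X "\<lambda>i. \<iota> i \<cdot> \<pi> i" a N] obj a cmp_hom[OF \<pi> \<iota>] by simp
    also have "\<dots> = hom_sum C N N (\<lambda>i. b \<cdot> ((\<iota> i \<cdot> \<pi> i) \<cdot> a)) {..<?n}"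
      by (rule cmp_hom_sum) (use obj b cmp_hom[OF a cmp_hom[OF \<pi> \<iota>]] in auto)
    also have "\<dots> = hom_sum C N N (\<lambda>i. (b \<cdot> \<iota> i) \<cdot> (\<pi> i \<cdot> a)) {..<?n}"
    proof (rule hom_sum_cong[OF obj(2,2)])
      fix i assume "i \<in> {..<?n}"
      then have i: "i < ?n" by simp
      show "(b \<cdot> \<iota> i) \<cdot> (\<pi> i \<cdot> a) \<in> Hom C N N" using in1[OF i a] in2[OF i b] cmp_hom by blast
      show "b \<cdot> ((\<iota> i \<cdot> \<pi> i) \<cdot> a) = (b \<cdot> \<iota> i) \<cdot> (\<pi> i \<cdot> a)"
        using cmp_assoc[OF a \<pi>[OF i] \<iota>[OF i]] cmp_assoc[OF in1[OF i a] \<iota>[OF i] b] by simp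
    qed
    finally show ?thesis .
  qed
  have cl: "(b \<cdot> \<iota> i) \<cdot> (\<pi> i \<cdot> a) \<in> Hom C N N" if "i < ?n" "a \<in> Hom C N X" "b \<in> Hom C X N" for i a b
    using in1[OF that(1,2)] in2[OF that(1,3)] cmp_hom by blast
  have iso_summand: "is_iso C N (Xs ! i) (\<pi> i \<cdot> a)" "is_iso C (Xs ! i) N (b \<cdot> \<iota> i)" "isomorphic C N (Xs ! i)"
    if i: "i < ?n" and a: "a \<in> Hom C N X" and b: "b \<in> Hom C X N"
      and iso: "is_iso C N N ((b \<cdot> \<iota> i) \<cdot> (\<pi> i \<cdot> a))" for i a b
    using local_retract_section_iso[OF N Xs in1[OF i a] in2[OF i b] iso] i unfolding isomorphic_def by auto
  have ex: "\<exists>i < ?n. is_iso C N N ((b \<cdot> \<iota> i) \<cdot> (\<pi> i \<cdot> a))"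
    if "a \<in> Hom C N X" "b \<in> Hom C X N" "b \<cdot> a = Idn C N" for a b
    using local_hom_sum_iso[OF N, of "{..<?n}" "\<lambda>i. (b \<cdot> \<iota> i) \<cdot> (\<pi> i \<cdot> a)"] expand[OF that(1,2)]
      that(3) idn_iso[OF obj(2)] cl[OF _ that(1,2)] by auto
  \<comment> \<open>Each of the two identities has an invertible term. Both terms belong to summands
    isomorphic to \<open>N\<close>, and there is only one such index.\<close>
  obtain k where k: "k < ?n" "is_iso C N N ((p \<cdot> \<iota> k) \<cdot> (\<pi> k \<cdot> s))" using ex[OF h(1,3) e(1)] by blast
  obtain l where l: "l < ?n" "is_iso C N N ((q \<cdot> \<iota> l) \<cdot> (\<pi> l \<cdot> t))" using ex[OF h(2,4) e(2)] by blast
  have Nk: "isomorphic C N (Xs ! k)" using iso_summand(3)[OF k(1) h(1,3) k(2)] .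
  have same: "i = k" if "i < ?n" "isomorphic C N (Xs ! i)" for i
    using noniso[OF that(1) k(1)] isomorphic_trans[OF isomorphic_sym[OF that(2)] Nk] by blast
  have lk: "l = k" using same[OF l(1) iso_summand(3)[OF l(1) h(2,4) l(2)]] .
  have isok: "is_iso C N N ((p \<cdot> \<iota> k) \<cdot> (\<pi> k \<cdot> t))"
    using iso_cmp iso_summand(2)[OF k(1) h(1,3) k(2)] iso_summand(1)[OF l(1) h(2,4) l(2)] lk by blast
  let ?m = "\<lambda>i. (p \<cdot> \<iota> i) \<cdot> (\<pi> i \<cdot> t)"
  let ?r = "hom_sum C N N ?m ({..<?n} - {k})"
  have r: "?r \<in> Hom C N N" by (rule hom_sum_closed[OF obj(2,2)]) (use cl h in auto)
  have mk: "?m k \<in> Hom C N N" using cl k h by blast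
  have "{..<?n} = insert k ({..<?n} - {k})" using k(1) by auto
  then have "p \<cdot> t = ?m k \<oplus> ?r"
    using expand[OF h(2,3)] hom_sum_insert[of "{..<?n} - {k}" k N N ?m] cl[OF _ h(2,3)] obj k(1) by auto
  then have z: "?m k \<oplus> ?r = Zer C N N" using e by simp
  \<comment> \<open>As \<open>p \<cdot> t\<close> is zero, the terms other than the
    \<open>k\<close>-th add up to minus an automorphism. One of them is then invertible and yields a
    second summand isomorphic to \<open>N\<close>.\<close>
  have "?r = (- 1) \<odot> ?m k"
    using add_left_cancel[OF mk r scl_hom[OF mk, of "- 1"]] z add_neg[OF mk] by simp
  moreover have "is_iso C N N ((- 1) \<odot> ?m k)"
  proof -
    obtain u where u: "u \<in> Hom C N N" "u \<cdot> ?m k = Idn C N" "?m k \<cdot> u = Idn C N" using is_isoE[OF isok] by metis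
    have "((- 1) \<odot> u) \<cdot> ((- 1) \<odot> ?m k) = u \<cdot> ?m k" "((- 1) \<odot> ?m k) \<cdot> ((- 1) \<odot> u) = ?m k \<cdot> u"
      using scl_cmp[OF scl_hom[OF mk, of "- 1"] u(1), of "- 1"] cmp_scl[OF mk u(1), of "- 1"]
        scl_cmp[OF scl_hom[OF u(1), of "- 1"] mk, of "- 1"] cmp_scl[OF u(1) mk, of "- 1"]
        neg_neg cmp_hom[OF mk u(1)] cmp_hom[OF u(1) mk] by simp_all
    then show ?thesis using is_isoI[OF scl_hom[OF mk] scl_hom[OF u(1)]] u by simp
  qed
  ultimately have "is_iso C N N ?r" by simp
  then obtain j where "j < ?n" "j \<noteq> k" "is_iso C N N (?m j)"
    using local_hom_sum_iso[OF N, of "{..<?n} - {k}" ?m] cl[OF _ h(2,3)] by auto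
  then show False using iso_summand(3)[OF _ h(2,3)] same by blast
qed

lemma ideal_isomorphic:
  assumes "isomorphic C Y X" "Idn C X \<in> factor_ideal C \<T> X X"
  shows "Idn C Y \<in> factor_ideal C \<T> Y Y"
proof -
  obtain u v where uv: "u \<in> Hom C Y X" "v \<in> Hom C X Y" "v \<cdot> u = Idn C Y"
    using assms(1) unfolding isomorphic_def is_iso_def by blast
  show ?thesis using ideal_cmp_left[OF ideal_idn_cmp[OF assms(2) uv(1)] uv(2)] uv(3) by simp
qed

lemma summand_retract:
  assumes "summand C X U"
  obtains s r where "s \<in> Hom C X U" "r \<in> Hom C U X" "r \<cdot> s = Idn C X"
  using assms direct_sum_retract[of "[X, _]" U X] unfolding summand_def by auto

lemma summand_ideal: "summand C X U \<Longrightarrow> Idn C X \<in> factor_ideal C {U} X X"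
  using summand_retract retract_idn by metis

end

context triangulated_category
begin

lemma hom_zero_shift_retract:
  assumes "hom_zero C X (fob S Y)" and s: "s \<in> Hom C Z Y" and r: "r \<in> Hom C Y Z" and rs: "r \<cdot> s = Idn C Z"
  shows "hom_zero C X (fob S Z)"
proof (rule hom_zero_retract_right[OF assms(1) shift_hom[OF s] shift_hom[OF r]])
  show "far S r \<cdot> far S s = Idn C (fob S Z)"
    using shift_cmp[OF s r] rs shift_idn hom_obj[OF s] by simp
qed

lemma ext_zero_ideal:
  assumes "Idn C X \<in> factor_ideal C \<T> X X" "Idn C Y \<in> factor_ideal C \<U> Y Y"
    "\<U> \<subseteq> Obj C" "\<And>T U. T \<in> \<T> \<Longrightarrow> U \<in> \<U> \<Longrightarrow> hom_zero C T (fob S U)"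
  shows "hom_zero C X (fob S Y)"
proof (rule ext_zero_ideal_right[OF assms(2)])
  show "X \<in> Obj C" using ideal_hom[OF assms(1)] hom_obj by blast
  fix U assume U: "U \<in> \<U>"
  then have "fob S U \<in> Obj C" using assms(3) shift_obj by blast
  then show "hom_zero C X (fob S U)" using hom_zero_ideal_left[OF assms(1)] assms(4) U by blast
qed

lemma obj_in_add_closure:
  assumes "T \<in> Obj C" shows "T \<in> add_closure C T"
proof -
  obtain U where U: "direct_sum C [T] U" using direct_sum_exists[of "[T]"] assms by auto
  obtain s r where "s \<in> Hom C T U" "r \<in> Hom C U T" "r \<cdot> s = Idn C T"
    using direct_sum_retract[OF U] by auto
  then have "summand C T U" by (rule split_mono_summand)
  moreover have "direct_sum C (replicate 1 T) U" using U by simp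
  ultimately show ?thesis unfolding add_closure_def by blast
qed

lemma add_closure_ideal:
  assumes "B \<in> add_closure C T" shows "Idn C B \<in> factor_ideal C {T} B B"
proof -
  obtain n U where U: "direct_sum C (replicate n T) U" and B: "summand C B U"
    using assms unfolding add_closure_def by blast
  have "Idn C U \<in> factor_ideal C {T} U U"
    by (rule ideal_mono[OF direct_sum_idn[OF U]]) auto
  then show ?thesis using ideal_subset[OF _ summand_ideal[OF B], of "{T}"] by blast
qed

end

context ext_symmetric_category
begin

text \<open>Every Krull-Schmidt summand \<open>Z\<close> of \<open>Y\<close> is compatible with
  itself and, by symmetry on both sides, with \<open>R\<close>. If \<open>Z\<close> were isomorphic
  to no member, \<open>insert Z R\<close> would be a larger rigid set.\<close>

lemma rigid_set_maximal_ideal: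
  assumes R: "maximal_rigid_set C S R"
    and Y: "Y \<in> Obj C" "hom_zero C Y (fob S Y)" "\<And>X. X \<in> R \<Longrightarrow> hom_zero C Y (fob S X)"
  shows "Idn C Y \<in> factor_ideal C R Y Y"
proof -
  have rigid: "\<And>X. X \<in> R \<Longrightarrow> indecomposable C X"
      "\<And>X X'. X \<in> R \<Longrightarrow> X' \<in> R \<Longrightarrow> X \<noteq> X' \<Longrightarrow> \<not> isomorphic C X X'"
      "\<And>X X'. X \<in> R \<Longrightarrow> X' \<in> R \<Longrightarrow> hom_zero C X (fob S X')"
    and max: "\<And>R'. rigid_set C S R' \<Longrightarrow> R \<subseteq> R' \<Longrightarrow> R' = R"
    using R unfolding maximal_rigid_set_def rigid_set_def Ext1_vanishes_iff by blast+
  obtain Ys where Ys: "direct_sum C Ys Y" "\<And>Z. Z \<in> set Ys \<Longrightarrow> local_endomorphism_ring C Z"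
    using krull_schmidt[OF Y(1)] by blast
  show ?thesis
  proof (rule ideal_direct_sum[OF Ys(1)])
    fix Z assume Z: "Z \<in> set Ys"
    obtain s r where sr: "s \<in> Hom C Z Y" "r \<in> Hom C Y Z" "r \<cdot> s = Idn C Z"
      using direct_sum_retract[OF Ys(1) Z] .
    have Zobj: "Z \<in> Obj C" using sr(1) hom_obj by blast
    have Zind: "indecomposable C Z" using Ys(2)[OF Z] local_indecomposable by blast
    have ZY: "hom_zero C Z (fob S Y)" using hom_zero_retract_left[OF Y(2) sr] .
    have ZZ: "hom_zero C Z (fob S Z)" using hom_zero_shift_retract[OF ZY sr] .
    have ZR: "hom_zero C Z (fob S X)" if "X \<in> R" for X using hom_zero_retract_left[OF Y(3)[OF that] sr] .
    have RZ: "hom_zero C X (fob S Z)" if "X \<in> R" for X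
      using ext_symmetric[OF Zobj _ ZR[OF that]] rigid(1)[OF that] by (auto simp: indecomposable_def)
    have "\<exists>X \<in> R. isomorphic C Z X"
    proof (rule ccontr)
      assume n: "\<not> (\<exists>X \<in> R. isomorphic C Z X)"
      have "rigid_set C S (insert Z R)"
        unfolding rigid_set_def Ext1_vanishes_iff
        using rigid Zind ZZ ZR RZ n isomorphic_sym by blast
      then have "Z \<in> R" using max by blast
      then show False using n isomorphic_refl[OF Zobj] by blast
    qed
    then obtain X where X: "X \<in> R" "isomorphic C Z X" by blast
    then have "Idn C X \<in> factor_ideal C R X X" using ideal_idn isomorphic_obj by blast
    then show "Idn C Z \<in> factor_ideal C R Z Z" using ideal_isomorphic[OF X(2)] by blast
  qed
qed

theorem exchange_complement:
  assumes act: "almost_complete_basic_tilting C S T" and cM: "complement C S T M"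
    and min: "minimal_right_approximation C T M B f"
    and tri: "(g, f, h) \<in> \<Delta>" "is_triangle C S M' B M (g, f, h)"
  shows "complement C S T M' \<and> \<not> isomorphic C M' M"
proof -
  obtain Ts where Ts: "direct_sum C Ts T" "\<And>X. X \<in> set Ts \<Longrightarrow> indecomposable C X"
    and Ts_noniso: "\<And>i j. i < length Ts \<Longrightarrow> j < length Ts \<Longrightarrow> i \<noteq> j \<Longrightarrow> \<not> isomorphic C (Ts ! i) (Ts ! j)"
    using act unfolding almost_complete_basic_tilting_def basic_def by blast
  have T: "T \<in> Obj C" using Ts(1) by (simp add: direct_sum_def)
  have idT: "Idn C T \<in> factor_ideal C (set Ts) T T" using direct_sum_idn[OF Ts(1)] .
  obtain U where U: "direct_sum C [T, M] U" and U_basic: "basic C U" and U_tilting: "tilting C S U"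
    and M_indec: "indecomposable C M"
    using cM unfolding complement_def by blast
  obtain R where R: "summand_reps C U R" "maximal_rigid_set C S R"
    and UU: "hom_zero C U (fob S U)"
    using U_tilting unfolding tilting_def exceptional_def Ext1_vanishes_iff by blast
  have M: "M \<in> Obj C" using M_indec by (simp add: indecomposable_def)
  have Uobj: "{U} \<subseteq> Obj C" using U by (simp add: direct_sum_def)
  have ext_U: "hom_zero C X (fob S Y)"
    if "Idn C X \<in> factor_ideal C {U} X X" "Idn C Y \<in> factor_ideal C {U} Y Y" for X Y
    using ext_zero_ideal[OF that Uobj] UU by blast
  have TU: "Idn C T \<in> factor_ideal C {U} T T" and MU: "Idn C M \<in> factor_ideal C {U} M M"
    using direct_sum_idn_summand[OF U] by simp_all
  \<comment> \<open>Otherwise \<open>M\<close> is isomorphic to a summand \<open>N\<close> of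
    \<open>T\<close>, and \<open>T \<oplus> M\<close> contains \<open>N\<close> twice.
    \<open>basic\<close> only asserts that some decomposition has no repetition, so this has to be
    compared with the decomposition at hand.\<close>
  have M_notin: "Idn C M \<notin> factor_ideal C {T} M M"
  proof
    assume "Idn C M \<in> factor_ideal C {T} M M"
    then have "Idn C M \<in> factor_ideal C (set Ts) M M" using ideal_subset[of "{T}"] idT by blast
    then obtain N where N: "N \<in> set Ts" "isomorphic C M N"
      using indecomposable_ideal_iso[OF M_indec _ Ts(2)] by blast
    obtain u v where uv: "u \<in> Hom C M N" "v \<in> Hom C N M" "v \<cdot> u = Idn C M" "u \<cdot> v = Idn C N"
      using N(2) unfolding isomorphic_def is_iso_def by blast
    obtain s r where sr: "s \<in> Hom C N T" "r \<in> Hom C T N" "r \<cdot> s = Idn C N"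
      using direct_sum_retract[OF Ts(1) N(1)] .
    obtain i j p q where ij: "i \<in> Hom C T U" "j \<in> Hom C M U" "p \<in> Hom C U T" "q \<in> Hom C U M"
      "p \<cdot> i = Idn C T" "q \<cdot> j = Idn C M" "p \<cdot> j = Zer C M T" "q \<cdot> i = Zer C T M"
      "(i \<cdot> p) \<oplus> (j \<cdot> q) = Idn C U"
      using direct_sum_pairE[OF U] by blast
    obtain Us where Us: "direct_sum C Us U" "\<And>X. X \<in> set Us \<Longrightarrow> indecomposable C X"
      and Us_noniso: "\<And>i j. i < length Us \<Longrightarrow> j < length Us \<Longrightarrow> i \<noteq> j \<Longrightarrow> \<not> isomorphic C (Us ! i) (Us ! j)"
      using U_basic unfolding basic_def by blast
    have Nobj: "N \<in> Obj C" using uv hom_obj by blast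
    show False
    proof (rule direct_sum_no_repeated_summand[OF _ Us(1) _ Us_noniso])
      show "local_endomorphism_ring C N" using Ts(2)[OF N(1)] indecomposable_local by blast
      show "\<And>Y. Y \<in> set Us \<Longrightarrow> local_endomorphism_ring C Y" using Us(2) indecomposable_local by blast
      show "i \<cdot> s \<in> Hom C N U" "j \<cdot> v \<in> Hom C N U" "r \<cdot> p \<in> Hom C U N" "u \<cdot> q \<in> Hom C U N"
        using ij sr uv cmp_hom by blast+
      show "(r \<cdot> p) \<cdot> (i \<cdot> s) = Idn C N"
        using cmp_assoc[OF cmp_hom[OF sr(1) ij(1)] ij(3) sr(2)] cmp_assoc[OF sr(1) ij(1,3)] ij(5) sr(3)
          idn_cmp[OF sr(1)] by simp
      show "(u \<cdot> q) \<cdot> (j \<cdot> v) = Idn C N"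
        using cmp_assoc[OF cmp_hom[OF uv(2) ij(2)] ij(4) uv(1)] cmp_assoc[OF uv(2) ij(2,4)] ij(6) uv(4)
          idn_cmp[OF uv(2)] by simp
      show "(r \<cdot> p) \<cdot> (j \<cdot> v) = Zer C N N"
        using cmp_assoc[OF cmp_hom[OF uv(2) ij(2)] ij(3) sr(2)] cmp_assoc[OF uv(2) ij(2,3)] ij(7)
          zer_cmp[OF uv(2) T] cmp_zer[OF sr(2) Nobj] by simp
    qed
  qed
  have B: "B \<in> add_closure C T" and fB: "f \<in> Hom C B M"
    and appr: "\<And>X. X \<in> add_closure C T \<Longrightarrow> (\<lambda>h. f \<cdot> h) ` Hom C X B = Hom C X M"
    and mini: "\<And>e. e \<in> Hom C B B \<Longrightarrow> f \<cdot> e = f \<Longrightarrow> is_iso C B B e"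
    using min unfolding minimal_right_approximation_def right_approximation_def by blast+
  interpret X: exchange_triangle C S \<Delta> T M M' B f g h
  proof unfold_locales
    show "distinguished M' B M g f h" using tri by (simp add: distinguished_def)
    show "Idn C B \<in> factor_ideal C {T} B B" using add_closure_ideal[OF B] .
    show "\<And>v. v \<in> Hom C T M \<Longrightarrow> \<exists>w \<in> Hom C T B. v = f \<cdot> w"
      using appr[OF obj_in_add_closure[OF T]] by blast
  qed (use T mini ext_U TU MU M_indec M_notin in blast)+
  have M': "M' \<in> Obj C" using X.tri_obj(1) .
  obtain V where V: "direct_sum C [T, M'] V" using direct_sum_exists[of "[T, M']"] T M' by auto
  \<comment> \<open>This list serves three times: as the decomposition that makes \<open>V\<close>
    basic, as its representatives of summands, and as the maximal rigid set.\<close>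
  let ?L = "Ts @ [M']"
  have VL: "direct_sum C ?L V" using direct_sum_append[OF Ts(1) V] .
  have Tsi: "Idn C X \<in> factor_ideal C {T} X X" if "X \<in> set Ts" for X
    using direct_sum_idn_summand[OF Ts(1) that] .
  have M'_Ts: "\<not> isomorphic C M' X" if "X \<in> set Ts" for X
    using ideal_isomorphic[OF _ Tsi[OF that]] X.M'_notin
    by (metis ideal_isomorphic ideal_subset Tsi singletonD that)
  have L_indec: "indecomposable C X" if "X \<in> set ?L" for X using that Ts(2) X.M'_indec by auto
  have L_noniso: "\<not> isomorphic C (?L ! i) (?L ! j)"
    if ij: "i < length ?L" "j < length ?L" "i \<noteq> j" for i j
  proof -
    consider "i < length Ts" "j < length Ts" | "i < length Ts" "j = length Ts" | "i = length Ts" "j < length Ts"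
      using ij by fastforce
    then show ?thesis
    proof cases
      case 1
      then show ?thesis using Ts_noniso ij(3) by (simp add: nth_append)
    next
      case 2
      then show ?thesis using M'_Ts[of "Ts ! i"] isomorphic_sym by (auto simp: nth_append)
    next
      case 3
      then show ?thesis using M'_Ts[of "Ts ! j"] by (auto simp: nth_append)
    qed
  qed
  have V_basic: "basic C V" unfolding basic_def using VL L_indec L_noniso by blast
  have idV: "Idn C V \<in> factor_ideal C {T, M'} V V" using direct_sum_idn[OF V] by simp
  have ext_TM': "hom_zero C X (fob S Y)"
    if "Idn C X \<in> factor_ideal C {T, M'} X X" "Idn C Y \<in> factor_ideal C {T, M'} Y Y" for X Y
    using ext_zero_ideal[OF that] T M' X.ext_T_T X.ext_T_M' X.ext_M'_T X.ext_M'_M' by blast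
  have LI: "Idn C X \<in> factor_ideal C {T, M'} X X" if "X \<in> set ?L" for X
  proof (cases "X = M'")
    case True
    then show ?thesis using ideal_idn[OF M'] by simp
  next
    case False
    then have "X \<in> set Ts" using that by simp
    then show ?thesis using ideal_mono[OF Tsi, of X "{T, M'}"] by blast
  qed
  have IL: "Idn C X \<in> factor_ideal C (set ?L) X X" if "Idn C X \<in> factor_ideal C {T, M'} X X" for X
  proof (rule ideal_subset[OF _ that])
    fix Y assume "Y \<in> {T, M'}"
    then show "Idn C Y \<in> factor_ideal C (set ?L) Y Y"
      using ideal_mono[OF idT, of "set ?L"] ideal_idn[OF M', of "set ?L"] by auto
  qed
  have L_distinct: "\<not> isomorphic C X Y" if XY: "X \<in> set ?L" "Y \<in> set ?L" "X \<noteq> Y" for X Y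
  proof -
    obtain i j where "i < length ?L" "?L ! i = X" "j < length ?L" "?L ! j = Y"
      using XY(1,2) unfolding in_set_conv_nth by blast
    then show ?thesis using L_noniso XY(3) by blast
  qed
  have rigid: "rigid_set C S (set ?L)"
    unfolding rigid_set_def Ext1_vanishes_iff using L_indec L_distinct ext_TM' LI by blast
  have reps: "summand_reps C V (set ?L)"
    unfolding summand_reps_def
  proof (intro conjI ballI allI impI)
    fix X assume X: "X \<in> set ?L"
    show "indecomposable C X" using L_indec[OF X] .
    show "summand C X V" using direct_sum_retract[OF VL X] split_mono_summand by metis
  next
    fix X assume X: "indecomposable C X \<and> summand C X V"
    then have "Idn C X \<in> factor_ideal C {V} X X" using summand_ideal by blast
    then have "Idn C X \<in> factor_ideal C {T, M'} X X" using ideal_subset[of "{V}"] idV by blast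
    then show "\<exists>Y \<in> set ?L. isomorphic C X Y"
      using indecomposable_ideal_iso[OF _ IL L_indec] X by metis
  qed (use L_distinct in blast)
  have RU: "Idn C X \<in> factor_ideal C {T, M} X X" if "X \<in> R" for X
  proof -
    have "Idn C X \<in> factor_ideal C {U} X X" using R(1) that summand_ideal unfolding summand_reps_def by blast
    moreover have "Idn C U \<in> factor_ideal C {T, M} U U" using direct_sum_idn[OF U] by simp
    ultimately show ?thesis using ideal_subset[of "{U}"] by blast
  qed
  \<comment> \<open>Maximality of \<open>T \<oplus> M\<close> is given for some set \<open>R\<close>
    of representatives. Its members lie in \<open>add (T \<oplus> M)\<close>, so an object
    compatible with \<open>T\<close> and \<open>M\<close> is compatible with
    \<open>R\<close>.\<close>
  have max: "Idn C Y \<in> factor_ideal C {T, M} Y Y"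
    if Y: "Y \<in> Obj C" "hom_zero C Y (fob S Y)" "hom_zero C Y (fob S T)" "hom_zero C Y (fob S M)" for Y
  proof -
    have "hom_zero C Y (fob S X)" if "X \<in> R" for X
      by (rule ext_zero_ideal_right[OF RU[OF that] Y(1)]) (use Y in blast)
    then have "Idn C Y \<in> factor_ideal C R Y Y" using rigid_set_maximal_ideal[OF R(2) Y(1,2)] by blast
    then show ?thesis using ideal_subset[OF RU] by blast
  qed
  have "R' = set ?L" if R': "rigid_set C S R'" "set ?L \<subseteq> R'" for R'
  proof -
    \<comment> \<open>\<open>X\<close> lies in \<open>add (T \<oplus> M')\<close>, so it is
      isomorphic to a member of the list. Both belong to \<open>R'\<close>, whose distinct members
      are not isomorphic.\<close>
    have "X \<in> set ?L" if X: "X \<in> R'" for X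
    proof -
      have Xi: "indecomposable C X" using R'(1) X unfolding rigid_set_def by blast
      have XR: "hom_zero C X (fob S Y)" if "Y \<in> R'" for Y
        using R'(1) X that unfolding rigid_set_def Ext1_vanishes_iff by blast
      have Xobj: "X \<in> Obj C" using Xi by (simp add: indecomposable_def)
      have "hom_zero C X (fob S T)"
        by (rule ext_zero_ideal_right[OF idT Xobj]) (use XR R'(2) in auto)
      then have "Idn C X \<in> factor_ideal C {T, M'} X X"
        using X.compatible_in_ideal[OF max Xobj XR[OF X]] XR R'(2) by auto
      then obtain Y where Y: "Y \<in> set ?L" "isomorphic C X Y"
        using indecomposable_ideal_iso[OF Xi IL L_indec] by metis
      then have "X = Y" using R' X unfolding rigid_set_def by blast
      then show ?thesis using Y by blast
    qed
    then show ?thesis using R'(2) by blast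
  qed
  then have "maximal_rigid_set C S (set ?L)" using rigid unfolding maximal_rigid_set_def by blast
  moreover have "exceptional C S V"
    unfolding exceptional_def Ext1_vanishes_iff using ext_TM'[OF idV idV] V by (simp add: direct_sum_def)
  ultimately have "tilting C S V" unfolding tilting_def using reps by blast
  then have "complement C S T M'" unfolding complement_def using X.M'_indec V V_basic by blast
  then show ?thesis using X.not_isomorphic by blast
qed

end

section \<open>Orbit categories\<close>

text \<open>Vanishing and spanning in the orbit category concern the components of morphisms and not
  their composition. Hence \<open>F\<close> is recorded by its object map and by its effect on
  vanishing.\<close>

locale orbit_construction = linear_category D
  for D :: "('k::field, 'o, 'a) lincat" (structure) and F :: "('o, 'a, 'o, 'a) cat_functor" +
  assumes bij_fob: "bij_betw (fob F) (Obj D) (Obj D)"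
    and hom_zero_fob: "X \<in> Obj D \<Longrightarrow> Y \<in> Obj D \<Longrightarrow> hom_zero D (fob F X) (fob F Y) \<longleftrightarrow> hom_zero D X Y"
begin

abbreviation pow :: "int \<Rightarrow> 'o \<Rightarrow> 'o" where
  "pow i \<equiv> fob (functor_pow D F i)"

lemma pow_0 [simp]: "pow 0 X = X"
  by (simp add: functor_pow_def)

lemma fob_obj: "X \<in> Obj D \<Longrightarrow> fob F X \<in> Obj D"
  using bij_fob bij_betwE by metis

lemma inv_fob_obj: "X \<in> Obj D \<Longrightarrow> inv_into (Obj D) (fob F) X \<in> Obj D"
  using bij_fob by (metis bij_betw_imp_surj_on inv_into_into)

lemma fob_inv_fob: "X \<in> Obj D \<Longrightarrow> fob F (inv_into (Obj D) (fob F) X) = X"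
  using bij_fob by (metis bij_betw_imp_surj_on f_inv_into_f)

lemma fob_inject: "X \<in> Obj D \<Longrightarrow> Y \<in> Obj D \<Longrightarrow> fob F X = fob F Y \<Longrightarrow> X = Y"
  using bij_fob by (auto simp: bij_betw_def inj_on_def)

lemma pow_obj: assumes "X \<in> Obj D" shows "pow i X \<in> Obj D"
proof -
  have "(fob F ^^ n) X \<in> Obj D" for n by (induction n) (use assms fob_obj in auto)
  moreover have "(inv_into (Obj D) (fob F) ^^ n) X \<in> Obj D" for n
    by (induction n) (use assms inv_fob_obj in auto)
  ultimately show ?thesis by (simp add: functor_pow_def functor_inv_def Let_def)
qed

lemma pow_Suc: assumes X: "X \<in> Obj D" shows "pow (i + 1) X = fob F (pow i X)"
proof (cases "0 \<le> i")
  case True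
  then have "nat \<bar>i + 1\<bar> = Suc (nat \<bar>i\<bar>)" by simp
  then show ?thesis using True by (simp add: functor_pow_def Let_def)
next
  case False
  let ?G = "inv_into (Obj D) (fob F)"
  define n where "n = nat (- i - 1)"
  \<comment> \<open>Negative exponents iterate the inverse. With \<open>i = - n - 1\<close>, one
    application of \<open>F\<close> cancels the outermost inverse and leaves \<open>n\<close> of
    them.\<close>
  have i: "i = - int n - 1" using False n_def by simp
  have "pow (i + 1) X = (?G ^^ n) X" using i by (simp add: functor_pow_def functor_inv_def)
  moreover have "nat \<bar>i\<bar> = Suc n" using i by simp
  then have "pow i X = ?G ((?G ^^ n) X)" using False by (simp add: functor_pow_def functor_inv_def)
  moreover have "(?G ^^ n) X \<in> Obj D" by (induction n) (use X inv_fob_obj in auto)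
  ultimately show ?thesis using fob_inv_fob by simp
qed

lemma pow_add: assumes X: "X \<in> Obj D" shows "pow (i + j) X = pow i (pow j X)"
proof (induction i rule: int_induct[where k = 0])
  case base
  show ?case by simp
next
  case (step1 i)
  have "pow (i + 1 + j) X = fob F (pow (i + j) X)" using pow_Suc[OF X, of "i + j"] by (simp add: algebra_simps)
  then show ?case using step1 pow_Suc[OF pow_obj[OF X], of i j] by simp
next
  case (step2 i)
  have "fob F (pow (i - 1 + j) X) = pow (i + j) X" using pow_Suc[OF X, of "i - 1 + j"] by (simp add: algebra_simps)
  also have "\<dots> = fob F (pow (i - 1) (pow j X))"
    using step2 pow_Suc[OF pow_obj[OF X], of "i - 1"] by simp
  finally show ?case using fob_inject pow_obj X by blast
qed

lemma hom_zero_pow: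
  assumes "X \<in> Obj D" "Y \<in> Obj D"
  shows "hom_zero D (pow i X) (pow i Y) \<longleftrightarrow> hom_zero D X Y"
proof (induction i rule: int_induct[where k = 0])
  case base
  show ?case by simp
next
  case (step1 i)
  then show ?case using hom_zero_fob pow_obj assms by (simp add: pow_Suc)
next
  case (step2 i)
  then show ?case
    using hom_zero_fob[OF pow_obj[OF assms(1)] pow_obj[OF assms(2)], of "i - 1" "i - 1"]
      pow_Suc[OF assms(1), of "i - 1"] pow_Suc[OF assms(2), of "i - 1"] by simp
qed

lemma hom_zero_pow_left:
  assumes "X \<in> Obj D" "Y \<in> Obj D"
  shows "hom_zero D (pow i X) Y \<longleftrightarrow> hom_zero D X (pow (- i) Y)"
  using hom_zero_pow[OF pow_obj[OF assms(1)] assms(2), of "- i" i] pow_add[OF assms(1), of "- i" i] by simp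

abbreviation C where "C \<equiv> orbit_category D F"

lemma orbit_Obj: "Obj C = orbit D F ` Obj D"
  by (simp add: orbit_category_def Let_def)

lemma orbit_Hom:
  "Hom C U V = {(U, \<phi>, V) | \<phi>. U \<in> Obj C \<and> V \<in> Obj C \<and>
     (\<forall>i. \<phi> i \<in> Hom D (pow i (orbit_rep U)) (orbit_rep V)) \<and>
     finite {i. \<phi> i \<noteq> Zer D (pow i (orbit_rep U)) (orbit_rep V)}}"
  by (simp add: orbit_category_def Let_def)

lemma orbit_Zer: "Zer C U V = (U, \<lambda>i. Zer D (pow i (orbit_rep U)) (orbit_rep V), V)"
  by (simp add: orbit_category_def Let_def)

lemma orbit_Add: "Add C (U, \<phi>, V) (U', \<psi>, V') = (U, \<lambda>i. \<phi> i \<oplus> \<psi> i, V)"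
  by (simp add: orbit_category_def Let_def)

lemma orbit_Scl: "Scl C a (U, \<phi>, V) = (U, \<lambda>i. a \<odot> \<phi> i, V)"
  by (simp add: orbit_category_def Let_def)

lemma orbit_rep_pow:
  assumes "X \<in> Obj D" obtains i where "orbit_rep (orbit D F X) = pow i X"
proof -
  have "X \<in> orbit D F X" unfolding orbit_def using pow_0 by (metis (mono_tags, lifting) mem_Collect_eq)
  then have "orbit_rep (orbit D F X) \<in> orbit D F X" unfolding orbit_rep_def by (rule someI)
  then show ?thesis using that unfolding orbit_def by blast
qed

lemma orbit_rep_obj:
  assumes "U \<in> Obj C" shows "orbit_rep U \<in> Obj D"
proof -
  obtain X where X: "X \<in> Obj D" "U = orbit D F X" using assms unfolding orbit_Obj by blast
  then show ?thesis using orbit_rep_pow[OF X(1)] pow_obj[OF X(1)] by metis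
qed

lemma orbit_pow: assumes "X \<in> Obj D" shows "orbit D F (pow i X) = orbit D F X"
proof -
  have "pow j (pow i X) = pow (j + i) X" "pow j X = pow (j - i) (pow i X)" for j
    using pow_add[OF assms, of j i] pow_add[OF assms, of "j - i" i] by simp_all
  then show ?thesis unfolding orbit_def by blast
qed

lemma orbit_orbit_rep:
  assumes "U \<in> Obj C" shows "orbit D F (orbit_rep U) = U"
proof -
  obtain X where X: "X \<in> Obj D" "U = orbit D F X" using assms unfolding orbit_Obj by blast
  obtain i where "orbit_rep U = pow i X" using orbit_rep_pow[OF X(1)] X(2) by blast
  then show ?thesis using orbit_pow[OF X(1)] X(2) by simp
qed

definition component :: "'o set \<Rightarrow> 'o set \<Rightarrow> int \<Rightarrow> 'a \<Rightarrow> 'o set \<times> (int \<Rightarrow> 'a) \<times> 'o set" where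
  "component U V i x = (U, (\<lambda>j. Zer D (pow j (orbit_rep U)) (orbit_rep V))(i := x), V)"

lemma component_hom:
  assumes "U \<in> Obj C" "V \<in> Obj C" "x \<in> Hom D (pow i (orbit_rep U)) (orbit_rep V)"
  shows "component U V i x \<in> Hom C U V"
proof -
  let ?\<phi> = "(\<lambda>j. Zer D (pow j (orbit_rep U)) (orbit_rep V))(i := x)"
  have "finite {j. ?\<phi> j \<noteq> Zer D (pow j (orbit_rep U)) (orbit_rep V)}"
    by (rule finite_subset[of _ "{i}"]) auto
  then show ?thesis
    unfolding orbit_Hom component_def using assms zer_hom[OF pow_obj] orbit_rep_obj by simp
qed

lemma orbit_hom_zero:
  assumes U: "U \<in> Obj C" and V: "V \<in> Obj C"
  shows "hom_zero C U V \<longleftrightarrow> (\<forall>i. hom_zero D (pow i (orbit_rep U)) (orbit_rep V))"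
proof
  assume z: "hom_zero C U V"
  show "\<forall>i. hom_zero D (pow i (orbit_rep U)) (orbit_rep V)"
  proof (intro allI hom_zeroI)
    fix i x assume "x \<in> Hom D (pow i (orbit_rep U)) (orbit_rep V)"
    then have "component U V i x = Zer C U V" using component_hom[OF U V] z unfolding hom_zero_def by blast
    then show "x = Zer D (pow i (orbit_rep U)) (orbit_rep V)"
      unfolding component_def orbit_Zer by (auto dest: fun_cong[of _ _ i])
  qed (use orbit_rep_obj[OF U] orbit_rep_obj[OF V] pow_obj in blast)+
next
  assume z: "\<forall>i. hom_zero D (pow i (orbit_rep U)) (orbit_rep V)"
  have "f = Zer C U V" if "f \<in> Hom C U V" for f
    using that z unfolding orbit_Hom orbit_Zer hom_zero_def by auto
  moreover have "Zer C U V \<in> Hom C U V"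
    unfolding orbit_Hom orbit_Zer using U V z zer_hom[OF pow_obj] orbit_rep_obj by simp
  ultimately show "hom_zero C U V" unfolding hom_zero_def by blast
qed

text \<open>The chosen representative of the orbit of \<open>Y\<close> is some
  \<open>pow c Y\<close>. Moving \<open>c\<close> to the other side shifts the exponent
  \<open>i\<close> to \<open>i - c\<close>, which the quantifier over all \<open>i\<close>
  absorbs.\<close>

lemma orbit_hom_zero_right:
  assumes U: "U \<in> Obj C" and Y: "Y \<in> Obj D"
  shows "hom_zero C U (orbit D F Y) \<longleftrightarrow> (\<forall>i. hom_zero D (pow i (orbit_rep U)) Y)"
proof -
  have V: "orbit D F Y \<in> Obj C" using Y unfolding orbit_Obj by blast
  obtain c where c: "orbit_rep (orbit D F Y) = pow c Y" using orbit_rep_pow[OF Y] .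
  note X = orbit_rep_obj[OF U]
  have e: "hom_zero D (pow i (orbit_rep U)) (pow c Y) \<longleftrightarrow> hom_zero D (pow (i - c) (orbit_rep U)) Y" for i
    using hom_zero_pow[OF pow_obj[OF X, of "i - c"] Y, of c] pow_add[OF X, of c "i - c"] by simp
  have "(\<forall>i. hom_zero D (pow i (orbit_rep U)) (pow c Y)) \<longleftrightarrow> (\<forall>i. hom_zero D (pow i (orbit_rep U)) Y)"
    unfolding e by (metis add_diff_cancel_right')
  then show ?thesis unfolding orbit_hom_zero[OF U V] c .
qed

text \<open>Finitely many degrees contribute, so the spanning sets of their components have a finite
  union. A subspace containing it is pulled back to each degree and found to be everything there;
  induction on the support then reaches all morphisms.\<close>

lemma orbit_finitely_spanned:
  assumes U: "U \<in> Obj C" and V: "V \<in> Obj C"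
    and fin: "finite {i. \<not> hom_zero D (pow i (orbit_rep U)) (orbit_rep V)}"
    and span: "\<And>i. finitely_spanned D (pow i (orbit_rep U)) (orbit_rep V)"
  shows "finitely_spanned C U V"
proof -
  let ?X = "\<lambda>i. pow i (orbit_rep U)" and ?Y = "orbit_rep V"
  let ?I = "{i. \<not> hom_zero D (?X i) ?Y}"
  have obj: "?X i \<in> Obj D" "?Y \<in> Obj D" for i using orbit_rep_obj[OF U] orbit_rep_obj[OF V] pow_obj by blast+
  obtain E where E: "\<And>i. E i \<subseteq> Hom D (?X i) ?Y" "\<And>i. finite (E i)"
    and W: "\<And>i W. hom_subspace D (?X i) ?Y W \<Longrightarrow> E i \<subseteq> W \<Longrightarrow> W = Hom D (?X i) ?Y"
    using span unfolding finitely_spanned_def by metis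
  define G where "G = (\<Union>i \<in> ?I. component U V i ` E i)"
  have comp_add: "component U V i (x \<oplus> y) = Add C (component U V i x) (component U V i y)"
    if "x \<in> Hom D (?X i) ?Y" "y \<in> Hom D (?X i) ?Y" for i x y
    unfolding component_def orbit_Add using zer_add[OF zer_hom[OF obj]] by auto
  have comp_scl: "component U V i (a \<odot> x) = Scl C a (component U V i x)" for i x a
    unfolding component_def orbit_Scl using scl_zer[OF obj] by auto
  have comp_zer: "component U V i (Zer D (?X i) ?Y) = Zer C U V" for i
    unfolding component_def orbit_Zer by auto
  have "W' = Hom C U V" if W': "hom_subspace C U V W'" "G \<subseteq> W'" for W'
  proof -
    have comp: "component U V i x \<in> W'" if x: "x \<in> Hom D (?X i) ?Y" for i x
    proof (cases "i \<in> ?I")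
      case True
      let ?W = "{x \<in> Hom D (?X i) ?Y. component U V i x \<in> W'}"
      have "hom_subspace D (?X i) ?Y ?W"
        using W'(1) comp_add comp_scl comp_zer zer_hom[OF obj] add_hom scl_hom
        unfolding hom_subspace_def by auto
      moreover have "E i \<subseteq> ?W" using W'(2) E(1) True unfolding G_def by blast
      ultimately have "?W = Hom D (?X i) ?Y" by (rule W)
      then show ?thesis using x by blast
    next
      case False
      then have "x = Zer D (?X i) ?Y" using x unfolding hom_zero_def by blast
      then show ?thesis using comp_zer W'(1) unfolding hom_subspace_def by simp
    qed
    have "(U, \<phi>, V) \<in> W'"
      if "finite K" "\<And>i. \<phi> i \<in> Hom D (?X i) ?Y" "{i. \<phi> i \<noteq> Zer D (?X i) ?Y} \<subseteq> K" for K \<phi>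
      using that
    proof (induction K arbitrary: \<phi>)
      case empty
      then have "(U, \<phi>, V) = Zer C U V" unfolding orbit_Zer by auto
      then show ?case using W'(1) unfolding hom_subspace_def by simp
    next
      case (insert k K)
      let ?\<psi> = "\<phi>(k := Zer D (?X k) ?Y)"
      have "(U, ?\<psi>, V) \<in> W'" by (rule insert.IH) (use insert.prems zer_hom[OF obj] in auto)
      moreover have "component U V k (\<phi> k) \<in> W'" using comp insert.prems(1) by blast
      moreover have "(U, \<phi>, V) = Add C (component U V k (\<phi> k)) (U, ?\<psi>, V)"
        unfolding component_def orbit_Add using zer_add[OF insert.prems(1)] add_zer[OF insert.prems(1)] by auto
      ultimately show ?case using W'(1) unfolding hom_subspace_def by auto
    qed
    then have "Hom C U V \<subseteq> W'" unfolding orbit_Hom by blast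
    then show ?thesis using W'(1) unfolding hom_subspace_def by blast
  qed
  moreover have "G \<subseteq> Hom C U V" unfolding G_def using component_hom[OF U V] E(1) by blast
  moreover have "finite G" unfolding G_def using fin E(2) by blast
  ultimately show ?thesis unfolding finitely_spanned_def by blast
qed

end


section \<open>Auslander-Reiten duality\<close>

locale AR_category = triangulated_category D S \<Delta>
  for D :: "('k::field, 'o, 'a) lincat" (structure) and S :: "('o, 'a, 'o, 'a) cat_functor"
    and \<Delta> :: "('a \<times> 'a \<times> 'a) set" +
  fixes \<tau> :: "('o, 'a, 'o, 'a) cat_functor"
  assumes AR: "AR_translation D S \<tau>"
begin

lemma tau_automorphism: "automorphism D \<tau>"
  using AR by (simp add: AR_translation_def)

lemma tau_obj: "X \<in> Obj D \<Longrightarrow> fob \<tau> X \<in> Obj D"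
  using tau_automorphism by (auto simp: automorphism_def linear_functor_def)

lemma bij_tau: "bij_betw (fob \<tau>) (Obj D) (Obj D)"
  and bij_shift: "bij_betw (fob S) (Obj D) (Obj D)"
  using tau_automorphism shift_automorphism by (auto simp: automorphism_def)

lemma shift_surj: assumes "Z \<in> Obj D" obtains Y where "Y \<in> Obj D" "Z = fob S Y"
  using bij_shift assms that unfolding bij_betw_def by blast

text \<open>One natural family is fixed by choice, so that bijectivity, linearity and naturality all
  speak about the same form.\<close>

definition AR_form :: "'o \<Rightarrow> 'o \<Rightarrow> 'a \<Rightarrow> 'a \<Rightarrow> 'k" ("\<Phi>") where
  "\<Phi> = (SOME \<Psi>.
       (\<forall>X \<in> Obj D. \<forall>Y \<in> Obj D.
          bij_betw (\<Psi> X Y) (Hom D X (fob S Y)) (hom_dual D Y (fob \<tau> X)) \<and>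
          (\<forall>f \<in> Hom D X (fob S Y). \<forall>g \<in> Hom D X (fob S Y). \<forall>\<eta> \<in> Hom D Y (fob \<tau> X). \<forall>a.
             \<Psi> X Y (f \<oplus> g) \<eta> = \<Psi> X Y f \<eta> + \<Psi> X Y g \<eta> \<and>
             \<Psi> X Y (a \<odot> f) \<eta> = a * \<Psi> X Y f \<eta>)) \<and>
       (\<forall>X X' Y Y'. \<forall>u \<in> Hom D X' X. \<forall>v \<in> Hom D Y Y'.
          \<forall>f \<in> Hom D X (fob S Y). \<forall>\<eta> \<in> Hom D Y' (fob \<tau> X').
             \<Psi> X' Y' (far S v \<cdot> f \<cdot> u) \<eta> = \<Psi> X Y f (far \<tau> u \<cdot> \<eta> \<cdot> v)))"

lemmas AR_form_spec = someI_ex[OF AR[unfolded AR_translation_def, THEN conjunct2], folded AR_form_def]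

lemma AR_bij: "X \<in> Obj D \<Longrightarrow> Y \<in> Obj D \<Longrightarrow> bij_betw (\<Phi> X Y) (Hom D X (fob S Y)) (hom_dual D Y (fob \<tau> X))"
  using AR_form_spec by blast

lemma AR_add: "f \<in> Hom D X (fob S Y) \<Longrightarrow> g \<in> Hom D X (fob S Y) \<Longrightarrow> \<eta> \<in> Hom D Y (fob \<tau> X)
    \<Longrightarrow> X \<in> Obj D \<Longrightarrow> Y \<in> Obj D \<Longrightarrow> \<Phi> X Y (f \<oplus> g) \<eta> = \<Phi> X Y f \<eta> + \<Phi> X Y g \<eta>"
  using AR_form_spec by blast

lemma AR_scl: "f \<in> Hom D X (fob S Y) \<Longrightarrow> \<eta> \<in> Hom D Y (fob \<tau> X)
    \<Longrightarrow> X \<in> Obj D \<Longrightarrow> Y \<in> Obj D \<Longrightarrow> \<Phi> X Y (a \<odot> f) \<eta> = a * \<Phi> X Y f \<eta>"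
  using AR_form_spec by blast

lemma AR_nat: "u \<in> Hom D X' X \<Longrightarrow> v \<in> Hom D Y Y' \<Longrightarrow> f \<in> Hom D X (fob S Y) \<Longrightarrow> \<eta> \<in> Hom D Y' (fob \<tau> X')
    \<Longrightarrow> \<Phi> X' Y' (far S v \<cdot> f \<cdot> u) \<eta> = \<Phi> X Y f (far \<tau> u \<cdot> \<eta> \<cdot> v)"
  using AR_form_spec by blast

lemma hom_dual_zer:
  assumes "\<xi> \<in> hom_dual D X Y" "X \<in> Obj D" "Y \<in> Obj D" shows "\<xi> (Zer D X Y) = 0"
proof -
  have "\<xi> (0 \<odot> Zer D X Y) = 0 * \<xi> (Zer D X Y)"
    using assms(1) zer_hom[OF assms(2,3)] unfolding hom_dual_def by blast
  then show ?thesis using zero_scl[OF zer_hom[OF assms(2,3)]] by simp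
qed

text \<open>From right to left, functionals on a zero space vanish and \<open>\<Phi>\<close> is
  injective. From left to right, a nonzero \<open>\<eta>\<close> must be detected by a functional:
  with \<open>\<tau> X = S Z\<close>, a second use of the formula pairs \<open>\<eta>\<close>
  nontrivially with some \<open>\<zeta>\<close>, and pairing with \<open>\<zeta>\<close> is a
  functional that \<open>\<Phi> X Y\<close> cannot represent.\<close>

lemma AR_hom_zero:
  assumes X: "X \<in> Obj D" and Y: "Y \<in> Obj D"
  shows "hom_zero D X (fob S Y) \<longleftrightarrow> hom_zero D Y (fob \<tau> X)"
proof -
  note bij = AR_bij and add = AR_add and scl = AR_scl
  have obj: "fob S Y \<in> Obj D" "fob \<tau> X \<in> Obj D" using X Y shift_obj tau_obj by blast+
  have ext: "f = g" if "f \<in> Hom D A (fob S B)" "g \<in> Hom D A (fob S B)" "A \<in> Obj D" "B \<in> Obj D"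
    "\<And>\<eta>. \<eta> \<in> Hom D B (fob \<tau> A) \<Longrightarrow> \<Phi> A B f \<eta> = \<Phi> A B g \<eta>" for A B f g
  proof -
    have "\<Phi> A B f \<in> hom_dual D B (fob \<tau> A)" "\<Phi> A B g \<in> hom_dual D B (fob \<tau> A)"
      using bij[OF that(3,4)] that(1,2) bij_betwE by blast+
    then have "\<Phi> A B f = \<Phi> A B g" using that(5) unfolding hom_dual_def by (auto intro: extensionalityI)
    then show ?thesis using bij[OF that(3,4)] that(1,2) unfolding bij_betw_def inj_on_def by blast
  qed
  have zer: "\<Phi> A B (Zer D A (fob S B)) \<eta> = 0" if "A \<in> Obj D" "B \<in> Obj D" "\<eta> \<in> Hom D B (fob \<tau> A)" for A B \<eta>
    using scl[OF zer_hom[OF that(1) shift_obj[OF that(2)]] that(3,1,2), of 0]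
      zero_scl[OF zer_hom[OF that(1) shift_obj[OF that(2)]]] by simp
  show ?thesis
  proof
    assume z: "hom_zero D X (fob S Y)"
    show "hom_zero D Y (fob \<tau> X)"
    proof (rule hom_zeroI[OF Y obj(2)], rule ccontr)
      fix \<eta> assume \<eta>: "\<eta> \<in> Hom D Y (fob \<tau> X)" "\<eta> \<noteq> Zer D Y (fob \<tau> X)"
      obtain Z where Z: "Z \<in> Obj D" "fob \<tau> X = fob S Z" using shift_surj[OF obj(2)] .
      obtain \<zeta> where \<zeta>: "\<zeta> \<in> Hom D Z (fob \<tau> Y)" "\<Phi> Y Z \<eta> \<zeta> \<noteq> \<Phi> Y Z (Zer D Y (fob S Z)) \<zeta>"
        using ext[of \<eta> Y Z "Zer D Y (fob S Z)"] \<eta> zer_hom[OF Y shift_obj[OF Z(1)]] Y Z by metis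
      have nz: "\<Phi> Y Z \<eta> \<zeta> \<noteq> 0" using \<zeta> zer[OF Y Z(1)] by simp
      let ?\<xi> = "restrict (\<lambda>\<eta>'. \<Phi> Y Z \<eta>' \<zeta>) (Hom D Y (fob \<tau> X))"
      let ?null = "restrict (\<lambda>\<eta>'. 0) (Hom D Y (fob \<tau> X))"
      have "?\<xi> \<in> hom_dual D Y (fob \<tau> X)"
        unfolding hom_dual_def using add[OF _ _ \<zeta>(1) Y Z(1)] scl[OF _ \<zeta>(1) Y Z(1)] add_hom scl_hom Z(2) by simp
      moreover have "?null \<in> hom_dual D Y (fob \<tau> X)"
        unfolding hom_dual_def using add_hom scl_hom by simp
      moreover have "\<xi> = \<Phi> X Y (Zer D X (fob S Y))" if "\<xi> \<in> hom_dual D Y (fob \<tau> X)" for \<xi>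
        using that bij[OF X Y] z unfolding hom_zero_def bij_betw_def by auto
      ultimately have "?\<xi> = ?null" by metis
      moreover have "?\<xi> \<eta> = \<Phi> Y Z \<eta> \<zeta>" "?null \<eta> = 0" using \<eta>(1) by simp_all
      ultimately show False using nz by metis
    qed
  next
    assume z: "hom_zero D Y (fob \<tau> X)"
    show "hom_zero D X (fob S Y)"
    proof (rule hom_zeroI[OF X obj(1)])
      fix f assume f: "f \<in> Hom D X (fob S Y)"
      show "f = Zer D X (fob S Y)"
      proof (rule ext[OF f zer_hom[OF X obj(1)] X Y])
        fix \<eta> assume \<eta>: "\<eta> \<in> Hom D Y (fob \<tau> X)"
        have "\<Phi> X Y f \<in> hom_dual D Y (fob \<tau> X)" using bij[OF X Y] f bij_betwE by blast
        then have "\<Phi> X Y f \<eta> = 0" using hom_dual_zer[OF _ Y obj(2)] hom_zeroD[OF z \<eta>] by simp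
        then show "\<Phi> X Y f \<eta> = \<Phi> X Y (Zer D X (fob S Y)) \<eta>" using zer[OF X Y \<eta>] by simp
      qed
    qed
  qed
qed

lemma hom_zero_tau: "X \<in> Obj D \<Longrightarrow> Y \<in> Obj D \<Longrightarrow> hom_zero D (fob \<tau> X) (fob \<tau> Y) \<longleftrightarrow> hom_zero D X Y"
  using automorphism_hom_zero[OF tau_automorphism] linear_category_axioms by blast

lemma serre_hom_zero:
  assumes "X \<in> Obj D" "Z \<in> Obj D"
  shows "hom_zero D X Z \<longleftrightarrow> hom_zero D Z (fob S (fob \<tau> X))"
proof -
  obtain Y where Y: "Y \<in> Obj D" "Z = fob S Y" using shift_surj[OF assms(2)] .
  show ?thesis
    using AR_hom_zero[OF assms(1) Y(1)] shift_hom_zero[OF Y(1) tau_obj[OF assms(1)]] Y(2) by simp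
qed

abbreviation F where "F \<equiv> cluster_functor D S \<tau>"

lemma fob_F: "fob F X = inv_into (Obj D) (fob \<tau>) (fob S X)"
  by (simp add: cluster_functor_def functor_comp_def functor_inv_def)

lemma F_obj: "X \<in> Obj D \<Longrightarrow> fob F X \<in> Obj D"
  unfolding fob_F using bij_tau shift_obj by (metis bij_betw_imp_surj_on inv_into_into)

lemma tau_F: "X \<in> Obj D \<Longrightarrow> fob \<tau> (fob F X) = fob S X"
  unfolding fob_F using bij_tau shift_obj by (metis bij_betw_imp_surj_on f_inv_into_f)

sublocale orbit: orbit_construction D F
proof
  have "bij_betw (inv_into (Obj D) (fob \<tau>)) (Obj D) (Obj D)" using bij_betw_inv_into[OF bij_tau] .
  then have "bij_betw (inv_into (Obj D) (fob \<tau>) \<circ> fob S) (Obj D) (Obj D)"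
    using bij_betw_trans[OF bij_shift] by blast
  moreover have "fob F = inv_into (Obj D) (fob \<tau>) \<circ> fob S" using fob_F by auto
  ultimately show "bij_betw (fob F) (Obj D) (Obj D)" by simp
  \<comment> \<open>\<open>\<tau> (F X) = S X\<close>, so applying \<open>\<tau>\<close> reduces the
    claim to the shift.\<close>
  show "hom_zero D (fob F X) (fob F Y) \<longleftrightarrow> hom_zero D X Y" if "X \<in> Obj D" "Y \<in> Obj D" for X Y
    using hom_zero_tau[OF F_obj[OF that(1)] F_obj[OF that(2)]] tau_F that shift_hom_zero by simp
qed

text \<open>Both sides are equivalent to vanishing of \<open>Hom B Z\<close>: the left one by a
  shift and Serre duality at \<open>S B\<close>, the right one by Serre duality at
  \<open>B\<close>.\<close>

lemma hom_zero_shift_tau: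
  assumes Z: "Z \<in> Obj D" and B: "B \<in> Obj D"
  shows "hom_zero D Z (fob \<tau> (fob S B)) \<longleftrightarrow> hom_zero D Z (fob S (fob \<tau> B))"
proof -
  have obj: "fob S Z \<in> Obj D" "fob S B \<in> Obj D" "fob \<tau> B \<in> Obj D" "fob \<tau> (fob S B) \<in> Obj D"
    "fob S (fob \<tau> B) \<in> Obj D"
    using Z B shift_obj tau_obj by blast+
  have "hom_zero D Z (fob \<tau> (fob S B)) \<longleftrightarrow> hom_zero D (fob S Z) (fob S (fob \<tau> (fob S B)))"
    using shift_hom_zero[OF Z obj(4)] by simp
  also have "\<dots> \<longleftrightarrow> hom_zero D (fob S B) (fob S Z)" using serre_hom_zero[OF obj(2,1)] by simp
  also have "\<dots> \<longleftrightarrow> hom_zero D B Z" using shift_hom_zero[OF B Z] .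
  also have "\<dots> \<longleftrightarrow> hom_zero D Z (fob S (fob \<tau> B))" using serre_hom_zero[OF B Z] .
  finally show ?thesis .
qed

lemma hom_zero_shift_F:
  assumes Z: "Z \<in> Obj D" and A: "A \<in> Obj D"
  shows "hom_zero D Z (fob S (fob F A)) \<longleftrightarrow> hom_zero D Z (fob F (fob S A))"
proof -
  have obj: "fob \<tau> Z \<in> Obj D" "fob F A \<in> Obj D" "fob S A \<in> Obj D" "fob S (fob F A) \<in> Obj D" "fob F (fob S A) \<in> Obj D"
    using Z A shift_obj tau_obj F_obj by blast+
  have "hom_zero D Z (fob S (fob F A)) \<longleftrightarrow> hom_zero D (fob \<tau> Z) (fob \<tau> (fob S (fob F A)))"
    using hom_zero_tau[OF Z obj(4)] by simp
  also have "\<dots> \<longleftrightarrow> hom_zero D (fob \<tau> Z) (fob \<tau> (fob F (fob S A)))"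
    using hom_zero_shift_tau[OF obj(1,2)] tau_F[OF A] tau_F[OF obj(3)] by simp
  also have "\<dots> \<longleftrightarrow> hom_zero D Z (fob F (fob S A))" using hom_zero_tau[OF Z obj(5)] .
  finally show ?thesis .
qed

lemma hom_zero_shift_pow:
  assumes A: "A \<in> Obj D"
  shows "Z \<in> Obj D \<Longrightarrow> hom_zero D Z (fob S (orbit.pow i A)) \<longleftrightarrow> hom_zero D Z (orbit.pow i (fob S A))"
proof (induction i arbitrary: Z rule: int_induct[where k = 0])
  case base
  show ?case by simp
next
  case (step1 i)
  \<comment> \<open>With \<open>Z = F Z'\<close> one factor \<open>F\<close> cancels on both sides,
    and the induction hypothesis is applied at \<open>Z'\<close>. This is why \<open>Z\<close>
    varies in the induction.\<close>
  obtain Z' where Z': "Z' \<in> Obj D" "Z = fob F Z'"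
    using orbit.fob_inv_fob[OF step1.prems] orbit.inv_fob_obj[OF step1.prems] by metis
  note obj = orbit.pow_obj[OF A] orbit.pow_obj[OF shift_obj[OF A]]
  show ?case
    using hom_zero_shift_F[OF step1.prems obj(1)[of i]] orbit.hom_zero_fob[OF Z'(1) shift_obj[OF obj(1)[of i]]]
      orbit.hom_zero_fob[OF Z'(1) obj(2)[of i]] step1.IH[OF Z'(1)] Z'(2) orbit.pow_Suc A shift_obj[OF A] by simp
next
  case (step2 i)
  note obj = orbit.pow_obj[OF A] orbit.pow_obj[OF shift_obj[OF A]]
  have FZ: "fob F Z \<in> Obj D" using F_obj step2.prems by blast
  have "orbit.pow i A = fob F (orbit.pow (i - 1) A)" "orbit.pow i (fob S A) = fob F (orbit.pow (i - 1) (fob S A))"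
    using orbit.pow_Suc[OF A, of "i - 1"] orbit.pow_Suc[OF shift_obj[OF A], of "i - 1"] by simp_all
  then show ?case
    using step2.IH[OF FZ] hom_zero_shift_F[OF FZ obj(1)[of "i - 1"]]
      orbit.hom_zero_fob[OF step2.prems shift_obj[OF obj(1)[of "i - 1"]]]
      orbit.hom_zero_fob[OF step2.prems obj(2)[of "i - 1"]] by simp
qed

text \<open>Since \<open>\<tau> F = S\<close>, the Serre functor sends \<open>F^i X\<close> to the
  double shift of \<open>F^(i - 1) X\<close>. Moving \<open>F^(i - 1)\<close> to the other side
  gives the exponent \<open>1 - i\<close>.\<close>

lemma serre_pow:
  assumes X: "X \<in> Obj D" and Y: "Y \<in> Obj D"
  shows "hom_zero D (orbit.pow i X) (fob S Y) \<longleftrightarrow> hom_zero D (orbit.pow (1 - i) Y) (fob S X)"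
proof -
  let ?A = "orbit.pow (i - 1) X"
  have A: "?A \<in> Obj D" "fob S ?A \<in> Obj D" using orbit.pow_obj[OF X] shift_obj by blast+
  have "orbit.pow i X = fob F ?A" using orbit.pow_Suc[OF X, of "i - 1"] by simp
  then have "fob \<tau> (orbit.pow i X) = fob S ?A" using tau_F[OF A(1)] by simp
  then have "hom_zero D (orbit.pow i X) (fob S Y) \<longleftrightarrow> hom_zero D (fob S Y) (fob S (fob S ?A))"
    using serre_hom_zero[OF orbit.pow_obj[OF X] shift_obj[OF Y], of i] by simp
  also have "\<dots> \<longleftrightarrow> hom_zero D Y (fob S ?A)" using shift_hom_zero[OF Y A(2)] .
  also have "\<dots> \<longleftrightarrow> hom_zero D Y (orbit.pow (i - 1) (fob S X))" using hom_zero_shift_pow[OF X Y] .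
  also have "\<dots> \<longleftrightarrow> hom_zero D (orbit.pow (1 - i) Y) (fob S X)"
    using orbit.hom_zero_pow_left[OF Y shift_obj[OF X], of "1 - i"] by simp
  finally show ?thesis .
qed

end

section \<open>Finite-dimensionality from a perfect pairing\<close>

abbreviation fun_scale :: "'k::field \<Rightarrow> ('b \<Rightarrow> 'k) \<Rightarrow> 'b \<Rightarrow> 'k" where
  "fun_scale \<equiv> \<lambda>c f x. c * f x"

lemma vector_space_fun: "vector_space (fun_scale :: 'k::field \<Rightarrow> ('b \<Rightarrow> 'k) \<Rightarrow> 'b \<Rightarrow> 'k)"
  by unfold_locales (auto simp: fun_eq_iff algebra_simps)

lemma vector_space_field: "vector_space ((*) :: 'k::field \<Rightarrow> 'k \<Rightarrow> 'k)"
  by unfold_locales (auto simp: algebra_simps)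

text \<open>If the dual basis of an infinite basis of \<open>A\<close> were taken in \<open>B\<close>, its span would not contain the functional
  with all coordinates \<open>1\<close>, so some element of \<open>A\<close> would annihilate the dual basis but not this functional.\<close>

lemma perfect_pairing_finite:
  fixes p :: "'a \<Rightarrow> 'b \<Rightarrow> 'k::field"
  defines "left \<equiv> \<lambda>A B a b. if b \<in> B then p a b else 0"
    and "right \<equiv> \<lambda>A B b a. if a \<in> A then p a b else 0"
  assumes sub: "module.subspace fun_scale (left A B ` A)"
    and left_rep: "\<And>l. Vector_Spaces.linear fun_scale (*) l \<Longrightarrow> \<exists>a \<in> A. \<forall>b \<in> B. l (right A B b) = p a b"
    and right_rep: "\<And>l. Vector_Spaces.linear fun_scale (*) l \<Longrightarrow> \<exists>b \<in> B. \<forall>a \<in> A. l (left A B a) = p a b"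
  shows "\<exists>E \<subseteq> left A B ` A. finite E \<and> left A B ` A \<subseteq> module.span fun_scale E"
proof -
  interpret L: vector_space "fun_scale :: 'k \<Rightarrow> ('b \<Rightarrow> 'k) \<Rightarrow> 'b \<Rightarrow> 'k" by (rule vector_space_fun)
  interpret R: vector_space "fun_scale :: 'k \<Rightarrow> ('a \<Rightarrow> 'k) \<Rightarrow> 'a \<Rightarrow> 'k" by (rule vector_space_fun)
  interpret K: vector_space "(*) :: 'k \<Rightarrow> 'k \<Rightarrow> 'k" by (rule vector_space_field)
  interpret LK: vector_space_pair "fun_scale :: 'k \<Rightarrow> ('b \<Rightarrow> 'k) \<Rightarrow> 'b \<Rightarrow> 'k" "(*) :: 'k \<Rightarrow> 'k \<Rightarrow> 'k" ..
  interpret RK: vector_space_pair "fun_scale :: 'k \<Rightarrow> ('a \<Rightarrow> 'k) \<Rightarrow> 'a \<Rightarrow> 'k" "(*) :: 'k \<Rightarrow> 'k \<Rightarrow> 'k" ..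
  \<comment> \<open>Elements of \<open>A\<close> and \<open>B\<close> become functions extended by
    zero outside the other carrier, so that linear algebra takes place in full function
    spaces.\<close>
  let ?l = "left A B" and ?r = "right A B"
  obtain E where E: "E \<subseteq> ?l ` A" "L.independent E" "?l ` A \<subseteq> L.span E"
    using L.maximal_independent_subset[of "?l ` A"] by blast
  have "finite E"
  proof (rule ccontr)
    assume inf: "infinite E"
    \<comment> \<open>These are the coordinate functionals \<open>c v\<close> of the basis
      \<open>E\<close>; \<open>s\<close> is the functional with all coordinates 1. Elements
      \<open>b v\<close> and \<open>b1\<close> of \<open>B\<close> will represent them.\<close>
    have "\<exists>g. Vector_Spaces.linear fun_scale (*) g \<and> (\<forall>w \<in> E. g w = (if w = v then 1 else 0))" for v
      using LK.linear_independent_extend[OF E(2), of "\<lambda>w. if w = v then 1 else 0"] by blast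
    then obtain c where c: "\<And>v. Vector_Spaces.linear fun_scale (*) (c v)"
      "\<And>v w. w \<in> E \<Longrightarrow> c v w = (if w = v then 1 else 0)" by metis
    obtain s where s: "Vector_Spaces.linear fun_scale (*) s" "\<And>w. w \<in> E \<Longrightarrow> s w = 1"
      using LK.linear_independent_extend[OF E(2), of "\<lambda>w. 1"] by blast
    have "\<exists>b. b \<in> B \<and> (\<forall>a \<in> A. c v (?l a) = p a b)" for v using right_rep[OF c(1)] by blast
    then obtain b where b: "\<And>v. b v \<in> B" "\<And>v a. a \<in> A \<Longrightarrow> c v (?l a) = p a (b v)" by metis
    obtain b1 where b1: "b1 \<in> B" "\<And>a. a \<in> A \<Longrightarrow> s (?l a) = p a b1" using right_rep[OF s(1)] by blast
    have "\<exists>a. v \<in> E \<longrightarrow> a \<in> A \<and> ?l a = v" for v using E(1) by blast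
    then obtain a where a: "\<And>v. v \<in> E \<Longrightarrow> a v \<in> A" "\<And>v. v \<in> E \<Longrightarrow> ?l (a v) = v" by metis
    let ?G = "(\<lambda>v. ?r (b v)) ` E"
    \<comment> \<open>An element of the span of the dual basis is nonzero at only finitely many
      basis vectors, whereas \<open>?r b1\<close> is 1 at all of them.\<close>
    have fin: "finite {v \<in> E. k (a v) \<noteq> 0}" if "k \<in> R.span ?G" for k
      using that
    proof (induction rule: R.span_induct)
      case base
      show ?case
        unfolding R.subspace_def
      proof (safe, goal_cases)
        case (2 x y)
        have "{v \<in> E. (x + y) (a v) \<noteq> 0} \<subseteq> {v \<in> E. x (a v) \<noteq> 0} \<union> {v \<in> E. y (a v) \<noteq> 0}" by auto
        then show ?case using 2 finite_subset by blast
      next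
        case (3 q x)
        have "{v \<in> E. q * x (a v) \<noteq> 0} \<subseteq> {v \<in> E. x (a v) \<noteq> 0}" by auto
        then show ?case using 3 finite_subset by blast
      qed simp
    next
      case (step k)
      then obtain w where w: "w \<in> E" "k = ?r (b w)" by blast
      have "k (a v) = (if v = w then 1 else 0)" if "v \<in> E" for v
        using b(2)[OF a(1)[OF that], of w] a[OF that] c(2)[OF that] w by (simp add: right_def)
      then have "{v \<in> E. k (a v) \<noteq> 0} \<subseteq> {w}" by (auto split: if_splits)
      then show ?case using finite_subset by blast
    qed
    have one: "?r b1 (a v) = 1" if "v \<in> E" for v
      using b1(2)[OF a(1)[OF that]] a[OF that] s(2)[OF that] by (simp add: right_def)
    have "{v \<in> E. ?r b1 (a v) \<noteq> 0} = E" using one by auto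
    then have notin: "?r b1 \<notin> R.span ?G" using fin[of "?r b1"] inf by auto
    \<comment> \<open>An independent set with the same span is extracted in order to define
      \<open>m\<close>, which vanishes on the dual basis and is 1 at \<open>?r b1\<close>.\<close>
    obtain H where H: "H \<subseteq> ?G" "R.independent H" "?G \<subseteq> R.span H"
      using R.maximal_independent_subset[of ?G] by blast
    have "?r b1 \<notin> R.span H" using notin R.span_mono[OF H(1)] by blast
    then have "R.independent (insert (?r b1) H)" using H(2) R.independent_insert by simp
    then obtain m where m: "Vector_Spaces.linear fun_scale (*) m"
      "\<And>x. x \<in> insert (?r b1) H \<Longrightarrow> m x = (if x = ?r b1 then 1 else 0)"
      using RK.linear_independent_extend[of _ "\<lambda>x. if x = ?r b1 then 1 else 0"] by blast
    interpret m: Vector_Spaces.linear "fun_scale :: 'k \<Rightarrow> ('a \<Rightarrow> 'k) \<Rightarrow> 'a \<Rightarrow> 'k" "(*)" m by (rule m(1))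
    have "m x = 0" if "x \<in> H" for x
    proof -
      have "x \<noteq> ?r b1" using that R.span_base[of x H] \<open>?r b1 \<notin> R.span H\<close> by blast
      then show ?thesis using m(2) that by simp
    qed
    then have m0: "m x = 0" if "x \<in> R.span H" for x
      using RK.linear_eq_0_on_span[OF m(1) _ that] by blast
    obtain a0 where a0: "a0 \<in> A" "\<And>b. b \<in> B \<Longrightarrow> m (?r b) = p a0 b" using left_rep[OF m(1)] by blast
    \<comment> \<open>All coordinates of the element \<open>a0\<close> that represents
      \<open>m\<close> vanish, so \<open>?l a0 = 0\<close>; but
      \<open>p a0 b1 = m (?r b1) = 1\<close>.\<close>
    have z: "c v (?l a0) = 0" if "v \<in> E" for v
    proof -
      have "?r (b v) \<in> R.span H" using H(3) that by blast
      then show ?thesis using b(2)[OF a0(1), of v] a0(2)[OF b(1)] m0 by metis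
    qed
    have "?l a0 \<in> L.span E" using E(3) a0(1) by blast
    then obtain t q where t: "finite t" "t \<subseteq> E" "?l a0 = (\<Sum>v\<in>t. fun_scale (q v) v)"
      unfolding L.span_explicit by blast
    have "q v = 0" if v: "v \<in> t" for v
    proof -
      interpret c: Vector_Spaces.linear "fun_scale :: 'k \<Rightarrow> ('b \<Rightarrow> 'k) \<Rightarrow> 'b \<Rightarrow> 'k" "(*)" "c v" by (rule c(1))
      have "c v (?l a0) = (\<Sum>w\<in>t. q w * c v w)" unfolding t(3) c.sum by (simp add: c.scale)
      also have "\<dots> = (\<Sum>w\<in>t. if w = v then q w else 0)" using c(2) t(2) by (intro sum.cong) auto
      also have "\<dots> = q v" using t(1) v by simp
      finally show ?thesis using z t(2) v by auto
    qed
    then have "?l a0 = 0" unfolding t(3) by (intro sum.neutral) (auto simp: fun_eq_iff)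
    then have "p a0 b1 = 0" using b1(1) unfolding left_def by (auto dest: fun_cong[of _ _ b1])
    moreover have "m (?r b1) = 1" using m(2) by simp
    ultimately show False using a0(2)[OF b1(1)] by simp
  qed
  then show ?thesis using E by blast
qed

context AR_category
begin

text \<open>Bijectivity of \<open>\<Phi> X Y\<close> represents the functionals on
  \<open>Hom Y (\<tau> X)\<close>. Those on \<open>Hom X (S Y)\<close> are represented by a second
  instance of the formula, at \<open>S Y\<close> and \<open>\<tau> X\<close>, once they are
  transported along \<open>\<tau>\<close>; \<open>pairing\<close> shows that both instances describe
  the same form.\<close>

lemma hom_finitely_spanned:
  assumes X: "X \<in> Obj D" and Z: "Z \<in> Obj D"
  shows "finitely_spanned D X Z"
proof -
  obtain Y where Y: "Y \<in> Obj D" and ZY: "Z = fob S Y" using shift_surj[OF Z] .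
  note bij = AR_bij and add = AR_add and scl = AR_scl and nat = AR_nat
  let ?A = "Hom D X (fob S Y)" and ?B = "Hom D Y (fob \<tau> X)"
  let ?p = "\<Phi> X Y"
  let ?l = "\<lambda>a b. if b \<in> ?B then ?p a b else 0"
  let ?r = "\<lambda>b a. if a \<in> ?A then ?p a b else 0"
  have obj: "fob S Y \<in> Obj D" "fob \<tau> X \<in> Obj D" "fob \<tau> (fob S Y) \<in> Obj D" "fob S (fob \<tau> X) \<in> Obj D"
    using X Y shift_obj tau_obj by blast+
  note bijA = bij[OF X Y]
  have dual: "?p f \<in> hom_dual D Y (fob \<tau> X)" if "f \<in> ?A" for f using bijA that bij_betwE by blast
  have inj: "f = g" if "f \<in> ?A" "g \<in> ?A" "\<And>\<eta>. \<eta> \<in> ?B \<Longrightarrow> ?p f \<eta> = ?p g \<eta>" for f g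
  proof -
    have "?p f = ?p g"
      by (rule extensionalityI[of _ ?B]) (use dual[OF that(1)] dual[OF that(2)] that(3) in \<open>auto simp: hom_dual_def\<close>)
    then show ?thesis using bijA that(1,2) unfolding bij_betw_def inj_on_def by blast
  qed
  have l_add: "?l (f \<oplus> g) = ?l f + ?l g" if "f \<in> ?A" "g \<in> ?A" for f g
    using add[OF that _ X Y] by (auto simp: fun_eq_iff)
  have l_scl: "?l (c \<odot> f) = fun_scale c (?l f)" if "f \<in> ?A" for f c
    using scl[OF that _ X Y] by (auto simp: fun_eq_iff)
  have l_zer: "?l (Zer D X (fob S Y)) = 0"
    using l_scl[OF zer_hom[OF X obj(1)], of 0] unfolding zero_scl[OF zer_hom[OF X obj(1)]]
    by (simp add: zero_fun_def)
  have r_add: "?r (\<eta> \<oplus> \<zeta>) = ?r \<eta> + ?r \<zeta>" if "\<eta> \<in> ?B" "\<zeta> \<in> ?B" for \<eta> \<zeta>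
    using dual that unfolding hom_dual_def by (auto simp: fun_eq_iff)
  have r_scl: "?r (c \<odot> \<eta>) = fun_scale c (?r \<eta>)" if "\<eta> \<in> ?B" for \<eta> c
    using dual that unfolding hom_dual_def by (auto simp: fun_eq_iff)
  interpret L: vector_space "fun_scale :: 'k \<Rightarrow> ('a \<Rightarrow> 'k) \<Rightarrow> 'a \<Rightarrow> 'k" by (rule vector_space_fun)
  have sub: "L.subspace (?l ` W)" if W: "hom_subspace D X (fob S Y) W" for W
  proof -
    have W': "W \<subseteq> ?A" "Zer D X (fob S Y) \<in> W" "\<And>f g. f \<in> W \<Longrightarrow> g \<in> W \<Longrightarrow> f \<oplus> g \<in> W"
      "\<And>a f. f \<in> W \<Longrightarrow> a \<odot> f \<in> W" using W unfolding hom_subspace_def by blast+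
    show ?thesis
    proof (rule L.subspaceI)
      show "0 \<in> ?l ` W" using l_zer[symmetric] W'(2) by (rule image_eqI[where f = ?l])
      fix x y assume "x \<in> ?l ` W" "y \<in> ?l ` W"
      then obtain f g where fg: "f \<in> W" "g \<in> W" "x = ?l f" "y = ?l g" by blast
      have "f \<in> ?A" "g \<in> ?A" using fg(1,2) W'(1) by blast+
      then have "x + y = ?l (f \<oplus> g)" unfolding fg(3,4) by (rule l_add[symmetric])
      then show "x + y \<in> ?l ` W" using W'(3)[OF fg(1,2)] by (rule image_eqI[where f = ?l])
    next
      fix c x assume "x \<in> ?l ` W"
      then obtain f where f: "f \<in> W" "x = ?l f" by blast
      have "f \<in> ?A" using f(1) W'(1) by blast
      then have "fun_scale c x = ?l (c \<odot> f)" unfolding f(2) by (rule l_scl[symmetric])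
      then show "fun_scale c x \<in> ?l ` W" using W'(4)[OF f(1)] by (rule image_eqI[where f = ?l])
    qed
  qed
  have subA: "hom_subspace D X (fob S Y) ?A"
    unfolding hom_subspace_def using zer_hom[OF X obj(1)] add_hom scl_hom by blast
  have left_rep: "\<exists>a \<in> ?A. \<forall>b \<in> ?B. l (?r b) = ?p a b" if l: "Vector_Spaces.linear fun_scale (*) l" for l
  proof -
    interpret l: Vector_Spaces.linear "fun_scale :: 'k \<Rightarrow> ('a \<Rightarrow> 'k) \<Rightarrow> 'a \<Rightarrow> 'k" "(*)" l by (rule l)
    let ?\<xi> = "restrict (\<lambda>b. l (?r b)) ?B"
    have d: "?\<xi> \<in> hom_dual D Y (fob \<tau> X)"
      unfolding hom_dual_def
      using r_add r_scl l.add l.scale add_hom scl_hom by simp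
    have "?\<xi> \<in> ?p ` ?A" using d bij_betw_imp_surj_on[OF bijA] by argo
    then obtain a where a: "?\<xi> = ?p a" "a \<in> ?A" by (rule imageE)
    have "l (?r b) = ?p a b" if "b \<in> ?B" for b
      unfolding a(1)[symmetric] restrict_apply'[OF that] ..
    then show ?thesis using a(2) by blast
  qed
  \<comment> \<open>By naturality both sides equal the value at \<open>\<tau> f \<cdot> \<eta>\<close> of the functional belonging to \<open>Idn (S Y)\<close>.\<close>
  have pairing: "\<Phi> (fob S Y) (fob \<tau> X) (far S \<eta>) (far \<tau> f) = ?p f \<eta>" if f: "f \<in> ?A" and \<eta>: "\<eta> \<in> ?B" for f \<eta>
  proof -
    note I = idn_hom[OF obj(1)]
    have tf: "far \<tau> f \<in> Hom D (fob \<tau> X) (fob \<tau> (fob S Y))"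
      using f tau_automorphism unfolding automorphism_def linear_functor_def by blast
    have te: "far \<tau> f \<cdot> \<eta> \<in> Hom D Y (fob \<tau> (fob S Y))" using cmp_hom[OF \<eta> tf] .
    have t1: "far \<tau> (Idn D (fob S Y)) = Idn D (fob \<tau> (fob S Y))"
      using obj(1) tau_automorphism unfolding automorphism_def linear_functor_def by blast
    have "?p f \<eta> = \<Phi> X Y (far S (Idn D Y) \<cdot> Idn D (fob S Y) \<cdot> f) \<eta>"
      using shift_idn[OF Y] idn_cmp[OF I] idn_cmp[OF f] by simp
    also have "\<dots> = \<Phi> (fob S Y) Y (Idn D (fob S Y)) (far \<tau> f \<cdot> \<eta> \<cdot> Idn D Y)"
      using nat[OF f idn_hom[OF Y] I \<eta>] .
    also have "\<dots> = \<Phi> (fob S Y) Y (Idn D (fob S Y)) (far \<tau> (Idn D (fob S Y)) \<cdot> far \<tau> f \<cdot> \<eta>)"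
      using cmp_idn[OF te] t1 idn_cmp[OF tf] by simp
    also have "\<dots> = \<Phi> (fob S Y) (fob \<tau> X) (far S \<eta> \<cdot> Idn D (fob S Y) \<cdot> Idn D (fob S Y)) (far \<tau> f)"
      using nat[OF I \<eta> I tf] by simp
    also have "\<dots> = \<Phi> (fob S Y) (fob \<tau> X) (far S \<eta>) (far \<tau> f)"
      using cmp_idn[OF shift_hom[OF \<eta>]] by simp
    finally show ?thesis by simp
  qed
  have right_rep: "\<exists>b \<in> ?B. \<forall>a \<in> ?A. l (?l a) = ?p a b" if l: "Vector_Spaces.linear fun_scale (*) l" for l
  proof -
    interpret l: Vector_Spaces.linear "fun_scale :: 'k \<Rightarrow> ('a \<Rightarrow> 'k) \<Rightarrow> 'a \<Rightarrow> 'k" "(*)" l by (rule l)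
    let ?T = "Hom D (fob \<tau> X) (fob \<tau> (fob S Y))"
    have tau_bij: "bij_betw (far \<tau>) ?A ?T" using tau_automorphism X obj(1) unfolding automorphism_def by blast
    have tau_add: "\<And>f g. f \<in> ?A \<Longrightarrow> g \<in> ?A \<Longrightarrow> far \<tau> (f \<oplus> g) = far \<tau> f \<oplus> far \<tau> g"
      and tau_scl: "\<And>f c. f \<in> ?A \<Longrightarrow> far \<tau> (c \<odot> f) = c \<odot> far \<tau> f"
      using tau_automorphism unfolding automorphism_def linear_functor_def by blast+
    \<comment> \<open>Precomposing with the inverse of \<open>far \<tau>\<close> turns
      \<open>l\<close> into a functional on \<open>Hom (\<tau> X) (\<tau> (S Y))\<close>. The
      formula represents it by some \<open>\<theta>\<close>, which desuspends to the wanted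
      \<open>\<eta>\<close>.\<close>
    define i where "i = inv_into ?A (far \<tau>)"
    have i: "i (far \<tau> f) = f" if "f \<in> ?A" for f
      unfolding i_def using inv_into_f_f tau_bij that unfolding bij_betw_def by metis
    have surj: "\<exists>f \<in> ?A. y = far \<tau> f" if "y \<in> ?T" for y using tau_bij that unfolding bij_betw_def by blast
    let ?\<xi> = "restrict (\<lambda>y. l (?l (i y))) ?T"
    have d: "?\<xi> \<in> hom_dual D (fob \<tau> X) (fob \<tau> (fob S Y))"
      unfolding hom_dual_def
    proof (intro CollectI conjI ballI allI)
      fix x y assume xy: "x \<in> ?T" "y \<in> ?T"
      then obtain f g where fg: "f \<in> ?A" "g \<in> ?A" "x = far \<tau> f" "y = far \<tau> g" using surj by metis
      have ixy: "i (x \<oplus> y) = f \<oplus> g" "i x = f" "i y = g" using fg tau_add i add_hom[OF fg(1,2)] by metis+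
      show "?\<xi> (x \<oplus> y) = ?\<xi> x + ?\<xi> y"
        unfolding restrict_apply'[OF xy(1)] restrict_apply'[OF xy(2)] restrict_apply'[OF add_hom[OF xy]] ixy
          l_add[OF fg(1,2)] by (rule l.add)
    next
      fix c x assume x: "x \<in> ?T"
      then obtain f where f: "f \<in> ?A" "x = far \<tau> f" using surj by metis
      have icx: "i (c \<odot> x) = c \<odot> f" "i x = f" using f tau_scl i scl_hom[OF f(1)] by metis+
      show "?\<xi> (c \<odot> x) = c * ?\<xi> x"
        unfolding restrict_apply'[OF x] restrict_apply'[OF scl_hom[OF x]] icx l_scl[OF f(1)] by (rule l.scale)
    qed simp
    have "?\<xi> \<in> \<Phi> (fob S Y) (fob \<tau> X) ` Hom D (fob S Y) (fob S (fob \<tau> X))"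
      using d bij_betw_imp_surj_on[OF bij[OF obj(1,2)]] by argo
    then obtain \<theta> where \<theta>: "?\<xi> = \<Phi> (fob S Y) (fob \<tau> X) \<theta>" "\<theta> \<in> Hom D (fob S Y) (fob S (fob \<tau> X))"
      by (rule imageE)
    obtain \<eta> where \<eta>: "\<eta> \<in> ?B" "\<theta> = far S \<eta>" using shift_full[OF \<theta>(2) Y obj(2)] .
    have "l (?l f) = ?p f \<eta>" if f: "f \<in> ?A" for f
    proof -
      have T: "far \<tau> f \<in> ?T" using f tau_bij bij_betwE by blast
      have "l (?l f) = ?\<xi> (far \<tau> f)" unfolding restrict_apply'[OF T] i[OF f] ..
      also have "\<dots> = ?p f \<eta>" unfolding \<theta>(1) \<eta>(2) by (rule pairing[OF f \<eta>(1)])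
      finally show ?thesis .
    qed
    then show ?thesis using \<eta>(1) by blast
  qed
  have "\<exists>E \<subseteq> ?l ` ?A. finite E \<and> ?l ` ?A \<subseteq> L.span E"
    by (rule perfect_pairing_finite[OF sub[OF subA] left_rep right_rep])
  then obtain E where E: "E \<subseteq> ?l ` ?A" "finite E" "?l ` ?A \<subseteq> L.span E" by blast
  obtain E' where E': "E' \<subseteq> ?A" "finite E'" "E = ?l ` E'" using finite_subset_image[OF E(2,1)] by blast
  have "W = ?A" if W: "hom_subspace D X (fob S Y) W" "E' \<subseteq> W" for W
  proof
    show WA: "W \<subseteq> ?A" using W(1) unfolding hom_subspace_def by blast
    \<comment> \<open>The image of \<open>W\<close> under \<open>?l\<close> contains the span of
      \<open>E\<close>, hence the image of \<open>?A\<close>; injectivity of \<open>?l\<close> on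
      \<open>?A\<close> brings this back to \<open>W\<close>.\<close>
    have "L.span E \<subseteq> ?l ` W" by (rule L.span_minimal[OF _ sub[OF W(1)]]) (use W(2) E'(3) in blast)
    then have sub: "?l ` ?A \<subseteq> ?l ` W" using E(3) by blast
    show "?A \<subseteq> W"
    proof
      fix f assume f: "f \<in> ?A"
      then obtain g where g: "g \<in> W" "?l f = ?l g" using sub by blast
      have "?p f \<eta> = ?p g \<eta>" if "\<eta> \<in> ?B" for \<eta> using fun_cong[OF g(2), of \<eta>] that by simp
      then have "f = g" using inj f g(1) WA by blast
      then show "f \<in> W" using g(1) by simp
    qed
  qed
  then show ?thesis unfolding finitely_spanned_def ZY using E'(1,2) by blast
qed

end

section \<open>Modules\<close>

lemma left_module_group:
  "left_module M \<Longrightarrow> comm_group \<lparr>carrier = mcar M, monoid.mult = madd M, one = mzero M\<rparr>"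
  by (simp add: left_module_def)

lemma mzero_closed: "left_module M \<Longrightarrow> mzero M \<in> mcar M"
  using monoid.one_closed[of "\<lparr>carrier = mcar M, monoid.mult = madd M, one = mzero M\<rparr>"] left_module_group[of M]
  by (simp add: comm_group_def comm_monoid_def)

lemma madd_closed: "left_module M \<Longrightarrow> x \<in> mcar M \<Longrightarrow> y \<in> mcar M \<Longrightarrow> madd M x y \<in> mcar M"
  using monoid.m_closed[of "\<lparr>carrier = mcar M, monoid.mult = madd M, one = mzero M\<rparr>" x y] left_module_group[of M]
  by (simp add: comm_group_def comm_monoid_def)

lemma madd_assoc: "left_module M \<Longrightarrow> x \<in> mcar M \<Longrightarrow> y \<in> mcar M \<Longrightarrow> z \<in> mcar M
    \<Longrightarrow> madd M (madd M x y) z = madd M x (madd M y z)"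
  using monoid.m_assoc[of "\<lparr>carrier = mcar M, monoid.mult = madd M, one = mzero M\<rparr>" x y z] left_module_group[of M]
  by (simp add: comm_group_def comm_monoid_def)

lemma madd_commute: "left_module M \<Longrightarrow> x \<in> mcar M \<Longrightarrow> y \<in> mcar M \<Longrightarrow> madd M x y = madd M y x"
  using comm_monoid.m_comm[of "\<lparr>carrier = mcar M, monoid.mult = madd M, one = mzero M\<rparr>" x y] left_module_group[of M]
  by (simp add: comm_group_def)

lemma mzero_madd: "left_module M \<Longrightarrow> x \<in> mcar M \<Longrightarrow> madd M (mzero M) x = x"
  using monoid.l_one[of "\<lparr>carrier = mcar M, monoid.mult = madd M, one = mzero M\<rparr>" x] left_module_group[of M]
  by (simp add: comm_group_def comm_monoid_def)

lemma madd_mzero: "left_module M \<Longrightarrow> x \<in> mcar M \<Longrightarrow> madd M x (mzero M) = x"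
  using mzero_madd madd_commute mzero_closed by metis

lemma madd_self_zero:
  assumes "left_module M" "x \<in> mcar M" "madd M x x = x" shows "x = mzero M"
proof -
  let ?G = "\<lparr>carrier = mcar M, monoid.mult = madd M, one = mzero M\<rparr>"
  interpret comm_group ?G by (rule left_module_group[OF assms(1)])
  show ?thesis using l_cancel_one[of x x] assms(2,3) by simp
qed

lemma mscl_closed: "left_module M \<Longrightarrow> x \<in> mcar M \<Longrightarrow> mscl M a x \<in> mcar M"
  by (simp add: left_module_def)

lemma mscl_madd: "left_module M \<Longrightarrow> x \<in> mcar M \<Longrightarrow> y \<in> mcar M
    \<Longrightarrow> mscl M a (madd M x y) = madd M (mscl M a x) (mscl M a y)"
  and mscl_add: "left_module M \<Longrightarrow> x \<in> mcar M \<Longrightarrow> mscl M (a + b) x = madd M (mscl M a x) (mscl M b x)"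
  and mscl_mult: "left_module M \<Longrightarrow> x \<in> mcar M \<Longrightarrow> mscl M (a * b) x = mscl M a (mscl M b x)"
  and mscl_one: "left_module M \<Longrightarrow> x \<in> mcar M \<Longrightarrow> mscl M 1 x = x"
  by (simp_all add: left_module_def)

lemma mscl_0: "left_module M \<Longrightarrow> x \<in> mcar M \<Longrightarrow> mscl M 0 x = mzero M"
  using mscl_add[of M x 0 0] madd_self_zero mscl_closed by (metis add_0)

lemma mscl_mzero: "left_module M \<Longrightarrow> mscl M a (mzero M) = mzero M"
  using mscl_madd[of M "mzero M" "mzero M" a] madd_self_zero mscl_closed mzero_closed mzero_madd by metis

lemma madd_neg: "left_module M \<Longrightarrow> x \<in> mcar M \<Longrightarrow> madd M x (mscl M (- 1) x) = mzero M"
  using mscl_add[of M x 1 "- 1"] mscl_one mscl_0 by (metis add.right_inverse)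

lemma madd_interchange:
  assumes "left_module M" "a \<in> mcar M" "b \<in> mcar M" "c \<in> mcar M" "d \<in> mcar M"
  shows "madd M (madd M a b) (madd M c d) = madd M (madd M a c) (madd M b d)"
proof -
  have "madd M b (madd M c d) = madd M c (madd M b d)"
    using madd_assoc[OF assms(1)] madd_commute[OF assms(1)] assms by metis
  then show ?thesis
    using madd_assoc[OF assms(1,2,3) madd_closed[OF assms(1,4,5)]]
      madd_assoc[OF assms(1,2,4) madd_closed[OF assms(1,3,5)]] by simp
qed

lemma mod_hom_closed: "f \<in> mod_hom M N \<Longrightarrow> x \<in> mcar M \<Longrightarrow> f x \<in> mcar N"
  and mod_hom_madd: "f \<in> mod_hom M N \<Longrightarrow> x \<in> mcar M \<Longrightarrow> y \<in> mcar M \<Longrightarrow> f (madd M x y) = madd N (f x) (f y)"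
  and mod_hom_mscl: "f \<in> mod_hom M N \<Longrightarrow> x \<in> mcar M \<Longrightarrow> f (mscl M a x) = mscl N a (f x)"
  by (auto simp: mod_hom_def)

lemma mod_homI:
  assumes "\<And>x. x \<in> mcar M \<Longrightarrow> f x \<in> mcar N"
    "\<And>x y. x \<in> mcar M \<Longrightarrow> y \<in> mcar M \<Longrightarrow> f (madd M x y) = madd N (f x) (f y)"
    "\<And>a x. x \<in> mcar M \<Longrightarrow> f (mscl M a x) = mscl N a (f x)"
  shows "f \<in> mod_hom M N"
  using assms by (auto simp: mod_hom_def)

lemma mod_hom_mzero:
  assumes "left_module M" "left_module N" "f \<in> mod_hom M N" shows "f (mzero M) = mzero N"
proof -
  have z: "mzero M \<in> mcar M" using mzero_closed[OF assms(1)] .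
  have "f (mzero M) = f (mscl M 0 (mzero M))" using mscl_mzero[OF assms(1)] by simp
  also have "\<dots> = mscl N 0 (f (mzero M))" using mod_hom_mscl[OF assms(3) z] .
  finally show ?thesis using mscl_0[OF assms(2) mod_hom_closed[OF assms(3) z]] by simp
qed

lemma mod_hom_zero: "left_module N \<Longrightarrow> (\<lambda>x. mzero N) \<in> mod_hom M N"
  by (rule mod_homI) (simp_all add: mzero_closed mzero_madd mscl_mzero)

lemma mod_hom_comp: "f \<in> mod_hom M N \<Longrightarrow> g \<in> mod_hom N P \<Longrightarrow> (\<lambda>x. g (f x)) \<in> mod_hom M P"
  by (rule mod_homI) (simp_all add: mod_hom_closed mod_hom_madd mod_hom_mscl)

lemma submodule_left_module:
  assumes M: "left_module M" and U: "submodule U M"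
  shows "left_module (M\<lparr>mcar := U\<rparr>)"
proof -
  have U': "U \<subseteq> mcar M" "mzero M \<in> U" "\<And>x y. x \<in> U \<Longrightarrow> y \<in> U \<Longrightarrow> madd M x y \<in> U"
    "\<And>a x. x \<in> U \<Longrightarrow> mscl M a x \<in> U"
    using U unfolding submodule_def by blast+
  have inM: "\<And>x. x \<in> U \<Longrightarrow> x \<in> mcar M" using U'(1) by blast
  have "comm_group \<lparr>carrier = U, monoid.mult = madd M, one = mzero M\<rparr>"
  proof (rule comm_groupI)
    fix x assume "x \<in> carrier \<lparr>carrier = U, monoid.mult = madd M, one = mzero M\<rparr>"
    then have x: "x \<in> U" "x \<in> mcar M" using U'(1) by auto
    have "madd M (mscl M (- 1) x) x = mzero M"
      using madd_neg[OF M x(2)] madd_commute[OF M x(2) mscl_closed[OF M x(2)]] by metis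
    then show "\<exists>y \<in> carrier \<lparr>carrier = U, monoid.mult = madd M, one = mzero M\<rparr>.
        y \<otimes>\<^bsub>\<lparr>carrier = U, monoid.mult = madd M, one = mzero M\<rparr>\<^esub> x = \<one>\<^bsub>\<lparr>carrier = U, monoid.mult = madd M, one = mzero M\<rparr>\<^esub>"
      using U'(4)[OF x(1)] by auto
  next
    fix x y
    assume "x \<in> carrier \<lparr>carrier = U, monoid.mult = madd M, one = mzero M\<rparr>"
      "y \<in> carrier \<lparr>carrier = U, monoid.mult = madd M, one = mzero M\<rparr>"
    then show "x \<otimes>\<^bsub>\<lparr>carrier = U, monoid.mult = madd M, one = mzero M\<rparr>\<^esub> y
        = y \<otimes>\<^bsub>\<lparr>carrier = U, monoid.mult = madd M, one = mzero M\<rparr>\<^esub> x"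
      using inM madd_commute[OF M] by simp
  qed (use U'(2,3) inM madd_assoc[OF M] mzero_madd[OF M] in auto)
  then show ?thesis
    unfolding left_module_def using U'(3,4) U'(1) M
    by (auto simp: mscl_madd mscl_add mscl_mult mscl_one subset_iff)
qed

lemma fg_module_left_module: "M \<in> fg_modules \<Longrightarrow> left_module M"
  by (simp add: fg_modules_def)

lemma mod_hom_image_fg:
  assumes M: "M \<in> fg_modules" and N: "left_module N" and f: "f \<in> mod_hom M N"
  shows "submodule (f ` mcar M) N" "N\<lparr>mcar := f ` mcar M\<rparr> \<in> fg_modules"
proof -
  have M': "left_module M" using M fg_module_left_module by blast
  show sub: "submodule (f ` mcar M) N"
    unfolding submodule_def
  proof (intro conjI ballI allI)
    show "f ` mcar M \<subseteq> mcar N" using mod_hom_closed[OF f] by blast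
    show "mzero N \<in> f ` mcar M" using mod_hom_mzero[OF M' N f] mzero_closed[OF M'] by (metis image_eqI)
    show "madd N x y \<in> f ` mcar M" if "x \<in> f ` mcar M" "y \<in> f ` mcar M" for x y
      using that mod_hom_madd[OF f] madd_closed[OF M'] by (auto simp flip: mod_hom_madd[OF f])
    show "mscl N a x \<in> f ` mcar M" if "x \<in> f ` mcar M" for a x
      using that mscl_closed[OF M'] by (auto simp flip: mod_hom_mscl[OF f])
  qed
  obtain G where G: "G \<subseteq> mcar M" "finite G" "\<And>U. submodule U M \<Longrightarrow> G \<subseteq> U \<Longrightarrow> U = mcar M"
    using M unfolding fg_modules_def finitely_generated_def by blast
  have "U = f ` mcar M" if U: "submodule U (N\<lparr>mcar := f ` mcar M\<rparr>)" "f ` G \<subseteq> U" for U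
  proof -
    have U': "U \<subseteq> f ` mcar M" "mzero N \<in> U" "\<And>x y. x \<in> U \<Longrightarrow> y \<in> U \<Longrightarrow> madd N x y \<in> U"
      "\<And>a x. x \<in> U \<Longrightarrow> mscl N a x \<in> U"
      using U(1) unfolding submodule_def by auto
    \<comment> \<open>The preimage of \<open>U\<close> is a submodule that contains the generators
      of \<open>M\<close>, so it is all of \<open>M\<close>.\<close>
    have "submodule {x \<in> mcar M. f x \<in> U} M"
      unfolding submodule_def
      using U' mod_hom_mzero[OF M' N f] mzero_closed[OF M'] madd_closed[OF M'] mscl_closed[OF M']
        mod_hom_madd[OF f] mod_hom_mscl[OF f] by auto
    then have "{x \<in> mcar M. f x \<in> U} = mcar M" using G(3) G(1) U(2) by blast
    then show ?thesis using U'(1) by blast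
  qed
  moreover have "f ` G \<subseteq> f ` mcar M" "finite (f ` G)" using G by blast+
  ultimately have "finitely_generated (N\<lparr>mcar := f ` mcar M\<rparr>)"
    unfolding finitely_generated_def by (intro exI[of _ "f ` G"]) auto
  then show "N\<lparr>mcar := f ` mcar M\<rparr> \<in> fg_modules"
    unfolding fg_modules_def using submodule_left_module[OF N sub] by blast
qed

section \<open>Free modules of finite rank\<close>

definition free_module :: "nat \<Rightarrow> 'h::ring_1 fmod" where
  "free_module n = \<lparr>mcar = {x. \<forall>i \<ge> n. x i = 0}, madd = (\<lambda>x y i. x i + y i), mzero = (\<lambda>i. 0),
     mscl = (\<lambda>a x i. a * x i)\<rparr>"

lemma free_module_simps [simp]:
  "x \<in> mcar (free_module n) \<longleftrightarrow> (\<forall>i \<ge> n. x i = 0)" "madd (free_module n) x y = (\<lambda>i. x i + y i)"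
  "mzero (free_module n) = (\<lambda>i. 0)" "mscl (free_module n) a x = (\<lambda>i. a * x i)"
  by (simp_all add: free_module_def)

lemma free_module_left_module: "left_module (free_module n)"
proof -
  let ?G = "\<lparr>carrier = mcar (free_module n :: 'a fmod), monoid.mult = madd (free_module n), one = mzero (free_module n)\<rparr>"
  have "comm_group ?G"
  proof (rule comm_groupI)
    fix x assume "x \<in> carrier ?G"
    then show "\<exists>y \<in> carrier ?G. y \<otimes>\<^bsub>?G\<^esub> x = \<one>\<^bsub>?G\<^esub>"
      by (intro bexI[of _ "\<lambda>i. - x i"]) auto
  qed (auto simp: fun_eq_iff algebra_simps)
  then show ?thesis unfolding left_module_def by (auto simp: fun_eq_iff algebra_simps)
qed

definition unit_vector :: "nat \<Rightarrow> nat \<Rightarrow> 'h::ring_1" where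
  "unit_vector k = (\<lambda>i. if i = k then 1 else 0)"

text \<open>As a function of \<open>x\<close>, this is the homomorphism from the free module of rank
  \<open>n\<close> that sends the \<open>k\<close>-th unit vector to \<open>y k\<close>.\<close>

primrec lin_comb :: "('h, 'm) lmod \<Rightarrow> (nat \<Rightarrow> 'm) \<Rightarrow> nat \<Rightarrow> (nat \<Rightarrow> 'h) \<Rightarrow> 'm" where
  "lin_comb M y 0 x = mzero M"
| "lin_comb M y (Suc n) x = madd M (lin_comb M y n x) (mscl M (x n) (y n))"

lemma lin_comb_closed:
  "left_module M \<Longrightarrow> (\<And>k. k < n \<Longrightarrow> y k \<in> mcar M) \<Longrightarrow> lin_comb M y n x \<in> mcar M"
  by (induction n) (simp_all add: mzero_closed madd_closed mscl_closed)

lemma lin_comb_mod_hom: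
  assumes M: "left_module M" and y: "\<And>k. k < n \<Longrightarrow> y k \<in> mcar M"
  shows "lin_comb M y n \<in> mod_hom (free_module m) M"
proof (rule mod_homI)
  fix x show "lin_comb M y n x \<in> mcar M" using lin_comb_closed[OF M y] .
next
  fix x x'
  show "lin_comb M y n (madd (free_module m) x x') = madd M (lin_comb M y n x) (lin_comb M y n x')"
    using y
  proof (induction n)
    case (Suc n)
    have y: "y k \<in> mcar M" if "k < n" for k using Suc.prems that by simp
    have yn: "y n \<in> mcar M" using Suc.prems by simp
    have cl: "lin_comb M y n z \<in> mcar M" for z using lin_comb_closed[OF M y] .
    show ?case
      using Suc.IH[OF y] madd_interchange[OF M cl cl mscl_closed[OF M yn] mscl_closed[OF M yn]]
        mscl_add[OF M yn] by simp
  qed (simp add: mzero_madd[OF M mzero_closed[OF M]])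
next
  fix a x
  show "lin_comb M y n (mscl (free_module m) a x) = mscl M a (lin_comb M y n x)"
    using y
  proof (induction n)
    case (Suc n)
    have y: "y k \<in> mcar M" if "k < n" for k using Suc.prems that by simp
    have yn: "y n \<in> mcar M" using Suc.prems by simp
    have cl: "lin_comb M y n z \<in> mcar M" for z using lin_comb_closed[OF M y] .
    show ?case
      using Suc.IH[OF y] mscl_madd[OF M cl mscl_closed[OF M yn]] mscl_mult[OF M yn] by simp
  qed (simp add: mscl_mzero[OF M])
qed

lemma mod_hom_lin_comb:
  assumes "left_module M" "left_module N" "f \<in> mod_hom M N" "\<And>k. k < n \<Longrightarrow> y k \<in> mcar M"
  shows "f (lin_comb M y n x) = lin_comb N (\<lambda>k. f (y k)) n x"
  using assms(4)
  by (induction n)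
    (simp_all add: mod_hom_mzero[OF assms(1-3)] mod_hom_madd[OF assms(3)] mod_hom_mscl[OF assms(3)]
      lin_comb_closed[OF assms(1)] mscl_closed[OF assms(1)])

lemma lin_comb_unit_vector:
  assumes M: "left_module M" and y: "\<And>k. k < n \<Longrightarrow> y k \<in> mcar M"
  shows "lin_comb M y n (unit_vector k) = (if k < n then y k else mzero M)"
  using y
proof (induction n)
  case (Suc n)
  have yn: "y n \<in> mcar M" using Suc.prems by simp
  have IH: "lin_comb M y n (unit_vector k) = (if k < n then y k else mzero M)" using Suc by simp
  consider "k < n" | "k = n" | "n < k" by linarith
  then show ?case
  proof cases
    case 1
    then show ?thesis using IH Suc.prems[of k] mscl_0[OF M yn] madd_mzero[OF M] by (simp add: unit_vector_def)
  next
    case 2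
    then show ?thesis using IH mscl_one[OF M yn] mzero_madd[OF M yn] by (simp add: unit_vector_def)
  next
    case 3
    then show ?thesis using IH mscl_0[OF M yn] madd_mzero[OF M mzero_closed[OF M]] by (simp add: unit_vector_def)
  qed
qed simp

lemma lin_comb_free:
  "lin_comb (free_module m) unit_vector n x = (\<lambda>i. if i < n then x i else (0 :: 'h::ring_1))"
proof (induction n)
  case (Suc n)
  have "lin_comb (free_module m) unit_vector (Suc n) x
      = (\<lambda>i. (if i < n then x i else 0) + x n * unit_vector n i)" using Suc by simp
  also have "\<dots> = (\<lambda>i. if i < Suc n then x i else 0)" by (auto simp: fun_eq_iff unit_vector_def less_Suc_eq)
  finally show ?case .
qed simp

lemma unit_vector_free: "k < n \<Longrightarrow> unit_vector k \<in> mcar (free_module n)"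
  by (auto simp: unit_vector_def)

lemma lin_comb_free_id: "x \<in> mcar (free_module n) \<Longrightarrow> lin_comb (free_module n) unit_vector n x = x"
  unfolding lin_comb_free by (auto simp: fun_eq_iff)

lemma free_module_fg: "free_module n \<in> fg_modules"
proof -
  have "U = mcar (free_module n)"
    if U: "submodule U (free_module n)" "unit_vector ` {..<n} \<subseteq> U" for U :: "(nat \<Rightarrow> 'a) set"
  proof
    show "U \<subseteq> mcar (free_module n)" using U(1) unfolding submodule_def by blast
    show "mcar (free_module n) \<subseteq> U"
    proof
      fix x :: "nat \<Rightarrow> 'a" assume x: "x \<in> mcar (free_module n)"
      have "left_module ((free_module n)\<lparr>mcar := U\<rparr>)" using submodule_left_module[OF free_module_left_module U(1)] .
      from lin_comb_closed[OF this, of n unit_vector x]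
      have "lin_comb ((free_module n)\<lparr>mcar := U\<rparr>) unit_vector n x \<in> U" using U(2) by auto
      \<comment> \<open>The submodule shares its operations with the free module, so the combination
        that lies in \<open>U\<close> is \<open>x\<close> itself.\<close>
      moreover have "lin_comb ((free_module n)\<lparr>mcar := U\<rparr>) unit_vector k x = lin_comb (free_module n) unit_vector k x" for k
        by (induction k) simp_all
      ultimately show "x \<in> U" using lin_comb_free_id[OF x] by simp
    qed
  qed
  then have "finitely_generated (free_module n :: 'a fmod)"
    unfolding finitely_generated_def using unit_vector_free
    by (intro exI[of _ "unit_vector ` {..<n}"]) (auto simp del: free_module_simps)
  then show ?thesis unfolding fg_modules_def using free_module_left_module by blast
qed

text \<open>A lift is assembled from preimages \<open>y k\<close> of the images of the unit
  vectors.\<close>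

lemma free_module_projective: "projective (free_module n)"
  unfolding projective_def
proof (intro conjI ballI impI)
  show "free_module n \<in> fg_modules" by (rule free_module_fg)
  fix M N :: "'a fmod" and p f
  assume M: "M \<in> fg_modules" and N: "N \<in> fg_modules" and p: "p \<in> mod_hom M N"
    and f: "f \<in> mod_hom (free_module n) N" and surj: "p ` mcar M = mcar N"
  note M' = fg_module_left_module[OF M] and N' = fg_module_left_module[OF N]
  have "\<exists>y. k < n \<longrightarrow> y \<in> mcar M \<and> p y = f (unit_vector k)" for k
    using mod_hom_closed[OF f unit_vector_free] surj by (metis imageE)
  then obtain y where y: "\<And>k. k < n \<Longrightarrow> y k \<in> mcar M" "\<And>k. k < n \<Longrightarrow> p (y k) = f (unit_vector k)"
    by metis
  have "p (lin_comb M y n x) = f x" if x: "x \<in> mcar (free_module n)" for x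
  proof -
    have "p (lin_comb M y n x) = lin_comb N (\<lambda>k. p (y k)) n x" using mod_hom_lin_comb[OF M' N' p y(1)] by simp
    also have "m \<le> n \<Longrightarrow> lin_comb N (\<lambda>k. p (y k)) m x = lin_comb N (\<lambda>k. f (unit_vector k)) m x" for m
      by (induction m) (use y(2) in simp_all)
    then have "lin_comb N (\<lambda>k. p (y k)) n x = lin_comb N (\<lambda>k. f (unit_vector k)) n x" by simp
    also have "\<dots> = f (lin_comb (free_module n) unit_vector n x)"
      using mod_hom_lin_comb[OF free_module_left_module N' f unit_vector_free] by simp
    finally show ?thesis using lin_comb_free_id[OF x] by simp
  qed
  then show "\<exists>g \<in> mod_hom (free_module n) M. \<forall>x \<in> mcar (free_module n). p (g x) = f x"
    by (intro bexI[of _ "lin_comb M y n"] ballI lin_comb_mod_hom[OF M' y(1)])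
qed

lemma free_cover:
  assumes M: "M \<in> fg_modules"
  obtains n p where "p \<in> mod_hom (free_module n) M" "p ` mcar (free_module n) = mcar M"
proof -
  note M' = fg_module_left_module[OF M]
  obtain G where G: "G \<subseteq> mcar M" "finite G" "\<And>U. submodule U M \<Longrightarrow> G \<subseteq> U \<Longrightarrow> U = mcar M"
    using M unfolding fg_modules_def finitely_generated_def by blast
  obtain ys where ys: "set ys = G" using finite_list[OF G(2)] by blast
  let ?n = "length ys" and ?p = "lin_comb M (nth ys) (length ys)"
  have y: "\<And>k. k < ?n \<Longrightarrow> ys ! k \<in> mcar M" using ys G(1) by (metis nth_mem subsetD)
  have p: "?p \<in> mod_hom (free_module ?n) M" using lin_comb_mod_hom[OF M' y] .
  have "G \<subseteq> ?p ` mcar (free_module ?n)"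
  proof
    fix g assume "g \<in> G"
    then obtain k where k: "k < ?n" "g = ys ! k" using ys by (metis in_set_conv_nth)
    then have "g = ?p (unit_vector k)" using lin_comb_unit_vector[OF M' y] by simp
    then show "g \<in> ?p ` mcar (free_module ?n)" using unit_vector_free[OF k(1)] by blast
  qed
  then have "?p ` mcar (free_module ?n) = mcar M"
    using G(3) mod_hom_image_fg(1)[OF free_module_fg M' p] by blast
  then show ?thesis using that[OF p] by blast
qed

section \<open>Complexes\<close>

lemma bounded_complex_terms:
  assumes "X \<in> bounded_complexes"
  shows "trm X n \<in> fg_modules" "left_module (trm X n)" "dif X n \<in> mod_hom (trm X n) (trm X (n + 1))"
    "x \<in> mcar (trm X n) \<Longrightarrow> dif X (n + 1) (dif X n x) = mzero (trm X (n + 2))"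
  using assms fg_module_left_module unfolding bounded_complexes_def by blast+

lemma dif_mzero: "X \<in> bounded_complexes \<Longrightarrow> dif X n (mzero (trm X n)) = mzero (trm X (n + 1))"
  using mod_hom_mzero bounded_complex_terms by blast

lemma chain_mapD:
  assumes "f \<in> chain_maps X Y"
  shows "f n \<in> mod_hom (trm X n) (trm Y n)"
    "x \<in> mcar (trm X n) \<Longrightarrow> f (n + 1) (dif X n x) = dif Y n (f n x)"
  using assms unfolding chain_maps_def by blast+

lemma chain_map_mzero:
  "X \<in> bounded_complexes \<Longrightarrow> Y \<in> bounded_complexes \<Longrightarrow> f \<in> chain_maps X Y
    \<Longrightarrow> f n (mzero (trm X n)) = mzero (trm Y n)"
  using mod_hom_mzero bounded_complex_terms(2) chain_mapD(1) by blast

lemma mzero_coboundary: "X \<in> bounded_complexes \<Longrightarrow> mzero (trm X n) \<in> coboundaries X n"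
  unfolding coboundaries_def
  using dif_mzero[of X "n - 1"] mzero_closed[OF bounded_complex_terms(2), of X "n - 1"]
  by (simp add: image_iff) metis

lemma chain_map_comp:
  "f \<in> chain_maps X Y \<Longrightarrow> g \<in> chain_maps Y Z \<Longrightarrow> (\<lambda>n x. g n (f n x)) \<in> chain_maps X Z"
  unfolding chain_maps_def using mod_hom_comp mod_hom_closed by fastforce

lemma zero_chain_map:
  "X \<in> bounded_complexes \<Longrightarrow> Y \<in> bounded_complexes \<Longrightarrow> (\<lambda>n x. mzero (trm Y n)) \<in> chain_maps X Y"
  unfolding chain_maps_def by (auto simp: mod_hom_zero bounded_complex_terms(2) dif_mzero)

lemma idn_chain_map: "(\<lambda>n x. x) \<in> chain_maps X X"
  unfolding chain_maps_def by (auto intro: mod_homI)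

lemma idn_quasi_iso:
  assumes X: "X \<in> bounded_complexes" shows "quasi_iso X X (\<lambda>n x. x)"
proof -
  have "y = madd (trm X n) y (mzero (trm X n))" if "y \<in> cocycles X n" for y n
    using madd_mzero[OF bounded_complex_terms(2)[OF X]] that unfolding cocycles_def by simp
  then show ?thesis unfolding quasi_iso_def using idn_chain_map mzero_coboundary[OF X] by blast
qed

lemma quasi_iso_exact:
  assumes "Z \<in> bounded_complexes" "X \<in> bounded_complexes" "quasi_iso Z X s" "cocycles X n \<subseteq> coboundaries X n"
  shows "cocycles Z n \<subseteq> coboundaries Z n"
proof
  have s: "s \<in> chain_maps Z X" using assms(3) by (simp add: quasi_iso_def)
  fix x assume x: "x \<in> cocycles Z n"
  then have x': "x \<in> mcar (trm Z n)" "dif Z n x = mzero (trm Z (n + 1))" by (auto simp: cocycles_def)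
  have "dif X n (s n x) = mzero (trm X (n + 1))"
    using chain_mapD(2)[OF s x'(1)] x'(2) chain_map_mzero[OF assms(1,2) s] by simp
  then have "s n x \<in> cocycles X n" using mod_hom_closed[OF chain_mapD(1)[OF s] x'(1)] by (simp add: cocycles_def)
  then show "x \<in> coboundaries Z n" using assms(3,4) x unfolding quasi_iso_def by blast
qed

section \<open>Stalk complexes of the regular module\<close>

definition stalk :: "int \<Rightarrow> 'h::ring_1 cochain_cx" where
  "stalk j = \<lparr>trm = (\<lambda>n. free_module (if n = j then 1 else 0)), dif = (\<lambda>n x i. 0)\<rparr>"

lemma trm_stalk: "trm (stalk j) n = free_module (if n = j then 1 else 0)"
  and dif_stalk: "dif (stalk j) n x = (\<lambda>i. 0)"
  by (simp_all add: stalk_def)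

lemma stalk_bounded: "stalk j \<in> bounded_complexes"
proof -
  have "dif (stalk j) n \<in> mod_hom (trm (stalk j) n) (trm (stalk j) (n + 1))" for n
    by (rule mod_homI) (auto simp: trm_stalk dif_stalk)
  moreover have "mcar (trm (stalk j) n) = {mzero (trm (stalk j) n)}" if "\<bar>n\<bar> > \<bar>j\<bar>" for n
    using that by (auto simp: trm_stalk fun_eq_iff)
  moreover have "trm (stalk j) n \<in> fg_modules" for n
    by (simp add: trm_stalk free_module_fg)
  moreover have "dif (stalk j) (n + 1) (dif (stalk j) n x) = mzero (trm (stalk j) (n + 2))" for n x
    by (simp add: trm_stalk dif_stalk)
  ultimately show ?thesis unfolding bounded_complexes_def by blast
qed

lemma complex_shift_stalk: "complex_shift (stalk j) = stalk (j - 1)"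
  unfolding complex_shift_def stalk_def by (auto simp: fun_eq_iff)

text \<open>The chain map from \<open>H\<close> in degree \<open>j\<close> that sends 1 to
  \<open>x\<close>; the scalar is the only coordinate \<open>y 0\<close> of an element of the free
  module of rank one.\<close>

definition stalk_map :: "'h::ring_1 cochain_cx \<Rightarrow> int \<Rightarrow> (nat \<Rightarrow> 'h) \<Rightarrow> 'h chmap" where
  "stalk_map X j x = (\<lambda>n y. if n = j then mscl (trm X j) (y 0) x else mzero (trm X n))"

lemma stalk_map_chain_map:
  assumes X: "X \<in> bounded_complexes" and x: "x \<in> cocycles X j"
  shows "stalk_map X j x \<in> chain_maps (stalk j) X"
proof -
  have x': "x \<in> mcar (trm X j)" "dif X j x = mzero (trm X (j + 1))" using x by (auto simp: cocycles_def)
  note M = bounded_complex_terms(2)[OF X]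
  have "stalk_map X j x n \<in> mod_hom (trm (stalk j) n) (trm X n)" for n
    by (rule mod_homI)
      (auto simp: stalk_map_def trm_stalk mscl_closed[OF M x'(1)] mscl_add[OF M x'(1)] mscl_mult[OF M x'(1)]
        mzero_closed[OF M] mzero_madd[OF M] mscl_mzero[OF M])
  moreover have "stalk_map X j x (n + 1) (dif (stalk j) n y) = dif X n (stalk_map X j x n y)" for n y
    using mod_hom_mscl[OF bounded_complex_terms(3)[OF X] x'(1)] x'(2) dif_mzero[OF X]
    by (auto simp: stalk_map_def dif_stalk mscl_0[OF M x'(1)] mscl_mzero[OF M])
  ultimately show ?thesis unfolding chain_maps_def by blast
qed

lemma unit_cocycle: "unit_vector 0 \<in> cocycles (stalk j) j"
  by (auto simp: cocycles_def trm_stalk dif_stalk unit_vector_def)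

text \<open>Resolving the term in degree \<open>m\<close> of a complex exact below \<open>m\<close>: the free cover \<open>P\<close> of that term and the preimage
  \<open>U \<subseteq> P\<close> of the coboundaries suffice, because \<open>U\<close> is again projective.\<close>

lemma (in hereditary_algebra) exact_below_replacement:
  fixes X :: "'h cochain_cx"
  assumes X: "X \<in> bounded_complexes" and exact: "\<And>i. i < m \<Longrightarrow> cocycles X i \<subseteq> coboundaries X i"
  obtains W t where "W \<in> bounded_complexes" "quasi_iso W X t"
    "\<And>i. i < m - 1 \<Longrightarrow> mcar (trm W i) = {mzero (trm W i)}"
proof -
  note M = bounded_complex_terms(2)[OF X] and d = bounded_complex_terms(3)[OF X]
  obtain k p where p: "p \<in> mod_hom (free_module k) (trm X m)" "p ` mcar (free_module k) = mcar (trm X m)"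
    using free_cover[OF bounded_complex_terms(1)[OF X]] .
  define P where "P = (free_module k :: 'h fmod)"
  have P: "left_module P" "P \<in> fg_modules" "projective P"
    unfolding P_def using free_module_left_module free_module_fg free_module_projective by blast+
  have p: "p \<in> mod_hom P (trm X m)" "p ` mcar P = mcar (trm X m)" using p unfolding P_def by blast+
  have dm: "dif X (m - 1) \<in> mod_hom (trm X (m - 1)) (trm X m)" using d[of "m - 1"] by simp
  define N where "N = (trm X m)\<lparr>mcar := coboundaries X m\<rparr>"
  have cob: "submodule (coboundaries X m) (trm X m)" and N: "N \<in> fg_modules"
    unfolding N_def coboundaries_def using mod_hom_image_fg[OF bounded_complex_terms(1)[OF X] M dm] by blast+
  define U where "U = {b \<in> mcar P. p b \<in> coboundaries X m}"
  have U: "submodule U P"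
    unfolding submodule_def
  proof (intro conjI ballI allI)
    show "U \<subseteq> mcar P" unfolding U_def by blast
    show "mzero P \<in> U"
      unfolding U_def using mzero_closed[OF P(1)] mod_hom_mzero[OF P(1) M p(1)] mzero_coboundary[OF X] by simp
    show "madd P x y \<in> U" if "x \<in> U" "y \<in> U" for x y
      using that madd_closed[OF P(1)] mod_hom_madd[OF p(1)] cob unfolding U_def submodule_def by auto
    show "mscl P a x \<in> U" if "x \<in> U" for a x
      using that mscl_closed[OF P(1)] mod_hom_mscl[OF p(1)] cob unfolding U_def submodule_def by auto
  qed
  define PU where "PU = P\<lparr>mcar := U\<rparr>"
  \<comment> \<open>Here the algebra is used to be hereditary: \<open>U\<close>, as a submodule of a
    free module, is projective, and the resolution stops after one step.\<close>
  have PU: "projective PU" unfolding PU_def using hereditary[OF P(3) U] .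
  have PU': "PU \<in> fg_modules" "left_module PU"
    using PU fg_module_left_module unfolding projective_def by blast+
  have PU_simps: "mcar PU = U" "madd PU = madd P" "mzero PU = mzero P" "mscl PU = mscl P"
    unfolding PU_def by simp_all
  have U_in: "x \<in> mcar P" "p x \<in> coboundaries X m" if "x \<in> U" for x using that unfolding U_def by blast+
  have pU: "p \<in> mod_hom PU N"
    by (rule mod_homI) (use U_in mod_hom_madd[OF p(1)] mod_hom_mscl[OF p(1)] in \<open>auto simp: PU_simps N_def\<close>)
  have dN: "dif X (m - 1) \<in> mod_hom (trm X (m - 1)) N"
    by (rule mod_homI)
      (use mod_hom_madd[OF dm] mod_hom_mscl[OF dm] in \<open>auto simp: N_def coboundaries_def\<close>)
  have surj: "dif X (m - 1) ` mcar (trm X (m - 1)) = mcar N" by (simp add: N_def coboundaries_def)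
  obtain g where g: "g \<in> mod_hom PU (trm X (m - 1))" "\<And>x. x \<in> U \<Longrightarrow> dif X (m - 1) (g x) = p x"
    using PU bounded_complex_terms(1)[OF X] N dN pU surj unfolding projective_def PU_simps by metis
  define ZM where "ZM = (free_module 0 :: 'h fmod)"
  have ZM: "ZM \<in> fg_modules" "left_module ZM" "mcar ZM = {mzero ZM}"
    unfolding ZM_def by (auto simp: fun_eq_iff free_module_fg free_module_left_module)
  \<comment> \<open>The complex is \<open>0 \<rightarrow> U \<rightarrow> P \<rightarrow> trm X (m +
    1) \<rightarrow> ...\<close> with \<open>P\<close> in degree \<open>m\<close> and the inclusion
    as differential in degree \<open>m - 1\<close>.\<close>
  define W where "W = \<lparr>trm = (\<lambda>n. if n = m then P else if n = m - 1 then PU else if m < n then trm X n else ZM),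
    dif = (\<lambda>n x. if n = m then dif X m (p x) else if n = m - 1 then x else if m < n then dif X n x
       else if n = m - 2 then mzero P else mzero ZM)\<rparr>"
  define t where "t = (\<lambda>n x. if n = m then p x else if n = m - 1 then g x else if m < n then x else mzero (trm X n))"
  have trm: "trm W m = P" "trm W (m - 1) = PU" "m < n \<Longrightarrow> trm W n = trm X n" "n < m - 1 \<Longrightarrow> trm W n = ZM" for n
    unfolding W_def by auto
  have dif: "dif W m x = dif X m (p x)" "dif W (m - 1) x = x" "m < n \<Longrightarrow> dif W n x = dif X n x"
    "dif W (m - 2) x = mzero P" "n < m - 2 \<Longrightarrow> dif W n x = mzero ZM" for n x
    unfolding W_def by auto
  have tt: "t m x = p x" "t (m - 1) x = g x" "m < n \<Longrightarrow> t n x = x" "n < m - 1 \<Longrightarrow> t n x = mzero (trm X n)" for n x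
    unfolding t_def by auto
  \<comment> \<open>Degree \<open>m - 2\<close> is listed apart: its term is already zero, but its
    differential has to land in \<open>PU\<close>, whose zero is that of \<open>P\<close>.\<close>
  have cases: "(n = m \<Longrightarrow> Q) \<Longrightarrow> (n = m - 1 \<Longrightarrow> Q) \<Longrightarrow> (m < n \<Longrightarrow> Q) \<Longrightarrow> (n = m - 2 \<Longrightarrow> Q) \<Longrightarrow> (n < m - 2 \<Longrightarrow> Q) \<Longrightarrow> Q"
    for n Q by linarith
  have ddp: "dif X (m + 1) (dif X m (p x)) = mzero (trm X (m + 2))" if "x \<in> mcar P" for x
    using bounded_complex_terms(4)[OF X mod_hom_closed[OF p(1) that]] .
  have dpU: "dif X m (p x) = mzero (trm X (m + 1))" if "x \<in> U" for x
  proof -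
    have "g x \<in> mcar (trm X (m - 1))" using mod_hom_closed[OF g(1)] that by (simp add: PU_simps)
    then show ?thesis using bounded_complex_terms(4)[OF X, of "g x" "m - 1"] g(2)[OF that] by (simp add: algebra_simps)
  qed
  have W_fg: "trm W n \<in> fg_modules" for n
    by (rule cases[of n]) (use trm P PU' ZM bounded_complex_terms(1)[OF X] in auto)
  have W_dif: "dif W n \<in> mod_hom (trm W n) (trm W (n + 1))" for n
  proof (rule cases[of n])
    assume n: "n = m"
    show ?thesis using mod_hom_comp[OF p(1) d[of m]] unfolding n trm(1) trm(3)[of "m + 1", simplified] dif(1)[abs_def] .
  next
    assume n: "n = m - 1"
    have "(\<lambda>x. x) \<in> mod_hom PU P" by (rule mod_homI) (use U_in in \<open>auto simp: PU_simps\<close>)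
    then show ?thesis unfolding n using trm(1,2) dif(2) by (simp add: W_def)
  next
    assume n: "m < n"
    then have "dif W n = dif X n" using dif(3) by blast
    then show ?thesis using d[of n] trm(3)[OF n] trm(3)[of "n + 1"] n by simp
  next
    assume n: "n = m - 2"
    have "(\<lambda>x. mzero PU) \<in> mod_hom ZM PU" by (rule mod_hom_zero[OF PU'(2)])
    moreover have "n + 1 = m - 1" "dif W n = (\<lambda>x. mzero PU)" using n dif(4) by (auto simp: PU_simps)
    ultimately show ?thesis using trm(2) trm(4)[of n] n by simp
  next
    assume n: "n < m - 2"
    have "dif W n = (\<lambda>x. mzero ZM)" using n dif(5) by blast
    then show ?thesis using mod_hom_zero[OF ZM(2), of ZM] trm(4)[of n] trm(4)[of "n + 1"] n by simp
  qed
  have W_dd: "dif W (n + 1) (dif W n x) = mzero (trm W (n + 2))" if x: "x \<in> mcar (trm W n)" for n x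
  proof (rule cases[of n])
    assume n: "n = m"
    then show ?thesis using ddp[of x] x trm(1) trm(3)[of "m + 2"] dif(1) dif(3)[of "m + 1"] by simp
  next
    assume n: "n = m - 1"
    have "x \<in> U" using x trm(2) PU_simps(1) n by simp
    then have "dif W m (dif W n x) = mzero (trm W (m + 1))"
      using dpU[of x] trm(3)[of "m + 1"] dif(1) dif(2) n by simp
    moreover have "n + 1 = m" "n + 2 = m + 1" using n by simp_all
    ultimately show ?thesis by metis
  next
    assume n: "m < n"
    then show ?thesis
      using bounded_complex_terms(4)[OF X, of x n] x trm(3)[of n] trm(3)[of "n + 2"] dif(3)[of n] dif(3)[of "n + 1"]
      by simp
  next
    assume n: "n = m - 2"
    then have e: "n + 1 = m - 1" "n + 2 = m" by simp_all
    then show ?thesis using dif(2,4) trm(1) n by simp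
  next
    assume n: "n < m - 2"
    show ?thesis
    proof (cases "n + 1 = m - 2")
      case True
      then have "n + 2 = m - 1" by simp
      then have "mzero (trm W (n + 2)) = mzero P" using trm(2) PU_simps(3) by metis
      moreover have "dif W (n + 1) (dif W n x) = mzero P" using dif(4) True by metis
      ultimately show ?thesis by simp
    next
      case False
      then show ?thesis using dif(5)[of "n + 1"] trm(4)[of "n + 2"] n by simp
    qed
  qed
  obtain b where b: "\<And>n. \<bar>n\<bar> > b \<Longrightarrow> mcar (trm X n) = {mzero (trm X n)}"
    using X unfolding bounded_complexes_def by blast
  have W_bounded: "mcar (trm W n) = {mzero (trm W n)}" if "\<bar>n\<bar> > \<bar>b\<bar> + \<bar>m\<bar> + 1" for n
  proof (cases "m < n")
    case True
    then show ?thesis using b[of n] that trm(3) by simp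
  next
    case False
    then have "n < m - 1" using that by linarith
    then show ?thesis using trm(4) ZM(3) by simp
  qed
  have W: "W \<in> bounded_complexes"
    unfolding bounded_complexes_def using W_fg W_dif W_dd W_bounded by blast
  have t_hom: "t n \<in> mod_hom (trm W n) (trm X n)" for n
  proof (rule cases[of n])
    assume n: "n = m"
    then have "t n = p" using tt(1) by blast
    then show ?thesis using p(1) n trm(1) by simp
  next
    assume n: "n = m - 1"
    then have "t n = g" using tt(2) by blast
    then show ?thesis using g(1) n trm(2) by simp
  next
    assume n: "m < n"
    then have "t n = (\<lambda>x. x)" using tt(3) by blast
    then show ?thesis using n trm(3) by (simp add: mod_hom_def)
  next
    assume n: "n = m - 2"
    then have "t n = (\<lambda>x. mzero (trm X n))" using tt(4)[of n] by auto
    then show ?thesis using mod_hom_zero[OF M] by simp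
  next
    assume n: "n < m - 2"
    then have "t n = (\<lambda>x. mzero (trm X n))" using tt(4)[of n] by auto
    then show ?thesis using mod_hom_zero[OF M] by simp
  qed
  have t_dif: "t (n + 1) (dif W n x) = dif X n (t n x)" if x: "x \<in> mcar (trm W n)" for n x
  proof (rule cases[of n])
    assume n: "n = m"
    then show ?thesis using tt(1) tt(3)[of "m + 1"] dif(1) by simp
  next
    assume n: "n = m - 1"
    then have "x \<in> U" using x trm(2) PU_simps by simp
    then show ?thesis using n tt(1,2) dif(2) g(2) by simp
  next
    assume n: "m < n"
    then show ?thesis using tt(3)[of n] tt(3)[of "n + 1"] dif(3) by simp
  next
    assume n: "n = m - 2"
    then have e: "n + 1 = m - 1" by simp
    have "g (mzero P) = mzero (trm X (m - 1))" using mod_hom_mzero[OF PU'(2) M g(1)] by (simp add: PU_simps)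
    then show ?thesis using e n tt(2) tt(4)[of n] dif(4) dif_mzero[OF X, of n] by simp
  next
    assume n: "n < m - 2"
    then show ?thesis using tt(4)[of n] tt(4)[of "n + 1"] dif_mzero[OF X, of n] by simp
  qed
  have t: "t \<in> chain_maps W X" unfolding chain_maps_def using t_hom t_dif by blast
  have c1: "coboundaries W n = coboundaries X n" if "m < n" for n
  proof (cases "n = m + 1")
    case True
    have "dif X m ` p ` mcar P = dif X m ` mcar (trm X m)" using p(2) by simp
    then show ?thesis unfolding coboundaries_def True using trm(1) dif(1) by (simp add: image_image)
  next
    case False
    then show ?thesis unfolding coboundaries_def using trm(3)[of "n - 1"] dif(3)[of "n - 1"] that by simp
  qed
  \<comment> \<open>The coboundaries in degree \<open>m\<close> are the full preimage of those of
    \<open>X\<close>, which makes \<open>p\<close> injective on cohomology there.\<close>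
  have c2: "coboundaries W m = U"
    unfolding coboundaries_def using trm(2) dif(2) PU_simps(1) by simp
  have inj: "x \<in> coboundaries W n" if x: "x \<in> cocycles W n" "t n x \<in> coboundaries X n" for n x
  proof -
    have x': "x \<in> mcar (trm W n)" "dif W n x = mzero (trm W (n + 1))" using x(1) by (auto simp: cocycles_def)
    show ?thesis
    proof (rule cases[of n])
      assume n: "n = m"
      then show ?thesis using x x' tt(1) trm(1) c2 unfolding U_def by simp
    next
      assume n: "n = m - 1"
      then have "x = mzero (trm W n)" using x'(2) dif(2) trm(1,2) by (simp add: PU_simps)
      then show ?thesis using mzero_coboundary[OF W] by simp
    next
      assume n: "m < n"
      then show ?thesis using x(2) tt(3) c1 by simp
    next
      assume n: "n = m - 2"
      then have "x = mzero (trm W n)" using x'(1) trm(4)[of n] ZM(3) by simp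
      then show ?thesis using mzero_coboundary[OF W] by simp
    next
      assume n: "n < m - 2"
      then have "x = mzero (trm W n)" using x'(1) trm(4)[of n] ZM(3) by simp
      then show ?thesis using mzero_coboundary[OF W] by simp
    qed
  qed
  have surj: "\<exists>x \<in> cocycles W n. \<exists>b \<in> coboundaries X n. y = madd (trm X n) (t n x) b" if y: "y \<in> cocycles X n" for n y
  proof -
    have y': "y \<in> mcar (trm X n)" "dif X n y = mzero (trm X (n + 1))" using y by (auto simp: cocycles_def)
    have lift: ?thesis if "x \<in> cocycles W n" "t n x = y" for x
      using that madd_mzero[OF M y'(1)] mzero_coboundary[OF X, of n] by metis
    consider "m < n" | "n = m" | "n < m" by linarith
    then show ?thesis
    proof cases
      case 1
      show ?thesis
        by (rule lift[of y]) (use 1 y' trm(3)[of n] trm(3)[of "n + 1"] dif(3)[of n] tt(3)[of n] in \<open>simp_all add: cocycles_def\<close>)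
    next
      case 2
      have "y \<in> p ` mcar P" unfolding p(2) using y'(1) 2 by simp
      then obtain x where x: "x \<in> mcar P" "p x = y" by blast
      show ?thesis
        by (rule lift[of x]) (use 2 x y' trm(1) trm(3)[of "m + 1"] dif(1) tt(1) in \<open>simp_all add: cocycles_def\<close>)
    next
      case 3
      \<comment> \<open>Below \<open>m\<close> the complex \<open>X\<close> is exact, so
        \<open>y\<close> is a coboundary and the zero cocycle serves as its preimage.\<close>
      have z: "mzero (trm W n) \<in> cocycles W n"
        using mzero_closed[OF bounded_complex_terms(2)[OF W]] dif_mzero[OF W] by (simp add: cocycles_def)
      have "y = madd (trm X n) (t n (mzero (trm W n))) y"
        using chain_map_mzero[OF W X t] mzero_madd[OF M y'(1)] by simp
      then show ?thesis using z y exact[OF 3] by blast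
    qed
  qed
  have "quasi_iso W X t" unfolding quasi_iso_def using t inj surj by blast
  then show ?thesis using that[OF W] trm(4) ZM(3) by simp
qed

section \<open>Morphisms in the derived category\<close>

context bounded_derived_category
begin

text \<open>Chain maps are functions on the whole type, and only their values on the carriers should
  count. The zero homotopy relates \<open>f\<close> and \<open>g\<close>, so \<open>Q_eq\<close>
  identifies their images.\<close>

lemma Q_cong:
  assumes X: "X \<in> bounded_complexes" and Y: "Y \<in> bounded_complexes"
    and f: "f \<in> chain_maps X Y" and g: "g \<in> chain_maps X Y"
    and eq: "\<And>n x. x \<in> mcar (trm X n) \<Longrightarrow> f n x = g n x"
  shows "Qa X Y f = Qa X Y g"
proof -
  note M = bounded_complex_terms(2)[OF Y]
  let ?s = "\<lambda>n (x :: nat \<Rightarrow> 'h). mzero (trm Y (n - 1))"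
  have "homotopic X Y f g"
    unfolding homotopic_def
  proof (intro exI[of _ ?s] conjI allI ballI)
    show "?s n \<in> mod_hom (trm X n) (trm Y (n - 1))" for n by (rule mod_hom_zero[OF M])
    fix n x assume x: "x \<in> mcar (trm X n)"
    have z: "dif Y (n - 1) (mzero (trm Y (n - 1))) = mzero (trm Y n)" using dif_mzero[OF Y, of "n - 1"] by simp
    have "g n x \<in> mcar (trm Y n)" using mod_hom_closed[OF chain_mapD(1)[OF g] x] .
    then show "f n x = madd (trm Y n) (g n x)
        (madd (trm Y n) (dif Y (n - 1) (?s n x)) (?s (n + 1) (dif X n x)))"
      using eq[OF x] z mzero_madd[OF M mzero_closed[OF M], of n] madd_mzero[OF M] by simp
  qed
  then show ?thesis using Q_eq[OF X Y f g] X idn_quasi_iso[OF X] by blast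
qed

lemma Q_zero:
  assumes X: "X \<in> bounded_complexes" and Y: "Y \<in> bounded_complexes"
  shows "Qa X Y (\<lambda>n x. mzero (trm Y n)) = Zer D (Qo X) (Qo Y)"
proof -
  note M = bounded_complex_terms(2)[OF Y] and z = zero_chain_map[OF X Y]
  have "Qa X Y (\<lambda>n x. mzero (trm Y n)) = Qa X Y (\<lambda>n x. mzero (trm Y n)) \<oplus> Qa X Y (\<lambda>n x. mzero (trm Y n))"
    using Q_add[OF X Y z z] mzero_madd[OF M mzero_closed[OF M]] by simp
  then show ?thesis using add_self_zer[OF Q_hom[OF X Y z]] by simp
qed

lemma Q_vanishes:
  assumes "X \<in> bounded_complexes" "Y \<in> bounded_complexes" "f \<in> chain_maps X Y"
    "\<And>n x. x \<in> mcar (trm X n) \<Longrightarrow> f n x = mzero (trm Y n)"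
  shows "Qa X Y f = Zer D (Qo X) (Qo Y)"
  using Q_cong[OF assms(1-3) zero_chain_map[OF assms(1,2)]] Q_zero[OF assms(1,2)] assms(4) by simp

text \<open>A fraction with denominator \<open>s\<close> and numerator \<open>f\<close> is zero if
  the roof can be refined by \<open>t\<close> so that the denominator stays invertible in
  \<open>D\<close> and the numerator vanishes. In this form the refinement may be a section of
  \<open>s\<close> as well as a quasi-isomorphism.\<close>

lemma hom_zeroI_fraction:
  assumes X: "X \<in> bounded_complexes" and Y: "Y \<in> bounded_complexes"
    and fac: "\<And>Z s f. Z \<in> bounded_complexes \<Longrightarrow> quasi_iso Z X s \<Longrightarrow> f \<in> chain_maps Z Y
      \<Longrightarrow> \<exists>W \<in> bounded_complexes. \<exists>t \<in> chain_maps W Z. is_iso D (Qo W) (Qo X) (Qa W X (\<lambda>n x. s n (t n x))) \<and>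
            (\<forall>n. \<forall>w \<in> mcar (trm W n). f n (t n w) = mzero (trm Y n))"
  shows "hom_zero D (Qo X) (Qo Y)"
proof (rule hom_zeroI[OF Q_obj[OF X] Q_obj[OF Y]])
  fix \<phi> assume \<phi>: "\<phi> \<in> Hom D (Qo X) (Qo Y)"
  obtain Z s f where Z: "Z \<in> bounded_complexes" and s: "quasi_iso Z X s" and f: "f \<in> chain_maps Z Y"
    and eq: "\<phi> \<cdot> Qa Z X s = Qa Z Y f"
    using Q_fraction[OF X Y \<phi>] by blast
  obtain W t where W: "W \<in> bounded_complexes" and t: "t \<in> chain_maps W Z"
    and iso: "is_iso D (Qo W) (Qo X) (Qa W X (\<lambda>n x. s n (t n x)))"
    and z: "\<And>n w. w \<in> mcar (trm W n) \<Longrightarrow> f n (t n w) = mzero (trm Y n)"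
    using fac[OF Z s f] by blast
  have s': "s \<in> chain_maps Z X" using s by (simp add: quasi_iso_def)
  have "\<phi> \<cdot> Qa W X (\<lambda>n x. s n (t n x)) = (\<phi> \<cdot> Qa Z X s) \<cdot> Qa W Z t"
    using Q_cmp[OF W Z X t s'] cmp_assoc[OF Q_hom[OF W Z t] Q_hom[OF Z X s'] \<phi>] by simp
  also have "\<dots> = Qa W Y (\<lambda>n x. f n (t n x))" using eq Q_cmp[OF W Z Y t f] by simp
  also have "\<dots> = Zer D (Qo W) (Qo Y)" by (rule Q_vanishes[OF W Y chain_map_comp[OF t f]]) (use z in blast)
  finally have e: "\<phi> \<cdot> Qa W X (\<lambda>n x. s n (t n x)) = Zer D (Qo W) (Qo Y)" .
  obtain u where u: "u \<in> Hom D (Qo X) (Qo W)" "Qa W X (\<lambda>n x. s n (t n x)) \<cdot> u = Idn D (Qo X)"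
    using is_isoE[OF iso] by metis
  have "\<phi> = (\<phi> \<cdot> Qa W X (\<lambda>n x. s n (t n x))) \<cdot> u"
    using cmp_assoc[OF u(1) iso_hom[OF iso] \<phi>] u(2) cmp_idn[OF \<phi>] by simp
  then show "\<phi> = Zer D (Qo X) (Qo Y)" using e zer_cmp[OF u(1) Q_obj[OF Y]] by simp
qed

text \<open>A quasi-isomorphism onto the stalk has a section, given by a cocycle over the unit
  vector, because the regular module is free. The roof may thus start at the stalk itself, and there
  the numerator lands in the zero term of \<open>Y\<close>.\<close>

lemma hom_zero_stalk:
  assumes Y: "Y \<in> bounded_complexes" and j: "mcar (trm Y j) = {mzero (trm Y j)}"
  shows "hom_zero D (Qo (stalk j)) (Qo Y)"
proof (rule hom_zeroI_fraction[OF stalk_bounded Y])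
  fix Z s f assume Z: "Z \<in> bounded_complexes" and s: "quasi_iso Z (stalk j) s" and f: "f \<in> chain_maps Z Y"
  have s': "s \<in> chain_maps Z (stalk j)" using s by (simp add: quasi_iso_def)
  obtain z b where z: "z \<in> cocycles Z j" and b: "b \<in> coboundaries (stalk j) j"
    and e: "unit_vector 0 = madd (trm (stalk j) j) (s j z) b"
    using s unit_cocycle unfolding quasi_iso_def by blast
  \<comment> \<open>A stalk has no nonzero coboundaries, so \<open>z\<close> lies exactly over the
    unit vector.\<close>
  have "b = (\<lambda>i. 0)" using b unfolding coboundaries_def by (auto simp: dif_stalk)
  then have sz: "s j z = unit_vector 0" using e by (simp add: trm_stalk)
  have z': "z \<in> mcar (trm Z j)" using z by (simp add: cocycles_def)
  let ?t = "stalk_map Z j z"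
  have t: "?t \<in> chain_maps (stalk j) Z" using stalk_map_chain_map[OF Z z] .
  have "s n (?t n x) = x" if x: "x \<in> mcar (trm (stalk j) n)" for n x
  proof (cases "n = j")
    case True
    have "s j (mscl (trm Z j) (x 0) z) = mscl (trm (stalk j) j) (x 0) (unit_vector 0)"
      using mod_hom_mscl[OF chain_mapD(1)[OF s'] z'] sz by simp
    also have "\<dots> = x" using x True by (auto simp: trm_stalk unit_vector_def fun_eq_iff)
    finally show ?thesis using True by (simp add: stalk_map_def)
  next
    case False
    then show ?thesis
      using x chain_map_mzero[OF Z stalk_bounded s', of n] by (auto simp: stalk_map_def trm_stalk fun_eq_iff)
  qed
  then have "Qa (stalk j) (stalk j) (\<lambda>n x. s n (?t n x)) = Idn D (Qo (stalk j))"
    using Q_cong[OF stalk_bounded stalk_bounded chain_map_comp[OF t s'] idn_chain_map] Q_idn[OF stalk_bounded] by simp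
  then have iso: "is_iso D (Qo (stalk j)) (Qo (stalk j)) (Qa (stalk j) (stalk j) (\<lambda>n x. s n (?t n x)))"
    using idn_iso[OF Q_obj[OF stalk_bounded]] by simp
  have "f n (?t n w) = mzero (trm Y n)" if w: "w \<in> mcar (trm (stalk j) n)" for n w
  proof (cases "n = j")
    case True
    have "f n (?t n w) \<in> mcar (trm Y n)"
      using mod_hom_closed[OF chain_mapD(1)[OF chain_map_comp[OF t f]] w] .
    then show ?thesis using j True by simp
  next
    case False
    then show ?thesis using chain_map_mzero[OF Z Y f] by (simp add: stalk_map_def)
  qed
  then show "\<exists>W \<in> bounded_complexes. \<exists>t \<in> chain_maps W Z.
      is_iso D (Qo W) (Qo (stalk j)) (Qa W (stalk j) (\<lambda>n x. s n (t n x))) \<and>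
      (\<forall>n. \<forall>w \<in> mcar (trm W n). f n (t n w) = mzero (trm Y n))"
    using iso t stalk_bounded by blast
qed

text \<open>The chain map that sends 1 to \<open>x\<close> is zero in \<open>D\<close>, hence
  null-homotopic after a quasi-isomorphism to the stalk. Evaluating the homotopy at a cocycle over
  the unit vector exhibits \<open>x\<close> as a coboundary.\<close>

lemma exact_of_hom_zero:
  assumes X: "X \<in> bounded_complexes" and z: "hom_zero D (Qo (stalk j)) (Qo X)"
  shows "cocycles X j \<subseteq> coboundaries X j"
proof
  fix x assume x: "x \<in> cocycles X j"
  have x': "x \<in> mcar (trm X j)" using x by (simp add: cocycles_def)
  note M = bounded_complex_terms(2)[OF X]
  let ?t = "stalk_map X j x"
  have t: "?t \<in> chain_maps (stalk j) X" using stalk_map_chain_map[OF X x] .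
  have "Qa (stalk j) X ?t = Qa (stalk j) X (\<lambda>n x. mzero (trm X n))"
    using hom_zeroD[OF z Q_hom[OF stalk_bounded X t]] Q_zero[OF stalk_bounded X] by simp
  then obtain Z s where Z: "Z \<in> bounded_complexes" and s: "quasi_iso Z (stalk j) s"
    and h: "homotopic Z X (\<lambda>n z. ?t n (s n z)) (\<lambda>n z. mzero (trm X n))"
    using Q_eq[OF stalk_bounded X t zero_chain_map[OF stalk_bounded X]] by blast
  obtain k where k: "\<And>n. k n \<in> mod_hom (trm Z n) (trm X (n - 1))"
    "\<And>n x. x \<in> mcar (trm Z n) \<Longrightarrow> ?t n (s n x) = madd (trm X n) (mzero (trm X n))
       (madd (trm X n) (dif X (n - 1) (k n x)) (k (n + 1) (dif Z n x)))"
    using h unfolding homotopic_def by blast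
  obtain z b where z: "z \<in> cocycles Z j" and b: "b \<in> coboundaries (stalk j) j"
    and e: "unit_vector 0 = madd (trm (stalk j) j) (s j z) b"
    using s unit_cocycle unfolding quasi_iso_def by blast
  have "b = (\<lambda>i. 0)" using b unfolding coboundaries_def by (auto simp: dif_stalk)
  then have sz: "s j z = unit_vector 0" using e by (simp add: trm_stalk)
  have z': "z \<in> mcar (trm Z j)" "dif Z j z = mzero (trm Z (j + 1))" using z by (auto simp: cocycles_def)
  have kz: "k j z \<in> mcar (trm X (j - 1))" using mod_hom_closed[OF k(1) z'(1)] .
  have dkz: "dif X (j - 1) (k j z) \<in> mcar (trm X j)"
    using mod_hom_closed[OF bounded_complex_terms(3)[OF X] kz] by simp
  have "k (j + 1) (mzero (trm Z (j + 1))) = mzero (trm X j)"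
    using mod_hom_mzero[OF bounded_complex_terms(2)[OF Z] M k(1), of "j + 1"] by simp
  then have "?t j (s j z) = dif X (j - 1) (k j z)"
    using k(2)[OF z'(1)] z'(2) madd_mzero[OF M dkz] mzero_madd[OF M dkz] by simp
  moreover have "?t j (s j z) = x" using sz mscl_one[OF M x'] by (simp add: stalk_map_def unit_vector_def)
  ultimately have "x = dif X (j - 1) (k j z)" by simp
  then show "x \<in> coboundaries X j" unfolding coboundaries_def using kz by (rule image_eqI)
qed

lemma shift_stalk: "isomorphic D (Qo (stalk (j - 1))) (fob S (Qo (stalk j)))"
  using shift_iso[OF stalk_bounded, of j] unfolding complex_shift_stalk isomorphic_def by blast

lemma stalk_obj: "Qo (stalk j) \<in> Obj D"
  using Q_obj[OF stalk_bounded] .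

text \<open>Morphisms from \<open>H\<close> in degree \<open>j\<close> compute the \<open>j\<close>-th cohomology.\<close>

definition cohomology_above :: "int \<Rightarrow> 'o \<Rightarrow> bool" where
  "cohomology_above p A \<longleftrightarrow> (\<forall>j < p. hom_zero D (Qo (stalk j)) A)"

lemma cohomology_bounded_below:
  assumes "A \<in> Obj D" obtains p where "cohomology_above p A"
proof -
  obtain X where X: "X \<in> bounded_complexes" "isomorphic D A (Qo X)" using Q_dense[OF assms] by blast
  obtain N where N: "\<And>n. \<bar>n\<bar> > N \<Longrightarrow> mcar (trm X n) = {mzero (trm X n)}"
    using X(1) unfolding bounded_complexes_def by blast
  have "hom_zero D (Qo (stalk j)) A" if "j < - N" for j
  proof -
    have "N < \<bar>j\<bar>" using that by linarith
    then show ?thesis using hom_zero_iso_right[OF X(2)] hom_zero_stalk[OF X(1) N] by blast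
  qed
  then show ?thesis using that[of "- N"] unfolding cohomology_above_def by blast
qed

end

section \<open>Vanishing over a hereditary algebra\<close>

locale hereditary_derived_category =
  hereditary_algebra scale + bounded_derived_category scale D S \<Delta> Qo Qa \<theta>
  for scale :: "'k::field \<Rightarrow> 'h::ring_1 \<Rightarrow> 'h"
    and D :: "('k, 'o, 'a) lincat" (structure)
    and S :: "('o, 'a, 'o, 'a) cat_functor" and \<Delta> :: "('a \<times> 'a \<times> 'a) set"
    and Qo :: "'h cochain_cx \<Rightarrow> 'o"
    and Qa :: "'h cochain_cx \<Rightarrow> 'h cochain_cx \<Rightarrow> 'h chmap \<Rightarrow> 'a"
    and \<theta> :: "'h cochain_cx \<Rightarrow> 'a"
begin

text \<open>The source of a fraction can be replaced by a complex with terms in degrees at least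
  \<open>m - 1\<close>, while the terms of \<open>Y\<close> live in degrees at most
  \<open>m - 2\<close>. The gap of two between the cohomology of \<open>X\<close> and the terms of
  \<open>Y\<close> reflects the vanishing of second extensions.\<close>

lemma hom_zero_exact_below:
  assumes X: "X \<in> bounded_complexes" and Y: "Y \<in> bounded_complexes"
    and exact: "\<And>i. i < m \<Longrightarrow> cocycles X i \<subseteq> coboundaries X i"
    and bound: "\<And>i. m - 2 < i \<Longrightarrow> mcar (trm Y i) = {mzero (trm Y i)}"
  shows "hom_zero D (Qo X) (Qo Y)"
proof (rule hom_zeroI_fraction[OF X Y])
  fix Z s f assume Z: "Z \<in> bounded_complexes" and s: "quasi_iso Z X s" and f: "f \<in> chain_maps Z Y"
  have s': "s \<in> chain_maps Z X" using s by (simp add: quasi_iso_def)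
  obtain W t where W: "W \<in> bounded_complexes" and t: "quasi_iso W Z t"
    and W0: "\<And>i. i < m - 1 \<Longrightarrow> mcar (trm W i) = {mzero (trm W i)}"
    using exact_below_replacement[OF Z quasi_iso_exact[OF Z X s exact]] by blast
  have t': "t \<in> chain_maps W Z" using t by (simp add: quasi_iso_def)
  have iso: "is_iso D (Qo W) (Qo X) (Qa W X (\<lambda>n x. s n (t n x)))"
    using Q_cmp[OF W Z X t' s'] iso_cmp[OF Q_quasi_iso[OF W Z t] Q_quasi_iso[OF Z X s]] by simp
  have "f n (t n w) = mzero (trm Y n)" if w: "w \<in> mcar (trm W n)" for n w
  proof (cases "n < m - 1")
    case True
    then have "w = mzero (trm W n)" using W0 w by blast
    then show ?thesis using chain_map_mzero[OF W Y chain_map_comp[OF t' f]] by simp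
  next
    case False
    have "f n (t n w) \<in> mcar (trm Y n)"
      using mod_hom_closed[OF chain_mapD(1)[OF chain_map_comp[OF t' f]] w] .
    then show ?thesis using bound[of n] False by simp
  qed
  then show "\<exists>W \<in> bounded_complexes. \<exists>t \<in> chain_maps W Z.
      is_iso D (Qo W) (Qo X) (Qa W X (\<lambda>n x. s n (t n x))) \<and>
      (\<forall>n. \<forall>w \<in> mcar (trm W n). f n (t n w) = mzero (trm Y n))"
    using W t' iso by blast
qed

lemma cohomology_above_hom_zero:
  assumes A: "A \<in> Obj D" "cohomology_above p A" and Y: "Y \<in> bounded_complexes"
    and bound: "\<And>i. p - 2 < i \<Longrightarrow> mcar (trm Y i) = {mzero (trm Y i)}"
  shows "hom_zero D A (Qo Y)"
proof -
  obtain X where X: "X \<in> bounded_complexes" "isomorphic D A (Qo X)" using Q_dense[OF A(1)] by blast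
  have "cocycles X i \<subseteq> coboundaries X i" if "i < p" for i
    using exact_of_hom_zero[OF X(1)] hom_zero_iso_right[OF X(2)] A(2) that unfolding cohomology_above_def by blast
  then have "hom_zero D (Qo X) (Qo Y)" using hom_zero_exact_below[OF X(1) Y _ bound] by blast
  then show ?thesis using hom_zero_iso_left[OF X(2)] by blast
qed

lemma cohomology_above_stalk:
  assumes "A \<in> Obj D" "cohomology_above p A" "j \<le> p - 2"
  shows "hom_zero D A (Qo (stalk j))"
  by (rule cohomology_above_hom_zero[OF assms(1,2) stalk_bounded])
    (use assms(3) in \<open>auto simp: trm_stalk fun_eq_iff\<close>)

end

section \<open>Powers of the cluster functor\<close>

locale hereditary_AR_category =
  hereditary_derived_category scale D S \<Delta> Qo Qa \<theta> + AR_category D S \<Delta> \<tau>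
  for scale :: "'k::field \<Rightarrow> 'h::ring_1 \<Rightarrow> 'h"
    and D :: "('k, 'o, 'a) lincat" (structure)
    and S :: "('o, 'a, 'o, 'a) cat_functor" and \<Delta> :: "('a \<times> 'a \<times> 'a) set"
    and Qo :: "'h cochain_cx \<Rightarrow> 'o"
    and Qa :: "'h cochain_cx \<Rightarrow> 'h cochain_cx \<Rightarrow> 'h chmap \<Rightarrow> 'a"
    and \<theta> :: "'h cochain_cx \<Rightarrow> 'a"
    and \<tau> :: "('o, 'a, 'o, 'a) cat_functor"
begin

text \<open>For \<open>B\<close> the inverse translate of \<open>A\<close>,
  \<open>\<tau> A = S B\<close>. So \<open>Hom (stalk j) B\<close> becomes, after one shift,
  \<open>Hom (stalk (j - 1)) (\<tau> A)\<close>, which by duality vanishes together with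
  \<open>Hom A (stalk (j - 2))\<close>. The latter is zero for \<open>j - 2 \<le> p - 2\<close>,
  that is, for \<open>j < p + 1\<close>.\<close>

lemma cohomology_above_pow_pred:
  assumes A: "A \<in> Obj D" "cohomology_above p A"
  shows "cohomology_above (p + 1) (orbit.pow (- 1) A)"
  unfolding cohomology_above_def
proof (intro allI impI)
  fix j assume j: "j < p + 1"
  let ?B = "orbit.pow (- 1) A" and ?G = "Qo (stalk j)"
  have B: "?B \<in> Obj D" using orbit.pow_obj[OF A(1)] .
  have "A = fob F ?B" using orbit.pow_Suc[OF A(1), of "- 1"] by simp
  then have tA: "fob \<tau> A = fob S ?B" using tau_F[OF B] by simp
  have SG: "fob S ?G \<in> Obj D" "fob S (fob S ?G) \<in> Obj D" using stalk_obj shift_obj by blast+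
  have SB: "fob S ?B \<in> Obj D" using shift_obj[OF B] .
  have i1: "isomorphic D (Qo (stalk (j - 1))) (fob S ?G)" using shift_stalk .
  have i2: "isomorphic D (Qo (stalk (j - 1 - 1))) (fob S (Qo (stalk (j - 1))))" by (rule shift_stalk)
  have "hom_zero D A (Qo (stalk (j - 1 - 1)))" using cohomology_above_stalk[OF A] j by simp
  then have "hom_zero D A (fob S (Qo (stalk (j - 1))))" using hom_zero_iso_right[OF i2] by blast
  then have "hom_zero D (Qo (stalk (j - 1))) (fob \<tau> A)" using AR_hom_zero[OF A(1) stalk_obj] by blast
  then have "hom_zero D (fob S ?G) (fob S ?B)" using hom_zero_iso_left[OF i1] tA by simp
  then show "hom_zero D ?G ?B" using shift_hom_zero[OF stalk_obj B] by blast
qed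

lemma cohomology_above_pow:
  assumes A: "A \<in> Obj D" "cohomology_above p A"
  shows "cohomology_above (p + int n) (orbit.pow (- int n) A)"
proof (induction n)
  case (Suc n)
  have "orbit.pow (- int (Suc n)) A = orbit.pow (- 1) (orbit.pow (- int n) A)"
    using orbit.pow_add[OF A(1), of "- 1" "- int n"] by simp
  moreover have "p + int (Suc n) = p + int n + 1" by simp
  ultimately show ?case using cohomology_above_pow_pred[OF orbit.pow_obj[OF A(1)] Suc.IH] by (simp only:)
qed (use A in simp)

lemma eventually_hom_zero_neg:
  assumes X: "X \<in> Obj D" and Y: "Y \<in> Obj D"
  obtains N where "\<And>i. i < N \<Longrightarrow> hom_zero D (orbit.pow i X) Y"
proof -
  obtain p where p: "cohomology_above p X" using cohomology_bounded_below[OF X] .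
  obtain Z where Z: "Z \<in> bounded_complexes" "isomorphic D Y (Qo Z)" using Q_dense[OF Y] by blast
  obtain b where b: "\<And>n. \<bar>n\<bar> > b \<Longrightarrow> mcar (trm Z n) = {mzero (trm Z n)}"
    using Z(1) unfolding bounded_complexes_def by blast
  \<comment> \<open>With \<open>i = - n\<close>, the cohomology of the translate starts at
    \<open>p + n\<close>, and the bound on \<open>i\<close> makes \<open>p + n - 2\<close> larger
    than \<open>b\<close>, beyond which \<open>Z\<close> has no terms. The minimum with 0 ensures
    that \<open>i\<close> is negative.\<close>
  have "hom_zero D (orbit.pow i X) Y" if i: "i < min 0 (p - b - 2)" for i
  proof -
    define n where "n = nat (- i)"
    have n: "i = - int n" using i n_def by simp
    have "hom_zero D (orbit.pow i X) (Qo Z)"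
      unfolding n
      by (rule cohomology_above_hom_zero[OF orbit.pow_obj[OF X] cohomology_above_pow[OF X p] Z(1)])
        (use b i n in auto)
    then show ?thesis using hom_zero_iso_right[OF Z(2)] by blast
  qed
  then show ?thesis using that by blast
qed

text \<open>The lower bound on the exponents is \<open>eventually_hom_zero_neg\<close>. The upper
  bound is the same statement after the reflection \<open>i \<mapsto> 1 - i\<close> of
  \<open>serre_pow\<close>, for which \<open>Y\<close> is written as a shift.\<close>

lemma finite_hom_nonzero:
  assumes X: "X \<in> Obj D" and Y: "Y \<in> Obj D"
  shows "finite {i. \<not> hom_zero D (orbit.pow i X) Y}"
proof -
  obtain Y' where Y': "Y' \<in> Obj D" "Y = fob S Y'" using shift_surj[OF Y] .
  obtain N where N: "\<And>i. i < N \<Longrightarrow> hom_zero D (orbit.pow i X) Y" using eventually_hom_zero_neg[OF X Y] by blast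
  obtain K where K: "\<And>i. i < K \<Longrightarrow> hom_zero D (orbit.pow i Y') (fob S X)"
    using eventually_hom_zero_neg[OF Y'(1) shift_obj[OF X]] by blast
  have "N \<le> i \<and> i \<le> 1 - K" if "\<not> hom_zero D (orbit.pow i X) Y" for i
  proof -
    have "\<not> hom_zero D (orbit.pow (1 - i) Y') (fob S X)" using that serre_pow[OF X Y'(1)] Y'(2) by simp
    then show ?thesis using N[of i] K[of "1 - i"] that by fastforce
  qed
  then have "{i. \<not> hom_zero D (orbit.pow i X) Y} \<subseteq> {N..1 - K}" by auto
  then show ?thesis using finite_subset by blast
qed

end


section \<open>The cluster category\<close>

lemma cluster_category_ext_symmetric:
  assumes "cluster_category_setting scale D S \<Delta> Qo Qa \<theta> \<tau> S' \<Delta>'"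
  shows "ext_symmetric_category (cluster_category D S \<tau>) S' \<Delta>'"
proof -
  interpret G: cluster_category_setting scale D S \<Delta> Qo Qa \<theta> \<tau> S' \<Delta>' by (rule assms)
  interpret H: hereditary_AR_category scale D S \<Delta> Qo Qa \<theta> \<tau>
    by unfold_locales (rule G.AR_translation)
  let ?C = "cluster_category D S \<tau>"
  have C: "?C = H.orbit.C" by (simp add: cluster_category_def)
  \<comment> \<open>Since the projection is a triangle functor, the shift of an orbit is, up to
    isomorphism, the orbit of a shift. Ext in the cluster category therefore unfolds into morphism
    spaces of \<open>D\<close>.\<close>
  obtain \<theta>' where iso: "\<And>X. X \<in> Obj D
      \<Longrightarrow> is_iso ?C (orbit D H.F (fob S X)) (fob S' (orbit D H.F X)) (\<theta>' X)"
    using G.projection_triangle_functor unfolding triangle_functor_def orbit_projection_def by auto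
  have ext: "hom_zero ?C U (fob S' V) \<longleftrightarrow>
      (\<forall>i. hom_zero D (H.orbit.pow i (orbit_rep U)) (fob S (orbit_rep V)))"
    if U: "U \<in> Obj ?C" and V: "V \<in> Obj ?C" for U V
  proof -
    have Y: "orbit_rep V \<in> Obj D" using H.orbit.orbit_rep_obj V C by simp
    have "isomorphic ?C (orbit D H.F (fob S (orbit_rep V))) (fob S' V)"
      using iso[OF Y] H.orbit.orbit_orbit_rep[of V] V unfolding isomorphic_def C by metis
    then have "hom_zero ?C U (fob S' V) \<longleftrightarrow> hom_zero ?C U (orbit D H.F (fob S (orbit_rep V)))"
      using G.C.hom_zero_iso_right by blast
    then show ?thesis using H.orbit.orbit_hom_zero_right[OF _ G.shift_obj[OF Y]] U C by simp
  qed
  show ?thesis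
  proof (unfold_locales)
    fix U V assume U: "U \<in> Obj ?C" and V: "V \<in> Obj ?C"
    have obj: "orbit_rep U \<in> Obj D" "orbit_rep V \<in> Obj D" using H.orbit.orbit_rep_obj U V C by simp_all
    show "finitely_spanned ?C U V"
      using H.orbit.orbit_finitely_spanned[of U V] H.finite_hom_nonzero[OF obj]
        H.hom_finitely_spanned[OF H.orbit.pow_obj[OF obj(1)] obj(2)] U V C by simp
    assume "hom_zero ?C U (fob S' V)"
    \<comment> \<open>The reflected exponents \<open>1 - i\<close> run through all integers with
      \<open>i\<close>, so each component of the reversed Ext has its dual among the vanishing
      ones.\<close>
    then have z: "hom_zero D (H.orbit.pow (1 - i) (orbit_rep U)) (fob S (orbit_rep V))" for i
      using ext[OF U V] by blast
    then show "hom_zero ?C V (fob S' U)"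
      using ext[OF V U] H.serre_pow[OF obj(2,1)] by blast
  qed
qed

theorem theorem6p8:
  fixes scale :: "'k::field \<Rightarrow> 'h::ring_1 \<Rightarrow> 'h"
    and D :: "('k, 'o, 'a) lincat"
    and S \<tau> :: "('o, 'a, 'o, 'a) cat_functor"
  assumes "cluster_category_setting scale D S \<Delta> Qo Qa \<theta> \<tau> S' \<Delta>'"
    and "C = cluster_category D S \<tau>"
    and "almost_complete_basic_tilting C S' T"
    and "complement C S' T M"
    and "minimal_right_approximation C T M B f"
    and "(g, f, h) \<in> \<Delta>'"
    and "is_triangle C S' M' B M (g, f, h)"
  shows "complement C S' T M' \<and> \<not> isomorphic C M' M"
proof -
  interpret ext_symmetric_category C S' \<Delta>'
    unfolding assms(2) by (rule cluster_category_ext_symmetric[OF assms(1)])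
  show ?thesis using exchange_complement[OF assms(3-7)] .
qed

end
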